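(* Let $R$ be an F-finite ring of prime characteristic $p$ and let $M$ be a finitely generated $R$-module. Then the limit $e_{HK}(M)=\lim_{e\to\infty}\mu_R(F^e_*M)/p^{e\gamma(R)}$ exists. Moreover, there is a constant $C\in\mathbb R$ such that for each $e\in\mathbb N$, $$e_{HK}(M)\leq \frac{\mu_R(F^e_*M)}{p^{e\gamma(R)}}+\frac{C}{p^e}.$$
   Context: All rings are commutative Noetherian with identity. For an $R$-module $M$ over a ring of prime characteristic $p$, $F^e_*M$ is $M$ viewed as an $R$-module by restriction of scalars along the $e$-th iterate of Frobenius $r\mapsto r^{p^e}$. $R$ is F-finite if $F^e_*R$ is a finitely generated $R$-module for some (equivalently all) $e\geq 1$. $\mu_R(N)$ is the minimal number of generators of a finitely generated $R$-module $N$. For $P\in\operatorname{Spec}(R)$ let $\kappa(P)=R_P/PR_P$ and $\alpha(P)=\log_{p^e}[F^e_*\kappa(P):\kappa(P)]$, which is independent of $e>0$. Let $\gamma(R)=\max\{\alpha(Q)\mid Q\in\operatorname{Min}(R)\}$, where $\operatorname{Min}(R)$ is the set of minimal primes of $R$. *)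

theory Defs
  imports
    "Jordan_Normal_Form.Missing_VectorSpace"
    "HOL-Algebra.Algebra"
begin

(* The additive order of one; ord is 0 when no positive multiple vanishes. *)
definition ring_char :: "('a, 'r) ring_scheme \<Rightarrow> nat" where
  "ring_char R = group.ord (add_monoid R) \<one>\<^bsub>R\<^esub>"

definition self_module :: "('a, 'r) ring_scheme \<Rightarrow> ('a, 'a) module" where
  "self_module R =
     \<lparr>carrier = carrier R, monoid.mult = monoid.mult R, one = \<one>\<^bsub>R\<^esub>,
      ring.zero = \<zero>\<^bsub>R\<^esub>, add = add R, smult = monoid.mult R\<rparr>"

(* The same abelian group, with r acting as its image under the e-th iterate of Frobenius.
   The mult and one fields of a module record play no role. *)
definition frob_push ::
  "('a, 'r) ring_scheme \<Rightarrow> nat \<Rightarrow> nat \<Rightarrow> ('a, 'b, 'm) module_scheme \<Rightarrow> ('a, 'b, 'm) module_scheme" where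
  "frob_push R p e M = M\<lparr>smult := \<lambda>r x. (r [^]\<^bsub>R\<^esub> (p ^ e)) \<odot>\<^bsub>M\<^esub> x\<rparr>"

definition fin_gen :: "('a, 'r) ring_scheme \<Rightarrow> ('a, 'b, 'm) module_scheme \<Rightarrow> bool" where
  "fin_gen R N \<longleftrightarrow> (\<exists>A. finite A \<and> A \<subseteq> carrier N \<and> LinearCombinations.module.span R N A = carrier N)"

(* Only meaningful for finitely generated N. *)
definition min_gens :: "('a, 'r) ring_scheme \<Rightarrow> ('a, 'b, 'm) module_scheme \<Rightarrow> nat" where
  "min_gens R N =
     (LEAST n. \<exists>A. finite A \<and> card A = n \<and> A \<subseteq> carrier N \<and> LinearCombinations.module.span R N A = carrier N)"

definition F_finite :: "('a, 'r) ring_scheme \<Rightarrow> nat \<Rightarrow> bool" where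
  "F_finite R p \<longleftrightarrow> (\<exists>e\<ge>1. fin_gen R (frob_push R p e (self_module R)))"

definition loc_rel :: "('a, 'r) ring_scheme \<Rightarrow> 'a set \<Rightarrow> (('a \<times> 'a) \<times> ('a \<times> 'a)) set" where
  "loc_rel R S = {((a, s), (b, t)). a \<in> carrier R \<and> b \<in> carrier R \<and> s \<in> S \<and> t \<in> S \<and>
     (\<exists>u\<in>S. u \<otimes>\<^bsub>R\<^esub> (t \<otimes>\<^bsub>R\<^esub> a) = u \<otimes>\<^bsub>R\<^esub> (s \<otimes>\<^bsub>R\<^esub> b))}"

definition loc_frac :: "('a, 'r) ring_scheme \<Rightarrow> 'a set \<Rightarrow> 'a \<Rightarrow> 'a \<Rightarrow> ('a \<times> 'a) set" where
  "loc_frac R S a s = loc_rel R S `` {(a, s)}"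

(* As for the quotient ring in the library, the operations are unions over all representatives;
   the sets united all coincide. *)
definition localization :: "('a, 'r) ring_scheme \<Rightarrow> 'a set \<Rightarrow> ('a \<times> 'a) set ring" where
  "localization R S =
     \<lparr>carrier = (carrier R \<times> S) // loc_rel R S,
      monoid.mult = (\<lambda>A B. \<Union>x\<in>A. \<Union>y\<in>B. loc_frac R S (fst x \<otimes>\<^bsub>R\<^esub> fst y) (snd x \<otimes>\<^bsub>R\<^esub> snd y)),
      one = loc_frac R S \<one>\<^bsub>R\<^esub> \<one>\<^bsub>R\<^esub>,
      ring.zero = loc_frac R S \<zero>\<^bsub>R\<^esub> \<one>\<^bsub>R\<^esub>,
      add = (\<lambda>A B. \<Union>x\<in>A. \<Union>y\<in>B.
               loc_frac R S ((snd y \<otimes>\<^bsub>R\<^esub> fst x) \<oplus>\<^bsub>R\<^esub> (snd x \<otimes>\<^bsub>R\<^esub> fst y)) (snd x \<otimes>\<^bsub>R\<^esub> snd y))\<rparr>"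

definition local_ring :: "('a, 'r) ring_scheme \<Rightarrow> 'a set \<Rightarrow> ('a \<times> 'a) set ring" where
  "local_ring R P = localization R (carrier R - P)"

(* The ideal generated by the image of P in the localization at P is P R_P. *)
definition residue_field :: "('a, 'r) ring_scheme \<Rightarrow> 'a set \<Rightarrow> ('a \<times> 'a) set set ring" where
  "residue_field R P =
     local_ring R P Quot
       (Idl\<^bsub>local_ring R P\<^esub> ((\<lambda>a. loc_frac R (carrier R - P) a \<one>\<^bsub>R\<^esub>) ` P))"

(* For a field K, the degree of F^e_* K over K; only meaningful when it is finite. *)
definition frob_degree :: "('a, 'r) ring_scheme \<Rightarrow> nat \<Rightarrow> nat \<Rightarrow> nat" where
  "frob_degree K p e = vectorspace.dim K (frob_push K p e (self_module K))"

(* The value common to all e > 0; it exists whenever the residue field is F-finite. *)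
definition frob_alpha :: "('a, 'r) ring_scheme \<Rightarrow> nat \<Rightarrow> 'a set \<Rightarrow> real" where
  "frob_alpha R p P =
     (THE a. \<forall>e>0. a = log (real (p ^ e)) (real (frob_degree (residue_field R P) p e)))"

definition min_primes :: "('a, 'r) ring_scheme \<Rightarrow> 'a set set" where
  "min_primes R = {P. primeideal P R \<and> (\<forall>Q. primeideal Q R \<longrightarrow> Q \<subseteq> P \<longrightarrow> Q = P)}"

(* Min(R) is finite and nonempty for a nonzero Noetherian ring, so Max is a genuine maximum. *)
definition frob_gamma :: "('a, 'r) ring_scheme \<Rightarrow> nat \<Rightarrow> real" where
  "frob_gamma R p = Max (frob_alpha R p ` min_primes R)"

definition e_HK :: "('a, 'r) ring_scheme \<Rightarrow> nat \<Rightarrow> ('a, 'b, 'm) module_scheme \<Rightarrow> real" where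
  "e_HK R p M =
     lim (\<lambda>e. real (min_gens R (frob_push R p e M)) / real p powr (real e * frob_gamma R p))"

end

theory Submission
  imports Defs
begin

text \<open>
  If \<open>R\<close> is reduced, the module \<open>M\<close> is generically a direct sum of copies of the rings \<open>R / P\<close>, \<open>P\<close> a minimal prime, and
  \<open>F\<^sub>*(R / P)\<close> has rank \<open>p\<^bsup>\<alpha>(P)\<^esup> \<le> p\<^bsup>\<gamma>\<^esup>\<close>. Hence there are \<open>p\<^bsup>\<gamma>\<^esup>\<close> maps \<open>M \<rightarrow> F\<^sub>*M\<close> whose images generate a submodule containing
  \<open>J F\<^sub>*M\<close> for an ideal \<open>J\<close> contained in no minimal prime. Applying \<open>F\<^sup>e\<^sub>*\<close> gives
  \<open>\<mu>(F\<^bsup>e+1\<^esup>\<^sub>*M) \<le> p\<^bsup>\<gamma>\<^esup> \<mu>(F\<^sup>e\<^sub>*M) + \<mu>(F\<^bsup>e+1\<^esup>\<^sub>*(M / JM))\<close>, and the error term is \<open>O(p\<^bsup>e(\<gamma>-1)\<^esup>)\<close>. So the normalized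
  sequence becomes decreasing after adding a suitable multiple of \<open>p\<^bsup>-e\<^esup>\<close>.

  The bound on the error term needs \<open>\<alpha>(Q) + 1 \<le> \<alpha>(P)\<close> for primes \<open>P \<subset> Q\<close>. For \<open>Q\<close> minimal over \<open>P + (x)\<close> this follows by
  comparing, at \<open>Q\<close>, the length of \<open>F\<^sup>e\<^sub>*(R / (P + x\<^sup>q))\<close>, \<open>q = p\<^sup>e\<close>, which is at least \<open>q p\<^bsup>e\<alpha>(Q)\<^esup>\<close>, with a
  constant multiple of \<open>\<mu>(F\<^sup>e\<^sub>*(R / P))\<close>.
\<close>

text \<open>All the modules F^e_*M share one underlying set, so different exponents are compared
  inside M itself: a claim about F^e_* is carried to F^(e+f)_* by inverse images under maps such as
  c x^(p^f), and no new type is needed for a push-forward. Localization is avoided in the same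
  spirit: a statement at a prime Q is one that holds after multiplication by s^q for some s outside
  Q.

  The number p^\<alpha>(Q) enters as the natural number \<open>rank Q\<close>, counted by bases
  lifted to R; only at the end is it identified with the degree of the residue field. Minimal primes
  of smaller rank do no harm, since their coefficient lists are padded with zeros up to length
  p^\<gamma>.

  The difficulty is a circle: the drop of the rank above P needs an upper bound for \<mu>(F^e_*(R /
  P)), and that bound has an error term whose size depends on the drop. The way out is that only
  exponential rates are compared, so a crude bound with base \<rho> slightly too large suffices for
  the drop, and the drop then yields the sharp bound.\<close>

lemma self_module_simps [simp]:
  "carrier (self_module R) = carrier R"
  "add (self_module R) = add R"
  "\<zero>\<^bsub>self_module R\<^esub> = \<zero>\<^bsub>R\<^esub>"
  "smult (self_module R) = monoid.mult R"
  by (simp_all add: self_module_def)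

lemma (in cring) self_module_module: "Module.module R (self_module R)"
proof (rule moduleI)
  show "abelian_group (self_module R)"
    by (rule abelian_groupI) (auto simp: a_ac intro: l_neg add.l_inv_ex)
qed (auto simp: l_distr r_distr m_assoc is_cring)

lemma frob_push_simps [simp]:
  "carrier (frob_push R p e M) = carrier M"
  "add (frob_push R p e M) = add M"
  "\<zero>\<^bsub>frob_push R p e M\<^esub> = \<zero>\<^bsub>M\<^esub>"
  "r \<odot>\<^bsub>frob_push R p e M\<^esub> x = (r [^]\<^bsub>R\<^esub> (p ^ e)) \<odot>\<^bsub>M\<^esub> x"
  by (simp_all add: frob_push_def)

lemma (in cring) one_notin_prime: "primeideal P R \<Longrightarrow> \<one> \<in> carrier R - P"
  using primeideal.I_notcarr ideal.one_imp_carrier[OF primeideal.axioms(1)] by fastforce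

text \<open>Reversed strict inclusion is well-founded on ideals: an infinite ascending chain would
  have a union equal to one of its terms, against strictness.\<close>

lemma (in noetherian_ring) ideal_induct [consumes 1, case_names step]:
  assumes I: "ideal I R"
    and step: "\<And>I. ideal I R \<Longrightarrow> (\<And>J. ideal J R \<Longrightarrow> I \<subset> J \<Longrightarrow> P J) \<Longrightarrow> P I"
  shows "P I"
proof -
  let ?r = "{(J, I). ideal I R \<and> ideal J R \<and> I \<subset> J}"
  have "wf ?r"
  proof (unfold wf_iff_no_infinite_down_chain, rule notI)
    assume "\<exists>f. \<forall>i. (f (Suc i), f i) \<in> ?r"
    then obtain f where f: "\<And>i. ideal (f i) R" "\<And>i. f i \<subset> f (Suc i)" by blast
    have "mono f" by (rule monoI[OF lift_Suc_mono_le[of f]]) (use f(2) in auto)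
    then have "f i \<subseteq> f j \<or> f j \<subseteq> f i" for i j
      using monoD[of f i j] monoD[of f j i] linear[of i j] by blast
    then have "subset.chain {I. ideal I R} (range f)"
      unfolding subset_chain_def using f(1) by blast
    from ideal_chain_is_trivial[OF _ this] obtain n where "\<Union>(range f) = f n" by auto
    with f(2)[of n] show False by blast
  qed
  then show ?thesis using I
    by (induction I rule: wf_induct_rule) (use step in blast)
qed

subsection \<open>Submodules and generators of Frobenius push-forwards\<close>

text \<open>For \<open>q = p ^ e\<close>, \<open>qsub R q M\<close> describes the \<open>R\<close>-submodules of \<open>F\<^sup>e\<^sub>*M\<close> as subsets of \<open>M\<close>, and
  \<open>qgen R q M I n\<close> says that the quotient of \<open>F\<^sup>e\<^sub>*M\<close> by the submodule generated by \<open>I\<close> has \<open>n\<close> generators.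
  No quotient module is ever formed.\<close>

definition qsub :: "('a, 'r) ring_scheme \<Rightarrow> nat \<Rightarrow> ('a, 'b, 'm) module_scheme \<Rightarrow> 'b set \<Rightarrow> bool" where
  "qsub R q M U \<longleftrightarrow> U \<subseteq> carrier M \<and> \<zero>\<^bsub>M\<^esub> \<in> U \<and> (\<forall>x\<in>U. \<forall>y\<in>U. x \<oplus>\<^bsub>M\<^esub> y \<in> U) \<and>
     (\<forall>r\<in>carrier R. \<forall>x\<in>U. (r [^]\<^bsub>R\<^esub> q) \<odot>\<^bsub>M\<^esub> x \<in> U)"

definition qhull :: "('a, 'r) ring_scheme \<Rightarrow> nat \<Rightarrow> ('a, 'b, 'm) module_scheme \<Rightarrow> 'b set \<Rightarrow> 'b set" where
  "qhull R q M A = \<Inter>{U. qsub R q M U \<and> A \<subseteq> U}"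

definition qgen :: "('a, 'r) ring_scheme \<Rightarrow> nat \<Rightarrow> ('a, 'b, 'm) module_scheme \<Rightarrow> 'b set \<Rightarrow> nat \<Rightarrow> bool" where
  "qgen R q M I n \<longleftrightarrow>
     (\<exists>A. finite A \<and> card A \<le> n \<and> A \<subseteq> carrier M \<and> carrier M \<subseteq> qhull R q M (I \<union> A))"

lemma qsubI:
  assumes "U \<subseteq> carrier M" "\<zero>\<^bsub>M\<^esub> \<in> U" "\<And>x y. x \<in> U \<Longrightarrow> y \<in> U \<Longrightarrow> x \<oplus>\<^bsub>M\<^esub> y \<in> U"
    "\<And>r x. r \<in> carrier R \<Longrightarrow> x \<in> U \<Longrightarrow> (r [^]\<^bsub>R\<^esub> q) \<odot>\<^bsub>M\<^esub> x \<in> U"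
  shows "qsub R q M U"
  using assms by (auto simp: qsub_def)

lemma qsubD:
  assumes "qsub R q M U"
  shows "U \<subseteq> carrier M" "\<zero>\<^bsub>M\<^esub> \<in> U" "\<And>x y. x \<in> U \<Longrightarrow> y \<in> U \<Longrightarrow> x \<oplus>\<^bsub>M\<^esub> y \<in> U"
    "\<And>r x. r \<in> carrier R \<Longrightarrow> x \<in> U \<Longrightarrow> (r [^]\<^bsub>R\<^esub> q) \<odot>\<^bsub>M\<^esub> x \<in> U"
  using assms by (auto simp: qsub_def)

lemma qhull_superset: "A \<subseteq> qhull R q M A"
  by (auto simp: qhull_def)

lemma qhull_base: "a \<in> A \<Longrightarrow> a \<in> qhull R q M A"
  by (auto simp: qhull_def)

lemma qhull_least: "qsub R q M U \<Longrightarrow> A \<subseteq> U \<Longrightarrow> qhull R q M A \<subseteq> U"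
  by (auto simp: qhull_def)

lemma qhull_mono: "A \<subseteq> B \<Longrightarrow> qhull R q M A \<subseteq> qhull R q M B"
  by (auto simp: qhull_def)

lemma qhull_qsub_eq: "qsub R q M U \<Longrightarrow> qhull R q M U = U"
  by (intro equalityI qhull_least qhull_superset) auto

context Module.module
begin

lemma qsub_carrier: "qsub R q M (carrier M)"
  by (rule qsubI) auto

lemma qhull_carrier: "A \<subseteq> carrier M \<Longrightarrow> qhull R q M A \<subseteq> carrier M"
  by (rule qhull_least[OF qsub_carrier])

lemma qsub_qhull: "A \<subseteq> carrier M \<Longrightarrow> qsub R q M (qhull R q M A)"
  using qhull_carrier[of A q] by (intro qsubI) (auto simp: qhull_def qsub_def)

text \<open>A (q q')-th power is the q-th power of a q'-th power, so closure under q-th powers is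
  the stronger condition. Hence generators of F^e_*R with \<open>e \<ge> 1\<close> also generate
  F_*R.\<close>

lemma qhull_mult_mono:
  assumes "A \<subseteq> carrier M"
  shows "qhull R (q * q') M A \<subseteq> qhull R q M A"
proof (rule qhull_least[OF _ qhull_superset])
  note h = qsubD[OF qsub_qhull[OF assms, of q]]
  have "r [^] (q * q') = (r [^] q') [^] q" if "r \<in> carrier R" for r
    using that by (simp add: R.nat_pow_pow mult.commute)
  then show "qsub R (q * q') M (qhull R q M A)"
    using h by (intro qsubI) auto
qed

lemma smult_diff_l:
  "\<lbrakk>a \<in> carrier R; b \<in> carrier R; x \<in> carrier M\<rbrakk> \<Longrightarrow> (a \<ominus> b) \<odot>\<^bsub>M\<^esub> x = a \<odot>\<^bsub>M\<^esub> x \<ominus>\<^bsub>M\<^esub> b \<odot>\<^bsub>M\<^esub> x"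
  by (simp add: a_minus_def smult_l_distr smult_l_minus)

lemma span_least:
  assumes "A \<subseteq> U" "U \<subseteq> carrier M" "\<zero>\<^bsub>M\<^esub> \<in> U"
    "\<And>x y. x \<in> U \<Longrightarrow> y \<in> U \<Longrightarrow> x \<oplus>\<^bsub>M\<^esub> y \<in> U"
    "\<And>r x. r \<in> carrier R \<Longrightarrow> x \<in> U \<Longrightarrow> r \<odot>\<^bsub>M\<^esub> x \<in> U"
  shows "span A \<subseteq> U"
  by (rule span_is_subset) (use assms in \<open>auto intro!: submodule.intro module_axioms\<close>)

end

text \<open>Two exponents are allowed because a p-linear map of M is linear from F^e_*M to
  F^(e+1)_*M. Preservation of zero follows from additivity by cancellation.\<close>

lemma (in Module.module) qsub_vimage:
  assumes "Module.module R N" and f: "f \<in> carrier M \<rightarrow> carrier N"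
    and add: "\<And>x y. x \<in> carrier M \<Longrightarrow> y \<in> carrier M \<Longrightarrow> f (x \<oplus>\<^bsub>M\<^esub> y) = f x \<oplus>\<^bsub>N\<^esub> f y"
    and smult: "\<And>r x. r \<in> carrier R \<Longrightarrow> x \<in> carrier M \<Longrightarrow> f ((r [^] q) \<odot>\<^bsub>M\<^esub> x) = (r [^] q') \<odot>\<^bsub>N\<^esub> f x"
    and U: "qsub R q' N U"
  shows "qsub R q M {x \<in> carrier M. f x \<in> U}"
proof -
  interpret N: Module.module R N by fact
  have "f \<zero>\<^bsub>M\<^esub> \<oplus>\<^bsub>N\<^esub> f \<zero>\<^bsub>M\<^esub> = f \<zero>\<^bsub>M\<^esub>" "f \<zero>\<^bsub>M\<^esub> \<in> carrier N"
    using add[of "\<zero>\<^bsub>M\<^esub>" "\<zero>\<^bsub>M\<^esub>"] f by auto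
  then have "f \<zero>\<^bsub>M\<^esub> = \<zero>\<^bsub>N\<^esub>" by (metis N.add.r_cancel_one')
  then show ?thesis
    using qsubD[OF U] by (intro qsubI) (auto simp: add smult)
qed

section \<open>The Frobenius in prime characteristic\<close>

locale frob = cring R for R (structure) +
  fixes p :: nat
  assumes prime_p: "Factorial_Ring.prime p" and char_p: "ring_char R = p"

locale frob_module = frob R p + Module.module R M for R (structure) and p and M (structure)

context frob
begin

lemma p_gt_1: "p > 1" using prime_p by (rule prime_gt_1_nat)

lemma add_pow_p: "a \<in> carrier R \<Longrightarrow> add_pow R (p * k) a = \<zero>"
proof -
  assume a: "a \<in> carrier R"
  have "add_pow R p \<one> = \<zero>"
    using char_p unfolding ring_char_def by (metis add.pow_ord_eq_1 one_closed)
  then have "add_pow R p a = \<zero>" if "a \<in> carrier R" for a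
    using add_pow_ldistr[of \<one> a p] that by simp
  then show ?thesis using a
    by (simp add: add.nat_pow_pow[symmetric] mult.commute[of p k])
qed

lemma char_one_not_zero: "\<one> \<noteq> \<zero>"
proof
  assume 1: "\<one> = \<zero>"
  have 2: "group.ord (add_monoid R) \<one> = 1"
    by (rule iffD2[OF add.ord_eq_1[OF one_closed] 1])
  have 3: "p = group.ord (add_monoid R) \<one>" by (rule char_p[unfolded ring_char_def, symmetric])
  have 4: "p = 1" by (rule trans[OF 3 2])
  show False using p_gt_1[unfolded 4] by simp
qed
text \<open>Pascal's rule summed over k. In the induction for the binomial theorem,
  \<open>f k\<close> is a^k b^(n+1-k); multiplying the old terms by a shifts the index, multiplying
  by b does not.\<close>

lemma finsum_choose_Suc:
  assumes f: "\<And>k. f k \<in> carrier R"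
  shows "(\<Oplus>k\<in>{..n}. add_pow R (n choose k) (f (Suc k))) \<oplus> (\<Oplus>k\<in>{..n}. add_pow R (n choose k) (f k))
    = (\<Oplus>k\<in>{..Suc n}. add_pow R (Suc n choose k) (f k))"
proof -
  have c: "(\<lambda>k. add_pow R (h k) (f (g k))) \<in> A \<rightarrow> carrier R" for h g :: "nat \<Rightarrow> nat" and A
    using f by auto
  note c' = c[of _ "\<lambda>k. k"]
  define u where "u = (\<Oplus>k\<in>{..n}. add_pow R (n choose k) (f (Suc k)))"
  define v where "v = (\<Oplus>k\<in>{..n}. add_pow R (n choose Suc k) (f (Suc k)))"
  have uv: "u \<in> carrier R" "v \<in> carrier R"
    unfolding u_def v_def by (rule finsum_closed[OF c])+
  have "(\<Oplus>k\<in>{..Suc n}. add_pow R (Suc n choose k) (f k))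
      = (\<Oplus>k\<in>{..n}. add_pow R (Suc n choose Suc k) (f (Suc k))) \<oplus> add_pow R (Suc n choose 0) (f 0)"
    by (rule finsum_Suc2[OF c'])
  also have "(\<Oplus>k\<in>{..n}. add_pow R (Suc n choose Suc k) (f (Suc k)))
      = (\<Oplus>k\<in>{..n}. add_pow R (n choose k) (f (Suc k)) \<oplus> add_pow R (n choose Suc k) (f (Suc k)))"
    using f by (intro finsum_cong') (auto simp: add.nat_pow_mult)
  also have "\<dots> = u \<oplus> v"
    unfolding u_def v_def by (rule finsum_addf[OF c c])
  finally have 1: "(\<Oplus>k\<in>{..Suc n}. add_pow R (Suc n choose k) (f k)) = u \<oplus> v \<oplus> f 0"
    using f by simp
  have "(\<Oplus>k\<in>{..Suc n}. add_pow R (n choose k) (f k)) = v \<oplus> add_pow R (n choose 0) (f 0)"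
    unfolding v_def by (rule finsum_Suc2[OF c'])
  moreover have "(\<Oplus>k\<in>{..Suc n}. add_pow R (n choose k) (f k))
      = add_pow R (n choose Suc n) (f (Suc n)) \<oplus> (\<Oplus>k\<in>{..n}. add_pow R (n choose k) (f k))"
    by (rule finsum_Suc[OF c'])
  moreover have "(\<Oplus>k\<in>{..n}. add_pow R (n choose k) (f k)) \<in> carrier R"
    by (rule finsum_closed[OF c'])
  ultimately have 2: "(\<Oplus>k\<in>{..n}. add_pow R (n choose k) (f k)) = v \<oplus> f 0"
    using f by (simp add: binomial_eq_0)
  show ?thesis using 1 2 uv f by (simp add: u_def[symmetric] a_assoc)
qed

lemma binomial_expansion:
  assumes a: "a \<in> carrier R" and b: "b \<in> carrier R"
  shows "(a \<oplus> b) [^] n = (\<Oplus>k\<in>{..n}. add_pow R (n choose k) (a [^] k \<otimes> b [^] (n - k)))"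
proof (induction n)
  case 0
  show ?case by simp
next
  case (Suc n)
  let ?t = "\<lambda>k. a [^] k \<otimes> b [^] (Suc n - k)"
  let ?s = "\<lambda>k. add_pow R (n choose k) (a [^] k \<otimes> b [^] (n - k))"
  have s: "?s \<in> {..n} \<rightarrow> carrier R" using a b by auto
  have 1: "?s k \<otimes> a = add_pow R (n choose k) (?t (Suc k))" for k
    using a b by (simp add: add_pow_ldistr, simp add: m_ac)
  have 2: "?s k \<otimes> b = add_pow R (n choose k) (?t k)" if "k \<le> n" for k
    using a b that by (simp add: add_pow_ldistr m_assoc Suc_diff_le)
  have "(a \<oplus> b) [^] Suc n = finsum R ?s {..n} \<otimes> a \<oplus> finsum R ?s {..n} \<otimes> b"
    unfolding nat_pow_Suc Suc using a b finsum_closed[OF s] by (rule r_distr)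
  also have "finsum R ?s {..n} \<otimes> a = (\<Oplus>k\<in>{..n}. ?s k \<otimes> a)"
    by (rule finsum_ldistr[OF _ a s]) simp
  also have "\<dots> = (\<Oplus>k\<in>{..n}. add_pow R (n choose k) (?t (Suc k)))"
    by (rule finsum_cong') (use a b 1 in auto)
  also have "finsum R ?s {..n} \<otimes> b = (\<Oplus>k\<in>{..n}. ?s k \<otimes> b)"
    by (rule finsum_ldistr[OF _ b s]) simp
  also have "\<dots> = (\<Oplus>k\<in>{..n}. add_pow R (n choose k) (?t k))"
    by (rule finsum_cong') (use a b 2 in auto)
  also have "(\<Oplus>k\<in>{..n}. add_pow R (n choose k) (?t (Suc k))) \<oplus> (\<Oplus>k\<in>{..n}. add_pow R (n choose k) (?t k))
      = (\<Oplus>k\<in>{..Suc n}. add_pow R (Suc n choose k) (?t k))"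
    by (rule finsum_choose_Suc) (use a b in auto)
  finally show ?case .
qed

lemma frob_add1:
  assumes "a \<in> carrier R" "b \<in> carrier R"
  shows "(a \<oplus> b) [^] p = a [^] p \<oplus> b [^] p"
proof -
  have p0: "p \<noteq> 0" using p_gt_1 by simp
  let ?t = "\<lambda>k. add_pow R (p choose k) ((a [^] k \<otimes> b [^] (p - k)))"
  have c: "?t k \<in> carrier R" for k using assms by simp
  have z: "?t k = \<zero>" if "k \<in> {..p} - {0, p}" for k
  proof -
    have "p dvd (p choose k)" using that prime_p p0 by (intro dvd_choose_prime) auto
    then obtain j where "p choose k = p * j" by auto
    then show ?thesis using assms add_pow_p by simp
  qed
  have "(a \<oplus> b) [^] p = (\<Oplus>k\<in>{..p}. ?t k)" using assms by (rule binomial_expansion)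
  also have "\<dots> = (\<Oplus>k\<in>{0, p}. ?t k)"
    by (rule add.finprod_mono_neutral_cong_right) (use z c in auto)
  also have "\<dots> = a [^] p \<oplus> b [^] p"
    using p0 assms by (simp add: a_comm)
  finally show ?thesis .
qed

lemma frob_add:
  assumes "a \<in> carrier R" "b \<in> carrier R"
  shows "(a \<oplus> b) [^] (p ^ e) = a [^] (p ^ e) \<oplus> b [^] (p ^ e)"
proof (induction e)
  case 0
  show ?case using assms by simp
next
  case (Suc e)
  have "(a \<oplus> b) [^] (p ^ Suc e) = ((a \<oplus> b) [^] (p ^ e)) [^] p"
    using assms by (simp add: nat_pow_pow mult.commute)
  also have "\<dots> = (a [^] (p ^ e)) [^] p \<oplus> (b [^] (p ^ e)) [^] p"
    using assms by (simp add: Suc frob_add1)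
  finally show ?case using assms by (simp add: nat_pow_pow mult.commute)
qed

lemma zero_pow: "\<zero> [^] (p ^ e) = \<zero>"
  using p_gt_1 by (simp add: nat_pow_zero)

lemma frob_minus:
  assumes "a \<in> carrier R"
  shows "(\<ominus> a) [^] (p ^ e) = \<ominus> (a [^] (p ^ e))"
proof -
  have "(\<ominus> a) [^] (p ^ e) \<oplus> a [^] (p ^ e) = \<zero>"
    using assms by (simp add: frob_add[symmetric] l_neg zero_pow)
  then show ?thesis using assms by (metis a_inv_closed minus_equality nat_pow_closed)
qed

lemma frob_diff:
  "a \<in> carrier R \<Longrightarrow> b \<in> carrier R \<Longrightarrow> (a \<ominus> b) [^] (p ^ e) = a [^] (p ^ e) \<ominus> b [^] (p ^ e)"
  by (simp add: a_minus_def frob_add frob_minus)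

lemma frob_pow: "a \<in> carrier R \<Longrightarrow> (a [^] (p ^ e)) [^] (p ^ f) = a [^] (p ^ (e + f))"
  by (simp add: nat_pow_pow power_add)

lemma frob_module_self: "frob_module R p (self_module R)"
  by (intro frob_module.intro frob_axioms self_module_module)

end

section \<open>Push-forwards as modules and their numbers of generators\<close>

context frob_module
begin

lemma frob_push_module: "Module.module R (frob_push R p e M)"
proof (rule moduleI)
  show "abelian_group (frob_push R p e M)"
    by (rule abelian_groupI) (auto simp: M.a_ac intro: M.l_neg M.add.l_inv_ex)
qed (auto simp: frob_add smult_l_distr smult_r_distr nat_pow_distrib smult_assoc1 is_cring)

text \<open>Links linear combinations to \<open>qhull\<close>. The minimality
  \<open>qhull_least\<close> then replaces computations with combinations: a property of a span is
  proved by exhibiting a submodule that contains the generators.\<close>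

lemma span_frob_push:
  assumes "A \<subseteq> carrier M"
  shows "LinearCombinations.module.span R (frob_push R p e M) A = qhull R (p ^ e) M A"
proof -
  interpret N: Module.module R "frob_push R p e M" by (rule frob_push_module)
  have A: "A \<subseteq> carrier (frob_push R p e M)" using assms by simp
  show ?thesis
  proof
    show "N.span A \<subseteq> qhull R (p ^ e) M A"
      using qsubD[OF qsub_qhull[OF assms]] qhull_superset[of A R "p ^ e" M]
      by (intro N.span_least) auto
    show "qhull R (p ^ e) M A \<subseteq> N.span A"
    proof (rule qhull_least)
      show "A \<subseteq> N.span A" by (rule N.in_own_span[OF A])
      show "qsub R (p ^ e) M (N.span A)"
        using N.span_is_submodule[OF A] unfolding submodule_def qsub_def by auto
    qed
  qed
qed

lemma min_gens_le:
  assumes "qgen R (p ^ e) M {} n"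
  shows "min_gens R (frob_push R p e M) \<le> n"
proof -
  from assms obtain A where A: "finite A" "card A \<le> n" "A \<subseteq> carrier M" "carrier M \<subseteq> qhull R (p ^ e) M A"
    by (auto simp: qgen_def)
  have "min_gens R (frob_push R p e M) \<le> card A"
    unfolding min_gens_def
    by (rule Least_le, rule exI[of _ A])
      (use A span_frob_push[OF A(3), of e] qhull_carrier[OF A(3), of "p ^ e"] in auto)
  then show ?thesis using A by simp
qed

text \<open>Some finite generating set must be known for the \<open>LEAST\<close> in
  \<open>min_gens\<close> to be attained; this is what the arbitrary n supplies.\<close>

lemma qgen_min_gens:
  assumes "qgen R (p ^ e) M {} n"
  shows "qgen R (p ^ e) M {} (min_gens R (frob_push R p e M))"
proof -
  from assms obtain A where A: "finite A" "A \<subseteq> carrier M" "carrier M \<subseteq> qhull R (p ^ e) M A"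
    by (auto simp: qgen_def)
  let ?P = "\<lambda>n. \<exists>A. finite A \<and> card A = n \<and> A \<subseteq> carrier (frob_push R p e M)
     \<and> LinearCombinations.module.span R (frob_push R p e M) A = carrier (frob_push R p e M)"
  have "?P (card A)" using A span_frob_push[OF A(2), of e] qhull_carrier[OF A(2), of "p ^ e"]
    by (intro exI[of _ A]) auto
  then have "?P (LEAST n. ?P n)" by (rule LeastI)
  then obtain B where "finite B" "card B = min_gens R (frob_push R p e M)" "B \<subseteq> carrier M"
      "LinearCombinations.module.span R (frob_push R p e M) B = carrier M"
    unfolding min_gens_def by auto
  then show ?thesis unfolding qgen_def using span_frob_push by (intro exI[of _ B]) simp
qed

lemma fin_gen_frob_push:
  "fin_gen R (frob_push R p e M) \<longleftrightarrow> (\<exists>n. qgen R (p ^ e) M {} n)"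
proof -
  have "LinearCombinations.module.span R (frob_push R p e M) A = carrier M \<longleftrightarrow> carrier M \<subseteq> qhull R (p ^ e) M A"
    if "A \<subseteq> carrier M" for A
    using span_frob_push[OF that] qhull_carrier[OF that] by auto
  then have "fin_gen R (frob_push R p e M) \<longleftrightarrow>
      (\<exists>A. finite A \<and> A \<subseteq> carrier M \<and> carrier M \<subseteq> qhull R (p ^ e) M A)"
    unfolding fin_gen_def by auto
  then show ?thesis unfolding qgen_def by auto
qed

text \<open>\<open>qsub\<close> does not demand closure under negation: it comes from the scalar -1,
  whose p^e-th power is again -1 in characteristic p, also for p = 2.\<close>

lemma qsub_neg: "qsub R (p ^ e) M U \<Longrightarrow> x \<in> U \<Longrightarrow> \<ominus>\<^bsub>M\<^esub> x \<in> U"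
  using qsubD(4)[of R "p ^ e" M U "\<ominus> \<one>" x] qsubD(1)[of R "p ^ e" M U]
  by (auto simp: frob_minus smult_l_minus)

lemma qsub_diff: "qsub R (p ^ e) M U \<Longrightarrow> x \<in> U \<Longrightarrow> y \<in> U \<Longrightarrow> x \<ominus>\<^bsub>M\<^esub> y \<in> U"
  by (simp add: a_minus_def qsub_neg qsubD(3))

lemma qsub_cancel:
  assumes "qsub R (p ^ e) M U" "x \<oplus>\<^bsub>M\<^esub> y \<in> U" "y \<in> U" "x \<in> carrier M"
  shows "x \<in> U"
proof -
  have "y \<in> carrier M" using assms qsubD(1) by blast
  then have "(x \<oplus>\<^bsub>M\<^esub> y) \<ominus>\<^bsub>M\<^esub> y = x" using assms(4) by (simp add: M.minus_eq M.a_assoc M.r_neg)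
  then show ?thesis using qsub_diff[OF assms(1,2,3)] by simp
qed

lemma qsub_sum:
  assumes U: "qsub R (p ^ e) M U" and Y: "qsub R (p ^ e) M Y"
  shows "qsub R (p ^ e) M {x \<oplus>\<^bsub>M\<^esub> y |x y. x \<in> U \<and> y \<in> Y}"
proof (rule qsubI)
  note cX = qsubD[OF U] and cY = qsubD[OF Y]
  show "{x \<oplus>\<^bsub>M\<^esub> y |x y. x \<in> U \<and> y \<in> Y} \<subseteq> carrier M" using cX(1) cY(1) by auto
  show "\<zero>\<^bsub>M\<^esub> \<in> {x \<oplus>\<^bsub>M\<^esub> y |x y. x \<in> U \<and> y \<in> Y}" using cX(2) cY(2) M.l_zero M.zero_closed by force
  fix u v assume "u \<in> {x \<oplus>\<^bsub>M\<^esub> y |x y. x \<in> U \<and> y \<in> Y}" "v \<in> {x \<oplus>\<^bsub>M\<^esub> y |x y. x \<in> U \<and> y \<in> Y}"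
  then obtain x y x' y' where h: "u = x \<oplus>\<^bsub>M\<^esub> y" "v = x' \<oplus>\<^bsub>M\<^esub> y'" "x \<in> U" "y \<in> Y" "x' \<in> U" "y' \<in> Y" by auto
  have car: "x \<in> carrier M" "y \<in> carrier M" "x' \<in> carrier M" "y' \<in> carrier M" using h cX(1) cY(1) by auto
  have "u \<oplus>\<^bsub>M\<^esub> v = (x \<oplus>\<^bsub>M\<^esub> x') \<oplus>\<^bsub>M\<^esub> (y \<oplus>\<^bsub>M\<^esub> y')" using car by (simp add: h M.a_ac)
  then show "u \<oplus>\<^bsub>M\<^esub> v \<in> {x \<oplus>\<^bsub>M\<^esub> y |x y. x \<in> U \<and> y \<in> Y}" using h cX(3) cY(3) by blast
next
  note cX = qsubD[OF U] and cY = qsubD[OF Y]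
  fix r u assume r: "r \<in> carrier R" and "u \<in> {x \<oplus>\<^bsub>M\<^esub> y |x y. x \<in> U \<and> y \<in> Y}"
  then obtain x y where h: "u = x \<oplus>\<^bsub>M\<^esub> y" "x \<in> U" "y \<in> Y" by auto
  then have "(r [^] (p ^ e)) \<odot>\<^bsub>M\<^esub> u = (r [^] (p ^ e)) \<odot>\<^bsub>M\<^esub> x \<oplus>\<^bsub>M\<^esub> (r [^] (p ^ e)) \<odot>\<^bsub>M\<^esub> y"
    using r cX(1) cY(1) by (simp add: smult_r_distr subset_iff)
  then show "(r [^] (p ^ e)) \<odot>\<^bsub>M\<^esub> u \<in> {x \<oplus>\<^bsub>M\<^esub> y |x y. x \<in> U \<and> y \<in> Y}"
    using h r cX(4) cY(4) by blast
qed

lemma qhull_UnE: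
  assumes "qsub R (p ^ e) M U" "qsub R (p ^ e) M Y" "z \<in> qhull R (p ^ e) M (U \<union> Y)"
  obtains x y where "x \<in> U" "y \<in> Y" "z = x \<oplus>\<^bsub>M\<^esub> y"
proof -
  let ?S = "{x \<oplus>\<^bsub>M\<^esub> y |x y. x \<in> U \<and> y \<in> Y}"
  note cX = qsubD[OF assms(1)] and cY = qsubD[OF assms(2)]
  have "U \<union> Y \<subseteq> ?S"
  proof
    fix u assume u: "u \<in> U \<union> Y"
    then have "u = u \<oplus>\<^bsub>M\<^esub> \<zero>\<^bsub>M\<^esub>" "u = \<zero>\<^bsub>M\<^esub> \<oplus>\<^bsub>M\<^esub> u" using cX(1) cY(1) by auto
    then show "u \<in> ?S" using u cX(2) cY(2) by blast
  qed
  then have "z \<in> ?S" using qhull_least[OF qsub_sum[OF assms(1,2)]] assms(3) by blast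
  then show thesis using that by blast
qed

lemma qsub_cyclic:
  assumes "a \<in> carrier M"
  shows "qsub R (p ^ e) M {(r [^] (p ^ e)) \<odot>\<^bsub>M\<^esub> a |r. r \<in> carrier R}"
proof (rule qsubI)
  show "{(r [^] (p ^ e)) \<odot>\<^bsub>M\<^esub> a |r. r \<in> carrier R} \<subseteq> carrier M" using assms by auto
  have "\<zero>\<^bsub>M\<^esub> = (\<zero> [^] (p ^ e)) \<odot>\<^bsub>M\<^esub> a" using assms by (simp add: zero_pow)
  then show "\<zero>\<^bsub>M\<^esub> \<in> {(r [^] (p ^ e)) \<odot>\<^bsub>M\<^esub> a |r. r \<in> carrier R}" by blast
  fix x y assume "x \<in> {(r [^] (p ^ e)) \<odot>\<^bsub>M\<^esub> a |r. r \<in> carrier R}" "y \<in> {(r [^] (p ^ e)) \<odot>\<^bsub>M\<^esub> a |r. r \<in> carrier R}"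
  then obtain r s where h: "r \<in> carrier R" "s \<in> carrier R" "x = (r [^] (p ^ e)) \<odot>\<^bsub>M\<^esub> a" "y = (s [^] (p ^ e)) \<odot>\<^bsub>M\<^esub> a" by blast
  then have "x \<oplus>\<^bsub>M\<^esub> y = ((r \<oplus> s) [^] (p ^ e)) \<odot>\<^bsub>M\<^esub> a" using assms by (simp add: frob_add smult_l_distr)
  then show "x \<oplus>\<^bsub>M\<^esub> y \<in> {(r [^] (p ^ e)) \<odot>\<^bsub>M\<^esub> a |r. r \<in> carrier R}" using h by blast
next
  fix t x assume t: "t \<in> carrier R" "x \<in> {(r [^] (p ^ e)) \<odot>\<^bsub>M\<^esub> a |r. r \<in> carrier R}"
  then obtain r where h: "r \<in> carrier R" "x = (r [^] (p ^ e)) \<odot>\<^bsub>M\<^esub> a" by blast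
  then have "(t [^] (p ^ e)) \<odot>\<^bsub>M\<^esub> x = ((t \<otimes> r) [^] (p ^ e)) \<odot>\<^bsub>M\<^esub> a"
    using assms t by (simp add: nat_pow_distrib smult_assoc1)
  then show "(t [^] (p ^ e)) \<odot>\<^bsub>M\<^esub> x \<in> {(r [^] (p ^ e)) \<odot>\<^bsub>M\<^esub> a |r. r \<in> carrier R}" using h t by blast
qed

lemma qhull_insertE:
  assumes U: "qsub R (p ^ e) M U" and a: "a \<in> carrier M" and z: "z \<in> qhull R (p ^ e) M (insert a U)"
  obtains x r where "x \<in> U" "r \<in> carrier R" "z = x \<oplus>\<^bsub>M\<^esub> (r [^] (p ^ e)) \<odot>\<^bsub>M\<^esub> a"
proof -
  let ?Y = "{(r [^] (p ^ e)) \<odot>\<^bsub>M\<^esub> a |r. r \<in> carrier R}"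
  have "a = (\<one> [^] (p ^ e)) \<odot>\<^bsub>M\<^esub> a" using a by simp
  then have "insert a U \<subseteq> U \<union> ?Y" by blast
  from qhull_mono[OF this, of R "p ^ e" M] z have "z \<in> qhull R (p ^ e) M (U \<union> ?Y)" by blast
  from qhull_UnE[OF U qsub_cyclic[OF a] this] show thesis using that by blast
qed

lemma qhull_qhull_Un:
  assumes "A \<subseteq> carrier M" "B \<subseteq> carrier M"
  shows "qhull R q M (qhull R q M A \<union> B) = qhull R q M (A \<union> B)"
proof
  have "qhull R q M A \<subseteq> qhull R q M (A \<union> B)" by (rule qhull_mono) simp
  moreover have "B \<subseteq> qhull R q M (A \<union> B)" using qhull_superset[of "A \<union> B" R q M] by blast
  ultimately show "qhull R q M (qhull R q M A \<union> B) \<subseteq> qhull R q M (A \<union> B)"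
    using assms by (intro qhull_least qsub_qhull) simp_all
  show "qhull R q M (A \<union> B) \<subseteq> qhull R q M (qhull R q M A \<union> B)"
    using qhull_superset[of A R q M] by (intro qhull_mono) blast
qed

end

sublocale frob \<subseteq> S: frob_module R p "self_module R"
  by (rule frob_module_self)

subsection \<open>Bases of residue fields over their Frobenius powers\<close>

text \<open>With \<open>B = Q\<close> this expresses that the residue classes of the list are linearly independent over
  \<open>\<kappa>(Q)\<^sup>q\<close>: no entry lies, up to a denominator \<open>s\<close>, in the span of the entries after it.\<close>

fun strict :: "('a, 'r) ring_scheme \<Rightarrow> nat \<Rightarrow> 'a set \<Rightarrow> 'a set \<Rightarrow> 'a list \<Rightarrow> bool" where
  "strict R q Q B [] \<longleftrightarrow> True"
| "strict R q Q B (y # ys) \<longleftrightarrow> strict R q Q B ys \<and> y \<in> carrier R \<and>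
     (\<forall>s\<in>carrier R - Q. (s [^]\<^bsub>R\<^esub> q) \<otimes>\<^bsub>R\<^esub> y \<notin> qhull R q (self_module R) (B \<union> set ys))"

text \<open>Lifts to R of a basis of \<kappa>(Q) over \<kappa>(Q)^q. The element d is one common
  denominator for the whole of R; it enters as a q-th power because scalars act on F^e_*R in this
  way.\<close>

definition qbasis :: "('a, 'r) ring_scheme \<Rightarrow> nat \<Rightarrow> 'a set \<Rightarrow> 'a list \<Rightarrow> bool" where
  "qbasis R q Q ys \<longleftrightarrow> strict R q Q Q ys \<and>
     (\<exists>d\<in>carrier R - Q. \<forall>r\<in>carrier R. (d [^]\<^bsub>R\<^esub> q) \<otimes>\<^bsub>R\<^esub> r \<in> qhull R q (self_module R) (Q \<union> set ys))"

text \<open>The tower of \<kappa> over \<kappa>^q over \<kappa>^(q q'): if the z form a basis of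
  \<kappa> over \<kappa>^q', then the z^q form one of \<kappa>^q over \<kappa>^(q q').\<close>

fun prod_basis :: "('a, 'r) ring_scheme \<Rightarrow> nat \<Rightarrow> 'a list \<Rightarrow> 'a list \<Rightarrow> 'a list" where
  "prod_basis R q [] zs = []"
| "prod_basis R q (y # ys) zs = map (\<lambda>z. y \<otimes>\<^bsub>R\<^esub> (z [^]\<^bsub>R\<^esub> q)) zs @ prod_basis R q ys zs"

lemma length_prod_basis [simp]: "length (prod_basis R q ys zs) = length ys * length zs"
  by (induction ys) auto

lemma set_prod_basis: "set (prod_basis R q ys zs) = {y \<otimes>\<^bsub>R\<^esub> (z [^]\<^bsub>R\<^esub> q) |y z. y \<in> set ys \<and> z \<in> set zs}"
  by (induction ys) auto

lemma strict_carrier: "strict R q Q B ys \<Longrightarrow> set ys \<subseteq> carrier R"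
  by (induction ys) auto

context frob
begin

abbreviation fsub :: "nat \<Rightarrow> 'a set \<Rightarrow> bool" where
  "fsub e U \<equiv> qsub R (p ^ e) (self_module R) U"

abbreviation fhull :: "nat \<Rightarrow> 'a set \<Rightarrow> 'a set" where
  "fhull e A \<equiv> qhull R (p ^ e) (self_module R) A"

lemma fsubI:
  assumes "U \<subseteq> carrier R" "\<zero> \<in> U" "\<And>x y. x \<in> U \<Longrightarrow> y \<in> U \<Longrightarrow> x \<oplus> y \<in> U"
    "\<And>r x. r \<in> carrier R \<Longrightarrow> x \<in> U \<Longrightarrow> (r [^] (p ^ e)) \<otimes> x \<in> U"
  shows "fsub e U"
  using assms by (intro qsubI) auto

lemma fsubD:
  assumes "fsub e U"
  shows "U \<subseteq> carrier R" "\<zero> \<in> U" "\<And>x y. x \<in> U \<Longrightarrow> y \<in> U \<Longrightarrow> x \<oplus> y \<in> U"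
    "\<And>r x. r \<in> carrier R \<Longrightarrow> x \<in> U \<Longrightarrow> (r [^] (p ^ e)) \<otimes> x \<in> U"
  using qsubD[OF assms] by auto

lemma fsub_fhull: "A \<subseteq> carrier R \<Longrightarrow> fsub e (fhull e A)"
  by (rule S.qsub_qhull) simp

lemma fhull_carrier: "A \<subseteq> carrier R \<Longrightarrow> fhull e A \<subseteq> carrier R"
  using S.qhull_carrier[of A] by simp

lemma a_inv_self [simp]: "\<ominus>\<^bsub>self_module R\<^esub> x = \<ominus> x"
  by (simp add: a_inv_def m_inv_def)

lemma a_minus_self [simp]: "x \<ominus>\<^bsub>self_module R\<^esub> y = x \<ominus> y"
  by (simp add: a_minus_def)

lemma fsub_cancel: "fsub e U \<Longrightarrow> x \<oplus> y \<in> U \<Longrightarrow> y \<in> U \<Longrightarrow> x \<in> carrier R \<Longrightarrow> x \<in> U"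
  using S.qsub_cancel[of e U x y] by simp

lemma fsub_cancel_diff:
  assumes U: "fsub e U" and "x \<ominus> y \<in> U" "y \<in> U" "x \<in> carrier R"
  shows "x \<in> U"
proof -
  have "y \<in> carrier R" using fsubD(1)[OF U] assms by blast
  then have "(x \<ominus> y) \<oplus> y = x" using assms(4) by (simp add: minus_eq a_assoc l_neg)
  with fsubD(3)[OF U assms(2,3)] show ?thesis by simp
qed

lemma ideal_fsub:
  assumes "ideal I R"
  shows "fsub e I"
proof -
  interpret I: ideal I R by fact
  show ?thesis using I.a_subset by (intro fsubI) (auto intro: I.I_l_closed)
qed

lemma ideal_in_carrier: "ideal I R \<Longrightarrow> I \<subseteq> carrier R"
  using ideal_fsub fsubD(1) by blast

lemma ideal_mult_left: "ideal I R \<Longrightarrow> r \<in> carrier R \<Longrightarrow> x \<in> I \<Longrightarrow> r \<otimes> x \<in> I"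
  by (rule ideal.I_l_closed)

lemma ideal_mult_right: "ideal I R \<Longrightarrow> r \<in> carrier R \<Longrightarrow> x \<in> I \<Longrightarrow> x \<otimes> r \<in> I"
  by (rule ideal.I_r_closed)

lemma ideal_frob_pow:
  assumes I: "ideal I R" and x: "x \<in> I"
  shows "x [^] (p ^ e) \<in> I"
proof -
  obtain n where n: "p ^ e = Suc n" using p_gt_1 by (cases "p ^ e") auto
  have xc: "x \<in> carrier R" using ideal_in_carrier[OF I] x by blast
  show ?thesis unfolding n nat_pow_Suc by (rule ideal_mult_left[OF I _ x]) (use xc in simp)
qed

text \<open>The map c x^(p^f) is R-linear from F^e_*R to F^(e+f)_*R, since Frobenius is additive and
  turns r^(p^e) into r^(p^(e+f)).\<close>

lemma fsub_vimage_frob: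
  assumes U: "fsub (e + f) U" and c: "c \<in> carrier R"
  shows "fsub e {x \<in> carrier R. c \<otimes> (x [^] (p ^ f)) \<in> U}"
proof (rule fsubI)
  note h = fsubD[OF U]
  show "\<zero> \<in> {x \<in> carrier R. c \<otimes> (x [^] (p ^ f)) \<in> U}" using h c by (simp add: zero_pow)
  fix x y assume xy: "x \<in> {x \<in> carrier R. c \<otimes> (x [^] (p ^ f)) \<in> U}" "y \<in> {x \<in> carrier R. c \<otimes> (x [^] (p ^ f)) \<in> U}"
  then have "c \<otimes> ((x \<oplus> y) [^] (p ^ f)) = c \<otimes> (x [^] (p ^ f)) \<oplus> c \<otimes> (y [^] (p ^ f))"
    using c by (simp add: frob_add r_distr)
  then show "x \<oplus> y \<in> {x \<in> carrier R. c \<otimes> (x [^] (p ^ f)) \<in> U}" using xy h(3) by simp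
next
  note h = fsubD[OF U]
  fix r x assume r: "r \<in> carrier R" and x: "x \<in> {x \<in> carrier R. c \<otimes> (x [^] (p ^ f)) \<in> U}"
  then have "c \<otimes> (((r [^] (p ^ e)) \<otimes> x) [^] (p ^ f)) = (r [^] (p ^ (e + f))) \<otimes> (c \<otimes> (x [^] (p ^ f)))"
    using c by (simp add: nat_pow_distrib frob_pow m_lcomm)
  then show "(r [^] (p ^ e)) \<otimes> x \<in> {x \<in> carrier R. c \<otimes> (x [^] (p ^ f)) \<in> U}"
    using r x h(4)[of r] by simp
qed auto

lemma fsub_vimage:
  assumes U: "fsub e U" and c: "c \<in> carrier R"
  shows "fsub e {x \<in> carrier R. c \<otimes> x \<in> U}"
proof -
  have "{x \<in> carrier R. c \<otimes> x \<in> U} = {x \<in> carrier R. c \<otimes> (x [^] (p ^ 0)) \<in> U}" by auto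
  then show ?thesis using fsub_vimage_frob[of e 0 U c] assms by simp
qed

lemma pow_notin_prime:
  assumes "primeideal P R" "s \<in> carrier R - P"
  shows "s [^] (n::nat) \<in> carrier R - P"
proof -
  interpret P: primeideal P R by fact
  have "\<one> \<notin> P" using one_notin_prime[OF assms(1)] by simp
  then show ?thesis
  proof (induction n)
    case (Suc n)
    then have "s [^] n \<otimes> s \<notin> P" using assms(2) P.I_prime[of "s [^] n" s] by blast
    then show ?case using assms(2) by simp
  qed simp
qed

lemma prod_notin_prime:
  assumes "primeideal P R" "s \<in> carrier R - P" "t \<in> carrier R - P"
  shows "s \<otimes> t \<in> carrier R - P"
  using primeideal.I_prime[OF assms(1), of s t] assms(2,3) by auto

text \<open>Greedy elimination along the generators: an entry is dropped exactly when some s^q with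
  s outside P moves it into the span of the entries kept so far, and then the denominator d is
  replaced by d s.\<close>

lemma exists_qbasis:
  assumes P: "primeideal P R" and cover: "carrier R \<subseteq> fhull e (set as)" and as: "set as \<subseteq> carrier R"
  shows "\<exists>ys. qbasis R (p ^ e) P ys \<and> length ys \<le> length as"
proof -
  interpret P: primeideal P R by fact
  have I: "ideal P R" by (rule P.is_ideal)
  have one: "\<one> \<in> carrier R - P" using one_notin_prime[OF P] by simp
  have "\<exists>ys d. strict R (p ^ e) P P ys \<and> length ys \<le> length as \<and> d \<in> carrier R - P \<and>
      (\<forall>x\<in>fhull e (P \<union> set as). (d [^] (p ^ e)) \<otimes> x \<in> fhull e (P \<union> set ys))"
    using as
  proof (induction as)
    case Nil
    show ?case
    proof (intro exI[of _ "[]"] exI[of _ \<one>] conjI ballI)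
      fix x assume "x \<in> fhull e (P \<union> set [])"
      then show "(\<one> [^] (p ^ e)) \<otimes> x \<in> fhull e (P \<union> set [])"
        using fhull_carrier[of "P \<union> set []" e] ideal_in_carrier[OF I] by auto
    qed (use one in auto)
  next
    case (Cons a as)
    then obtain ys d where ys: "strict R (p ^ e) P P ys" "length ys \<le> length as" and d: "d \<in> carrier R - P"
      and h: "\<And>x. x \<in> fhull e (P \<union> set as) \<Longrightarrow> (d [^] (p ^ e)) \<otimes> x \<in> fhull e (P \<union> set ys)" by auto
    have a: "a \<in> carrier R" using Cons.prems by simp
    have cy: "P \<union> set ys \<subseteq> carrier R" using strict_carrier[OF ys(1)] ideal_in_carrier[OF I] by simp
    show ?case
    proof (cases "\<exists>s\<in>carrier R - P. (s [^] (p ^ e)) \<otimes> a \<in> fhull e (P \<union> set ys)")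
      case True
      then obtain s where s: "s \<in> carrier R - P" "(s [^] (p ^ e)) \<otimes> a \<in> fhull e (P \<union> set ys)" by blast
      let ?c = "(d \<otimes> s) [^] (p ^ e)"
      let ?U = "{x \<in> carrier R. ?c \<otimes> x \<in> fhull e (P \<union> set ys)}"
      have U: "fsub e ?U" by (rule fsub_vimage[OF fsub_fhull[OF cy]]) (use d s in auto)
      have "P \<union> set (a # as) \<subseteq> ?U"
      proof
        fix x assume x: "x \<in> P \<union> set (a # as)"
        then have xc: "x \<in> carrier R" using Cons.prems ideal_in_carrier[OF I] by auto
        show "x \<in> ?U"
        proof (cases "x = a")
          case True
          have "?c \<otimes> a = (d [^] (p ^ e)) \<otimes> ((s [^] (p ^ e)) \<otimes> a)"
            using d s a by (simp add: nat_pow_distrib m_assoc)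
          then show ?thesis using fsubD(4)[OF fsub_fhull[OF cy], of d _ e] s(2) d a True by simp
        next
          case False
          then have "x \<in> fhull e (P \<union> set as)" using x by (auto intro: qhull_base)
          from h[OF this] have "(s [^] (p ^ e)) \<otimes> ((d [^] (p ^ e)) \<otimes> x) \<in> fhull e (P \<union> set ys)"
            using fsubD(4)[OF fsub_fhull[OF cy], of s _ e] s(1) by simp
          moreover have "?c \<otimes> x = (s [^] (p ^ e)) \<otimes> ((d [^] (p ^ e)) \<otimes> x)"
            using d s xc by (simp add: nat_pow_distrib m_ac)
          ultimately show ?thesis using xc by simp
        qed
      qed
      then have "fhull e (P \<union> set (a # as)) \<subseteq> ?U" by (rule qhull_least[OF U])
      moreover have "d \<otimes> s \<in> carrier R - P" using prod_notin_prime[OF P] d s by blast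
      ultimately show ?thesis using ys by (intro exI[of _ ys] exI[of _ "d \<otimes> s"]) auto
    next
      case False
      let ?H = "fhull e (P \<union> set (a # ys))"
      have cy': "P \<union> set (a # ys) \<subseteq> carrier R" using cy a by simp
      let ?U = "{x \<in> carrier R. (d [^] (p ^ e)) \<otimes> x \<in> ?H}"
      have U: "fsub e ?U" by (rule fsub_vimage[OF fsub_fhull[OF cy']]) (use d in auto)
      have "P \<union> set (a # as) \<subseteq> ?U"
      proof
        fix x assume x: "x \<in> P \<union> set (a # as)"
        then have xc: "x \<in> carrier R" using Cons.prems ideal_in_carrier[OF I] by auto
        show "x \<in> ?U"
        proof (cases "x = a")
          case True
          have "a \<in> ?H" by (rule qhull_base) simp
          then show ?thesis using fsubD(4)[OF fsub_fhull[OF cy'], of d _ e] d a True by simp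
        next
          case False
          then have "x \<in> fhull e (P \<union> set as)" using x by (auto intro: qhull_base)
          from h[OF this] show ?thesis
            using xc qhull_mono[of "P \<union> set ys" "P \<union> set (a # ys)" R "p ^ e" "self_module R"] by auto
        qed
      qed
      then have "fhull e (P \<union> set (a # as)) \<subseteq> ?U" by (rule qhull_least[OF U])
      then show ?thesis using ys False d a by (intro exI[of _ "a # ys"] exI[of _ d]) auto
    qed
  qed
  then obtain ys d where ys: "strict R (p ^ e) P P ys" "length ys \<le> length as" "d \<in> carrier R - P"
      "\<And>x. x \<in> fhull e (P \<union> set as) \<Longrightarrow> (d [^] (p ^ e)) \<otimes> x \<in> fhull e (P \<union> set ys)" by blast
  have "carrier R \<subseteq> fhull e (P \<union> set as)"
    using cover qhull_mono[of "set as" "P \<union> set as" R "p ^ e" "self_module R"] by auto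
  then show ?thesis unfolding qbasis_def using ys by (intro exI[of _ ys]) blast
qed

text \<open>Independence in a tower, for the block of one y. All later products lie in the set of
  elements y c^(p^e) + h with c in the span of the later z and h in the span of the later y. A
  relation for y z^(p^e) then puts (s^(p^f) z - c)^(p^e) y in the span of \<open>ys\<close>, so
  independence of y forces s^(p^f) z - c into P, and z depends on the later z. The list
  \<open>ws\<close> is kept apart from \<open>zs\<close> because the induction shortens only the
  current block, while the blocks of \<open>ys\<close> retain the full list.\<close>

lemma strict_prod_aux:
  assumes P: "primeideal P R" and y: "strict R (p ^ e) P P (y # ys)"
    and zs: "strict R (p ^ f) P P zs" and B: "strict R (p ^ (e + f)) P P (prod_basis R (p ^ e) ys ws)"
    and ws: "set ws \<subseteq> carrier R"
  shows "strict R (p ^ (e + f)) P P (map (\<lambda>z. y \<otimes> (z [^] (p ^ e))) zs @ prod_basis R (p ^ e) ys ws)"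
  using zs
proof (induction zs)
  case Nil
  then show ?case using B by simp
next
  case (Cons z zs)
  interpret P: primeideal P R by fact
  have I: "ideal P R" by (rule P.is_ideal)
  have Pc: "P \<subseteq> carrier R" by (rule ideal_in_carrier[OF I])
  have yc: "y \<in> carrier R" "set ys \<subseteq> carrier R" using strict_carrier[OF y] by auto
  have zc: "z \<in> carrier R" "set zs \<subseteq> carrier R" using strict_carrier[OF Cons.prems] by auto
  let ?L = "map (\<lambda>z. y \<otimes> (z [^] (p ^ e))) zs @ prod_basis R (p ^ e) ys ws"
  let ?He = "fhull e (P \<union> set ys)" and ?Hf = "fhull f (P \<union> set zs)"
  have He: "fsub e ?He" and Hf: "fsub f ?Hf" using yc zc Pc by (auto intro: fsub_fhull)
  note he = fsubD[OF He] and hf = fsubD[OF Hf]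
  let ?T = "{u \<in> carrier R. \<exists>c\<in>?Hf. u \<ominus> y \<otimes> (c [^] (p ^ e)) \<in> ?He}"
  have T: "fsub (e + f) ?T"
  proof (rule fsubI)
    have "\<zero> \<ominus> y \<otimes> (\<zero> [^] (p ^ e)) = \<zero>" using yc by (simp add: zero_pow minus_eq)
    then show "\<zero> \<in> ?T" using he(2) hf(2) by (auto intro!: bexI[of _ \<zero>])
  next
    fix u v assume "u \<in> ?T" "v \<in> ?T"
    then obtain c d where h: "u \<in> carrier R" "v \<in> carrier R" "c \<in> ?Hf" "d \<in> ?Hf"
      "u \<ominus> y \<otimes> (c [^] (p ^ e)) \<in> ?He" "v \<ominus> y \<otimes> (d [^] (p ^ e)) \<in> ?He" by auto
    have cd: "c [^] (p ^ e) \<in> carrier R" "d [^] (p ^ e) \<in> carrier R" "c \<in> carrier R" "d \<in> carrier R" using h hf(1) by auto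
    have "(u \<oplus> v) \<ominus> y \<otimes> ((c \<oplus> d) [^] (p ^ e)) = (u \<ominus> y \<otimes> (c [^] (p ^ e))) \<oplus> (v \<ominus> y \<otimes> (d [^] (p ^ e)))"
      unfolding frob_add[OF cd(3,4)]
    proof -
      have "(u \<oplus> v) \<ominus> y \<otimes> (c' \<oplus> d') = (u \<ominus> y \<otimes> c') \<oplus> (v \<ominus> y \<otimes> d')"
        if "c' \<in> carrier R" "d' \<in> carrier R" for c' d' using that h(1,2) yc(1) by algebra
      then show "(u \<oplus> v) \<ominus> y \<otimes> (c [^] (p ^ e) \<oplus> d [^] (p ^ e)) = (u \<ominus> y \<otimes> (c [^] (p ^ e))) \<oplus> (v \<ominus> y \<otimes> (d [^] (p ^ e)))"
        using cd by blast
    qed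
    then show "u \<oplus> v \<in> ?T" using h he(3) hf(3) by (auto intro!: bexI[of _ "c \<oplus> d"])
  next
    fix r u assume r: "r \<in> carrier R" and "u \<in> ?T"
    then obtain c where h: "u \<in> carrier R" "c \<in> ?Hf" "u \<ominus> y \<otimes> (c [^] (p ^ e)) \<in> ?He" by auto
    have c: "c \<in> carrier R" using h hf(1) by auto
    have "(r [^] (p ^ (e + f))) \<otimes> u \<ominus> y \<otimes> (((r [^] (p ^ f)) \<otimes> c) [^] (p ^ e))
        = ((r [^] (p ^ f)) [^] (p ^ e)) \<otimes> (u \<ominus> y \<otimes> (c [^] (p ^ e)))"
    proof -
      have "r' \<otimes> u \<ominus> y \<otimes> (r' \<otimes> c') = r' \<otimes> (u \<ominus> y \<otimes> c')"
        if "c' \<in> carrier R" "r' \<in> carrier R" for c' r' using that h(1) yc(1) by algebra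
      then show ?thesis using r c by (simp add: nat_pow_distrib frob_pow add.commute)
    qed
    moreover have "((r [^] (p ^ f)) [^] (p ^ e)) \<otimes> (u \<ominus> y \<otimes> (c [^] (p ^ e))) \<in> ?He"
      using he(4) h r by simp
    moreover have "(r [^] (p ^ f)) \<otimes> c \<in> ?Hf" using hf(4) h r by simp
    ultimately show "(r [^] (p ^ (e + f))) \<otimes> u \<in> ?T" using h r by (auto intro!: bexI[of _ "(r [^] (p ^ f)) \<otimes> c"])
  qed auto
  have z0: "u \<ominus> y \<otimes> (\<zero> [^] (p ^ e)) = u" if "u \<in> carrier R" for u
    using that yc by (simp add: zero_pow minus_eq)
  have "P \<union> set ?L \<subseteq> ?T"
  proof
    fix u assume u: "u \<in> P \<union> set ?L"
    consider "u \<in> P" | z' where "z' \<in> set zs" "u = y \<otimes> (z' [^] (p ^ e))"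
      | y' w where "y' \<in> set ys" "w \<in> set ws" "u = y' \<otimes> (w [^] (p ^ e))"
      using u by (auto simp: set_prod_basis)
    then show "u \<in> ?T"
    proof cases
      case 1
      then show ?thesis using z0[of u] Pc hf(2) qhull_base[of u "P \<union> set ys"] by (auto intro!: bexI[of _ \<zero>])
    next
      case 2
      have z': "z' \<in> carrier R" using 2 zc by auto
      then have "u \<ominus> y \<otimes> (z' [^] (p ^ e)) = \<zero>" "u \<in> carrier R" using 2 yc by (auto simp: minus_eq r_neg)
      moreover have "z' \<in> ?Hf" using 2 by (auto intro: qhull_base)
      ultimately show ?thesis using he(2) by (auto intro!: bexI[of _ z'])
    next
      case 3
      have c: "y' \<in> carrier R" "w \<in> carrier R" using 3 yc ws by auto
      have "y' \<in> ?He" using 3 by (auto intro: qhull_base)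
      then have "(w [^] (p ^ e)) \<otimes> y' \<in> ?He" using he(4) c by simp
      then have "u \<in> ?He" "u \<in> carrier R" using 3 c by (auto simp: m_comm)
      then show ?thesis using z0[of u] hf(2) by (auto intro!: bexI[of _ \<zero>])
    qed
  qed
  then have incl: "fhull (e + f) (P \<union> set ?L) \<subseteq> ?T" by (rule qhull_least[OF T])
  have "(s [^] (p ^ (e + f))) \<otimes> (y \<otimes> (z [^] (p ^ e))) \<notin> fhull (e + f) (P \<union> set ?L)"
    if s: "s \<in> carrier R - P" for s
  proof
    assume "(s [^] (p ^ (e + f))) \<otimes> (y \<otimes> (z [^] (p ^ e))) \<in> fhull (e + f) (P \<union> set ?L)"
    with incl obtain c where c: "c \<in> ?Hf" "(s [^] (p ^ (e + f))) \<otimes> (y \<otimes> (z [^] (p ^ e))) \<ominus> y \<otimes> (c [^] (p ^ e)) \<in> ?He" by blast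
    have cc: "c \<in> carrier R" using c hf(1) by auto
    let ?t = "(s [^] (p ^ f)) \<otimes> z \<ominus> c"
    have "(s [^] (p ^ (e + f))) \<otimes> (y \<otimes> (z [^] (p ^ e))) \<ominus> y \<otimes> (c [^] (p ^ e)) = (?t [^] (p ^ e)) \<otimes> y"
    proof -
      have "s' \<otimes> (y \<otimes> z') \<ominus> y \<otimes> c' = (s' \<otimes> z' \<ominus> c') \<otimes> y"
        if "c' \<in> carrier R" "s' \<in> carrier R" "z' \<in> carrier R" for c' s' z' using that yc(1) by algebra
      then show ?thesis using s cc zc by (simp add: frob_diff nat_pow_distrib frob_pow add.commute)
    qed
    then have "(?t [^] (p ^ e)) \<otimes> y \<in> ?He" using c by simp
    then have "?t \<in> P" using y s cc zc by auto
    then have "?t \<in> ?Hf" by (auto intro: qhull_base)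
    then have "(s [^] (p ^ f)) \<otimes> z \<in> ?Hf" using fsub_cancel_diff[OF Hf _ c(1)] s zc by auto
    then show False using Cons.prems s by auto
  qed
  then show ?case using Cons.IH Cons.prems yc zc by auto
qed

lemma strict_prod:
  assumes P: "primeideal P R" and "strict R (p ^ e) P P ys" and zs: "strict R (p ^ f) P P zs"
  shows "strict R (p ^ (e + f)) P P (prod_basis R (p ^ e) ys zs)"
  using assms(2)
proof (induction ys)
  case (Cons y ys)
  then show ?case
    using strict_prod_aux[OF P Cons.prems zs _ strict_carrier[OF zs]] by simp
qed simp

lemma qbasis_prod:
  assumes P: "primeideal P R" and ys: "qbasis R (p ^ e) P ys" and zs: "qbasis R (p ^ f) P zs"
  shows "qbasis R (p ^ (e + f)) P (prod_basis R (p ^ e) ys zs)"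
proof -
  interpret P: primeideal P R by fact
  have I: "ideal P R" by (rule P.is_ideal)
  have Pc: "P \<subseteq> carrier R" by (rule ideal_in_carrier[OF I])
  obtain d where d: "d \<in> carrier R - P" "\<And>r. r \<in> carrier R \<Longrightarrow> (d [^] (p ^ e)) \<otimes> r \<in> fhull e (P \<union> set ys)"
    using ys by (auto simp: qbasis_def)
  obtain d' where d': "d' \<in> carrier R - P" "\<And>r. r \<in> carrier R \<Longrightarrow> (d' [^] (p ^ f)) \<otimes> r \<in> fhull f (P \<union> set zs)"
    using zs by (auto simp: qbasis_def)
  have yc: "set ys \<subseteq> carrier R" and zc: "set zs \<subseteq> carrier R"
    using ys zs strict_carrier[of R "p ^ e" P P ys] strict_carrier[of R "p ^ f" P P zs]
    by (simp_all add: qbasis_def)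
  let ?ps = "prod_basis R (p ^ e) ys zs"
  let ?H = "fhull (e + f) (P \<union> set ?ps)"
  have Hc: "P \<union> set ?ps \<subseteq> carrier R"
    using Pc subsetD[OF yc] subsetD[OF zc] by (auto simp: set_prod_basis)
  have H: "fsub (e + f) ?H" by (rule fsub_fhull[OF Hc])
  note h = fsubD[OF H]
  let ?c = "d' [^] (p ^ (e + f))"
  have c: "?c \<in> carrier R" using d' by auto
  \<comment> \<open>\<open>?H\<close> is closed only under p^(e+f)-th powers. Quantifying over all r
    makes this set closed under p^e-th powers, so that the cover by \<open>ys\<close> can be tested
    on its generators.\<close>
  let ?W = "{u \<in> carrier R. \<forall>r\<in>carrier R. ?c \<otimes> ((r [^] (p ^ e)) \<otimes> u) \<in> ?H}"
  have W: "fsub e ?W"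
  proof (rule fsubI)
    show "\<zero> \<in> ?W" using h(2) c by simp
  next
    fix u v assume uv: "u \<in> ?W" "v \<in> ?W"
    have "?c \<otimes> ((r [^] (p ^ e)) \<otimes> (u \<oplus> v)) = ?c \<otimes> ((r [^] (p ^ e)) \<otimes> u) \<oplus> ?c \<otimes> ((r [^] (p ^ e)) \<otimes> v)"
      if "r \<in> carrier R" for r using that uv c by (simp add: r_distr)
    then show "u \<oplus> v \<in> ?W" using uv h(3) by auto
  next
    fix t u assume t: "t \<in> carrier R" and u: "u \<in> ?W"
    have "(r [^] (p ^ e)) \<otimes> ((t [^] (p ^ e)) \<otimes> u) = ((r \<otimes> t) [^] (p ^ e)) \<otimes> u" if "r \<in> carrier R" for r
      using that t u by (simp add: nat_pow_distrib m_assoc)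
    then show "(t [^] (p ^ e)) \<otimes> u \<in> ?W" using t u by auto
  qed auto
  have "P \<union> set ys \<subseteq> ?W"
  proof
    fix y assume y: "y \<in> P \<union> set ys"
    then have ycar: "y \<in> carrier R" using Pc yc by auto
    have "?c \<otimes> ((r [^] (p ^ e)) \<otimes> y) \<in> ?H" if r: "r \<in> carrier R" for r
    proof (cases "y \<in> P")
      case True
      then show ?thesis using r c by (intro qhull_base UnI1 ideal_mult_left[OF I]) auto
    next
      case False
      then have y': "y \<in> set ys" using y by simp
      let ?U = "{x \<in> carrier R. y \<otimes> (x [^] (p ^ e)) \<in> ?H}"
      have U: "fsub f ?U" using fsub_vimage_frob[of f e ?H y] H ycar by (simp add: add.commute)
      have "P \<union> set zs \<subseteq> ?U"
      proof
        fix x assume x: "x \<in> P \<union> set zs"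
        show "x \<in> ?U"
        proof (cases "x \<in> P")
          case True
          have "x [^] (p ^ e) \<in> P"
            using ideal_frob_pow[OF I True] .
          then show ?thesis using True Pc ycar by (auto intro!: qhull_base ideal_mult_left[OF I])
        next
          case False
          then show ?thesis using x y' zc by (auto intro!: qhull_base simp: set_prod_basis)
        qed
      qed
      then have "fhull f (P \<union> set zs) \<subseteq> ?U" by (rule qhull_least[OF U])
      with d'(2)[OF r] have "y \<otimes> (((d' [^] (p ^ f)) \<otimes> r) [^] (p ^ e)) \<in> ?H" by auto
      moreover have "y \<otimes> (((d' [^] (p ^ f)) \<otimes> r) [^] (p ^ e)) = ?c \<otimes> ((r [^] (p ^ e)) \<otimes> y)"
        using ycar r d'(1) by (simp add: nat_pow_distrib frob_pow add.commute m_ac)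
      ultimately show ?thesis by simp
    qed
    then show "y \<in> ?W" using ycar by simp
  qed
  then have incl: "fhull e (P \<union> set ys) \<subseteq> ?W" by (rule qhull_least[OF W])
  have fin: "((d \<otimes> d') [^] (p ^ (e + f))) \<otimes> r \<in> ?H" if r: "r \<in> carrier R" for r
  proof -
    \<comment> \<open>The denominator of \<open>ys\<close> comes with exponent p^e, but exponent
      p^(e+f) is required; the surplus power of d is absorbed into the element that is
      covered.\<close>
    let ?n = "p ^ (e + f) - p ^ e"
    have "p ^ e \<le> p ^ (e + f)" using p_gt_1 by (intro power_increasing) auto
    then have pw: "d [^] (p ^ (e + f)) = (d [^] (p ^ e)) \<otimes> (d [^] ?n)"
      using d(1) by (simp add: nat_pow_mult)
    have "(d [^] (p ^ e)) \<otimes> ((d [^] ?n) \<otimes> r) \<in> ?W"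
      by (rule subsetD[OF incl d(2)]) (use d(1) r in simp)
    then have "\<forall>t\<in>carrier R. ?c \<otimes> ((t [^] (p ^ e)) \<otimes> ((d [^] (p ^ e)) \<otimes> ((d [^] ?n) \<otimes> r))) \<in> ?H" by simp
    then have "?c \<otimes> ((\<one> [^] (p ^ e)) \<otimes> ((d [^] (p ^ e)) \<otimes> ((d [^] ?n) \<otimes> r))) \<in> ?H"
      using one_closed by (rule bspec)
    moreover have "?c \<otimes> ((\<one> [^] (p ^ e)) \<otimes> ((d [^] (p ^ e)) \<otimes> ((d [^] ?n) \<otimes> r)))
        = ((d \<otimes> d') [^] (p ^ (e + f))) \<otimes> r"
      using d(1) d'(1) r by (simp add: nat_pow_distrib pw m_ac)
    ultimately show ?thesis by simp
  qed
  have dd: "d \<otimes> d' \<in> carrier R - P" using prod_notin_prime[OF P] d(1) d'(1) by blast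
  have st: "strict R (p ^ (e + f)) P P ?ps"
    using strict_prod[OF P] ys zs unfolding qbasis_def by blast
  show ?thesis unfolding qbasis_def using st dd fin by blast
qed

lemma qbasis_power:
  assumes P: "primeideal P R" and ys: "qbasis R (p ^ 1) P ys"
  shows "\<exists>zs. qbasis R (p ^ e) P zs \<and> length zs = length ys ^ e"
proof (induction e)
  case 0
  interpret P: primeideal P R by fact
  have one: "\<one> \<in> carrier R - P" using one_notin_prime[OF P] by simp
  have I: "ideal P R" by (rule P.is_ideal)
  have Pc: "P \<subseteq> carrier R" by (rule ideal_in_carrier[OF I])
  have "s [^] (p ^ 0) \<otimes> \<one> \<notin> fhull 0 (P \<union> set [])" if "s \<in> carrier R - P" for s
    using qhull_qsub_eq[OF ideal_fsub[OF I, of 0]] that by simp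
  then have "strict R (p ^ 0) P P [\<one>]" by simp
  moreover have "(\<one> [^] (p ^ 0)) \<otimes> r \<in> fhull 0 (P \<union> set [\<one>])" if "r \<in> carrier R" for r
    using fsubD(4)[OF fsub_fhull[of "P \<union> set [\<one>]" 0] that, of \<one>] that Pc
      qhull_base[of \<one> "P \<union> set [\<one>]" R "p ^ 0" "self_module R"] by simp
  ultimately have "qbasis R (p ^ 0) P [\<one>]" unfolding qbasis_def using one by blast
  then show ?case by (intro exI[of _ "[\<one>]"]) simp
next
  case (Suc e)
  then obtain zs where zs: "qbasis R (p ^ e) P zs" "length zs = length ys ^ e" by blast
  then show ?case
    using qbasis_prod[OF P zs(1) ys] by (intro exI[of _ "prod_basis R (p ^ e) zs ys"]) (simp add: mult.commute)
qed

end

subsection \<open>Lengths at a prime\<close>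

text \<open>\<open>len_le R q Q U V t\<close> bounds by \<open>t\<close> the length of the localization at \<open>Q\<close> of \<open>V / U\<close>; a step of a chain is
  counted only if it stays strict after localizing.\<close>

definition qstep :: "('a, 'r) ring_scheme \<Rightarrow> nat \<Rightarrow> 'a set \<Rightarrow> 'a set \<Rightarrow> 'a set \<Rightarrow> bool" where
  "qstep R q Q U V \<longleftrightarrow> (\<exists>y\<in>V. \<forall>s\<in>carrier R - Q. (s [^]\<^bsub>R\<^esub> q) \<otimes>\<^bsub>R\<^esub> y \<notin> U)"

definition len_le :: "('a, 'r) ring_scheme \<Rightarrow> nat \<Rightarrow> 'a set \<Rightarrow> 'a set \<Rightarrow> 'a set \<Rightarrow> nat \<Rightarrow> bool" where
  "len_le R q Q U V t \<longleftrightarrow> (\<forall>N T.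
     (\<forall>k. qsub R q (self_module R) (N k) \<and> U \<subseteq> N k \<and> N k \<subseteq> V \<and> N k \<subseteq> N (Suc k)) \<longrightarrow>
     card {k. k < T \<and> qstep R q Q (N k) (N (Suc k))} \<le> t)"

lemma len_leD:
  assumes "len_le R q Q U V t" "\<And>k. qsub R q (self_module R) (N k)" "\<And>k. U \<subseteq> N k" "\<And>k. N k \<subseteq> V"
    "\<And>k. N k \<subseteq> N (Suc k)"
  shows "card {k. k < (T::nat) \<and> qstep R q Q (N k) (N (Suc k))} \<le> t"
  using assms unfolding len_le_def by simp

lemma len_leI:
  assumes "\<And>N T. \<lbrakk>\<And>k. qsub R q (self_module R) (N k); \<And>k. U \<subseteq> N k; \<And>k. N k \<subseteq> V;
    \<And>k. N k \<subseteq> N (Suc k)\<rbrakk> \<Longrightarrow> card {k. k < (T::nat) \<and> qstep R q Q (N k) (N (Suc k))} \<le> t"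
  shows "len_le R q Q U V t"
  using assms unfolding len_le_def by simp

lemma len_le_mono:
  assumes "len_le R q Q U V s" "U \<subseteq> U'" "V' \<subseteq> V" "s \<le> t"
  shows "len_le R q Q U' V' t"
proof (rule len_leI)
  fix N :: "nat \<Rightarrow> 'a set" and T
  assume a: "\<And>k. qsub R q (self_module R) (N k)" "\<And>k. U' \<subseteq> N k" "\<And>k. N k \<subseteq> V'" "\<And>k. N k \<subseteq> N (Suc k)"
  have b: "U \<subseteq> N k" "N k \<subseteq> V" for k using a(2,3)[of k] assms(2,3) by auto
  show "card {k. k < T \<and> qstep R q Q (N k) (N (Suc k))} \<le> t"
    using len_leD[OF assms(1), of N T] a(1,4) b assms(4) by (meson le_trans)
qed

section \<open>Ideals I + (a) and (I : a)\<close>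

context cring
begin

definition adjoin :: "'a set \<Rightarrow> 'a \<Rightarrow> 'a set" where
  "adjoin I a = set_add R I (PIdl a)"

lemma mem_adjoin:
  assumes "a \<in> carrier R"
  shows "x \<in> adjoin I a \<longleftrightarrow> (\<exists>i\<in>I. \<exists>r\<in>carrier R. x = i \<oplus> r \<otimes> a)"
  unfolding adjoin_def set_add_def' cgenideal_def by auto

lemma adjoin_ideal:
  assumes "ideal I R" "a \<in> carrier R"
  shows "ideal (adjoin I a) R"
  unfolding adjoin_def by (rule add_ideals[OF assms(1) cgenideal_ideal[OF assms(2)]])

lemma subset_adjoin:
  assumes "ideal I R" "a \<in> carrier R"
  shows "I \<subseteq> adjoin I a"
proof
  fix x assume x: "x \<in> I"
  then have "x \<in> carrier R" using assms(1) by (simp add: ideal.Icarr)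
  then have "x = x \<oplus> \<zero> \<otimes> a" using assms(2) by simp
  then show "x \<in> adjoin I a" unfolding mem_adjoin[OF assms(2)] using x by (intro bexI[of _ x] bexI[of _ \<zero>]) auto
qed

lemma gen_adjoin:
  assumes "ideal I R" "a \<in> carrier R"
  shows "a \<in> adjoin I a"
proof -
  have "\<zero> \<in> I" using assms(1) by (simp add: additive_subgroup.zero_closed ideal_def)
  moreover have "a = \<zero> \<oplus> \<one> \<otimes> a" using assms(2) by simp
  ultimately show ?thesis unfolding mem_adjoin[OF assms(2)] by (intro bexI[of _ \<zero>] bexI[of _ \<one>]) auto
qed

lemma colon_ideal:
  assumes "ideal I R" "a \<in> carrier R"
  shows "ideal {r \<in> carrier R. r \<otimes> a \<in> I} R"
proof -
  interpret I: ideal I R by fact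
  show ?thesis
  proof (rule idealI[OF ring_axioms])
    show "subgroup {r \<in> carrier R. r \<otimes> a \<in> I} (add_monoid R)"
    proof (rule add.subgroupI)
      show "{r \<in> carrier R. r \<otimes> a \<in> I} \<noteq> {}" using assms(2) I.zero_closed by (auto intro!: exI[of _ \<zero>])
    qed (use assms(2) in \<open>auto simp: l_distr l_minus a_inv_def[symmetric]\<close>)
  next
    fix r x assume r: "r \<in> {r \<in> carrier R. r \<otimes> a \<in> I}" and x: "x \<in> carrier R"
    have "x \<otimes> r \<otimes> a = x \<otimes> (r \<otimes> a)" "r \<otimes> x \<otimes> a = x \<otimes> (r \<otimes> a)"
      using r x assms(2) by (simp_all add: m_ac)
    moreover have "x \<otimes> (r \<otimes> a) \<in> I" using r x by (auto intro: I.I_l_closed)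
    ultimately show "x \<otimes> r \<in> {r \<in> carrier R. r \<otimes> a \<in> I}" "r \<otimes> x \<in> {r \<in> carrier R. r \<otimes> a \<in> I}"
      using r x by auto
  qed
qed

end

section \<open>Generators of F^e_*(R / I) and additivity of lengths\<close>

context frob
begin

abbreviation gens :: "nat \<Rightarrow> 'a set \<Rightarrow> nat \<Rightarrow> bool" where
  "gens e I n \<equiv> qgen R (p ^ e) (self_module R) I n"

lemma fsub0_mult:
  assumes "fsub 0 U"
  shows "r \<in> carrier R \<Longrightarrow> x \<in> U \<Longrightarrow> r \<otimes> x \<in> U"
  using fsubD(4)[OF assms, of r x] by simp

text \<open>This is the largest \<open>fsub e\<close> set inside H. It allows a generation statement
  for the exponent p^e to be used with a target H that is stable only for the larger
  exponent.\<close>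

lemma fsub_saturate:
  assumes H: "fsub (e + f) H"
  shows "fsub e {u \<in> carrier R. \<forall>r\<in>carrier R. (r [^] (p ^ e)) \<otimes> u \<in> H}"
proof (rule fsubI)
  note h = fsubD[OF H]
  show "\<zero> \<in> {u \<in> carrier R. \<forall>r\<in>carrier R. (r [^] (p ^ e)) \<otimes> u \<in> H}" using h(2) by simp
  fix u v assume uv: "u \<in> {u \<in> carrier R. \<forall>r\<in>carrier R. (r [^] (p ^ e)) \<otimes> u \<in> H}"
    "v \<in> {u \<in> carrier R. \<forall>r\<in>carrier R. (r [^] (p ^ e)) \<otimes> u \<in> H}"
  have "(r [^] (p ^ e)) \<otimes> (u \<oplus> v) = (r [^] (p ^ e)) \<otimes> u \<oplus> (r [^] (p ^ e)) \<otimes> v"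
    if "r \<in> carrier R" for r using that uv by (simp add: r_distr)
  then show "u \<oplus> v \<in> {u \<in> carrier R. \<forall>r\<in>carrier R. (r [^] (p ^ e)) \<otimes> u \<in> H}" using uv h(3) by auto
next
  fix t u assume t: "t \<in> carrier R" and u: "u \<in> {u \<in> carrier R. \<forall>r\<in>carrier R. (r [^] (p ^ e)) \<otimes> u \<in> H}"
  have "(r [^] (p ^ e)) \<otimes> ((t [^] (p ^ e)) \<otimes> u) = ((r \<otimes> t) [^] (p ^ e)) \<otimes> u" if "r \<in> carrier R" for r
    using that t u by (simp add: nat_pow_distrib m_assoc)
  then show "(t [^] (p ^ e)) \<otimes> u \<in> {u \<in> carrier R. \<forall>r\<in>carrier R. (r [^] (p ^ e)) \<otimes> u \<in> H}" using t u by auto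
qed auto

lemma gensE:
  assumes "gens e I n"
  obtains A where "finite A" "card A \<le> n" "A \<subseteq> carrier R" "carrier R \<subseteq> fhull e (I \<union> A)"
  using assms by (auto simp: qgen_def)

lemma gensI:
  assumes "finite A" "card A \<le> n" "A \<subseteq> carrier R" "carrier R \<subseteq> fhull e (I \<union> A)"
  shows "gens e I n"
  unfolding qgen_def using assms by (intro exI[of _ A]) simp

text \<open>The recurrence \<mu>(F^(e+f)_*(R / P)) <= k \<mu>(F^f_*(R / P)) + \<mu>(F^(e+f)_*(R / (P
  + (d)))). If A generates F^f_*(R / P), the products y a^(p^e) generate modulo P a submodule that
  contains d R; what remains lives over P + (d).\<close>

lemma gens_step:
  assumes P: "ideal P R" and Y: "finite Y" "card Y \<le> k" "Y \<subseteq> carrier R" and d: "d \<in> carrier R"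
    and dY: "\<And>r. r \<in> carrier R \<Longrightarrow> d \<otimes> r \<in> fhull e (P \<union> Y)"
    and m: "gens f P m" and n: "gens (e + f) (adjoin P d) n"
  shows "gens (e + f) P (k * m + n)"
proof -
  obtain A where A: "finite A" "card A \<le> m" "A \<subseteq> carrier R" "carrier R \<subseteq> fhull f (P \<union> A)" using m by (rule gensE)
  obtain C where C: "finite C" "card C \<le> n" "C \<subseteq> carrier R" "carrier R \<subseteq> fhull (e + f) ((adjoin P d) \<union> C)"
    using n by (rule gensE)
  let ?YA = "(\<lambda>(y, a). y \<otimes> (a [^] (p ^ e))) ` (Y \<times> A)"
  have Pc: "P \<subseteq> carrier R" by (rule ideal_in_carrier[OF P])
  have YAc: "?YA \<subseteq> carrier R" using subsetD[OF Y(3)] subsetD[OF A(3)] by auto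
  let ?B = "P \<union> (?YA \<union> C)"
  let ?H = "fhull (e + f) ?B"
  have Bc: "?B \<subseteq> carrier R" using Pc YAc C(3) by simp
  have H: "fsub (e + f) ?H" by (rule fsub_fhull[OF Bc])
  note h = fsubD[OF H]
  let ?W = "{u \<in> carrier R. \<forall>r\<in>carrier R. (r [^] (p ^ e)) \<otimes> u \<in> ?H}"
  have W: "fsub e ?W" by (rule fsub_saturate[OF H])
  have "P \<union> Y \<subseteq> ?W"
  proof
    fix y assume y: "y \<in> P \<union> Y"
    then have yc: "y \<in> carrier R" using Pc Y(3) by auto
    have "(r [^] (p ^ e)) \<otimes> y \<in> ?H" if r: "r \<in> carrier R" for r
    proof (cases "y \<in> P")
      case True
      then show ?thesis using r by (intro qhull_base UnI1 ideal_mult_left[OF P]) auto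
    next
      case False
      then have y': "y \<in> Y" using y by simp
      let ?U = "{x \<in> carrier R. y \<otimes> (x [^] (p ^ e)) \<in> ?H}"
      have U: "fsub f ?U" using fsub_vimage_frob[of f e ?H y] H yc by (simp add: add.commute)
      have "P \<union> A \<subseteq> ?U"
      proof
        fix x assume x: "x \<in> P \<union> A"
        then have xc: "x \<in> carrier R" using Pc A(3) by auto
        have "y \<otimes> (x [^] (p ^ e)) \<in> ?B"
        proof (cases "x \<in> P")
          case True
          then show ?thesis using ideal_mult_left[OF P yc ideal_frob_pow[OF P True]] by simp
        next
          case False
          then have "(y, x) \<in> Y \<times> A" using x y' by simp
          then show ?thesis by (auto intro!: rev_image_eqI[of "(y, x)"])
        qed
        then show "x \<in> ?U" using xc by (simp add: qhull_base)
      qed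
      then have "fhull f (P \<union> A) \<subseteq> ?U" by (rule qhull_least[OF U])
      then have "y \<otimes> (r [^] (p ^ e)) \<in> ?H" using A(4) r by auto
      then show ?thesis using yc r by (simp add: m_comm)
    qed
    then show "y \<in> ?W" using yc by simp
  qed
  then have W': "fhull e (P \<union> Y) \<subseteq> ?W" by (rule qhull_least[OF W])
  have dr: "r \<otimes> d \<in> ?H" if r: "r \<in> carrier R" for r
  proof -
    have "d \<otimes> r \<in> ?W" by (rule subsetD[OF W' dY[OF r]])
    then have "\<forall>t\<in>carrier R. (t [^] (p ^ e)) \<otimes> (d \<otimes> r) \<in> ?H" by simp
    then have "(\<one> [^] (p ^ e)) \<otimes> (d \<otimes> r) \<in> ?H" using one_closed by (rule bspec)
    then show ?thesis using d r by (simp add: m_comm)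
  qed
  have "(adjoin P d) \<union> C \<subseteq> ?H"
  proof
    fix x assume "x \<in> (adjoin P d) \<union> C"
    then show "x \<in> ?H"
    proof
      assume "x \<in> adjoin P d"
      then obtain i r where ir: "i \<in> P" "r \<in> carrier R" "x = i \<oplus> r \<otimes> d" using mem_adjoin[OF d] by auto
      then show ?thesis using h(3)[OF qhull_base dr[OF ir(2)]] by simp
    qed (simp add: qhull_base)
  qed
  then have "fhull (e + f) ((adjoin P d) \<union> C) \<subseteq> ?H" by (rule qhull_least[OF H])
  then have cov: "carrier R \<subseteq> ?H" using C(4) by simp
  have "card (?YA \<union> C) \<le> card ?YA + card C" by (rule card_Un_le)
  also have "card ?YA \<le> card (Y \<times> A)" by (rule card_image_le) (use Y A in simp)
  also have "\<dots> \<le> k * m" using Y A by (simp add: card_cartesian_product mult_le_mono)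
  finally have "card (?YA \<union> C) \<le> k * m + n" using C(2) by simp
  then show ?thesis using Y A C YAc cov by (intro gensI[of "?YA \<union> C"]) simp_all
qed

text \<open>Subadditivity along the exact sequence 0 -> R / (I : a) -> R / I -> R / (I + (a)) -> 0,
  whose first map is multiplication by a.\<close>

lemma gens_colon:
  assumes I: "ideal I R" and a: "a \<in> carrier R"
    and m: "gens e (adjoin I a) m" and n: "gens e {r \<in> carrier R. r \<otimes> a \<in> I} n"
  shows "gens e I (m + n)"
proof -
  let ?K = "{r \<in> carrier R. r \<otimes> a \<in> I}"
  obtain A where A: "finite A" "card A \<le> m" "A \<subseteq> carrier R" "carrier R \<subseteq> fhull e ((adjoin I a) \<union> A)" using m by (rule gensE)
  obtain B where B: "finite B" "card B \<le> n" "B \<subseteq> carrier R" "carrier R \<subseteq> fhull e (?K \<union> B)" using n by (rule gensE)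
  let ?aB = "(\<lambda>b. a \<otimes> b) ` B"
  let ?G = "I \<union> (A \<union> ?aB)"
  have Ic: "I \<subseteq> carrier R" by (rule ideal_in_carrier[OF I])
  have aBc: "?aB \<subseteq> carrier R" using a subsetD[OF B(3)] by auto
  have Gc: "?G \<subseteq> carrier R" using Ic A(3) aBc by simp
  have H: "fsub e (fhull e ?G)" by (rule fsub_fhull[OF Gc])
  have "?K \<union> B \<subseteq> {x \<in> carrier R. a \<otimes> x \<in> fhull e ?G}"
  proof
    fix x assume x: "x \<in> ?K \<union> B"
    then have xc: "x \<in> carrier R" using B(3) by auto
    have "a \<otimes> x \<in> ?G" using x a xc by (auto simp: m_comm)
    then show "x \<in> {x \<in> carrier R. a \<otimes> x \<in> fhull e ?G}" using xc by (simp add: qhull_base)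
  qed
  then have "fhull e (?K \<union> B) \<subseteq> {x \<in> carrier R. a \<otimes> x \<in> fhull e ?G}" by (rule qhull_least[OF fsub_vimage[OF H a]])
  then have ar: "a \<otimes> r \<in> fhull e ?G" if "r \<in> carrier R" for r using that B(4) by auto
  have "(adjoin I a) \<union> A \<subseteq> fhull e ?G"
  proof
    fix x assume "x \<in> (adjoin I a) \<union> A"
    then show "x \<in> fhull e ?G"
    proof
      assume "x \<in> adjoin I a"
      then obtain i r where ir: "i \<in> I" "r \<in> carrier R" "x = i \<oplus> r \<otimes> a" using mem_adjoin[OF a] by auto
      then show ?thesis using fsubD(3)[OF H qhull_base ar[OF ir(2)], of i] a by (simp add: m_comm)
    qed (simp add: qhull_base)
  qed
  then have "fhull e ((adjoin I a) \<union> A) \<subseteq> fhull e ?G" by (rule qhull_least[OF H])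
  then have cov: "carrier R \<subseteq> fhull e ?G" using A(4) by simp
  have "card (A \<union> ?aB) \<le> card A + card ?aB" by (rule card_Un_le)
  moreover have "card ?aB \<le> card B" by (rule card_image_le[OF B(1)])
  ultimately have "card (A \<union> ?aB) \<le> m + n" using A(2) B(2) by simp
  then show ?thesis using A B aBc cov by (intro gensI[of "A \<union> ?aB"]) simp_all
qed

lemma gens_carrier: "gens e (carrier R) 0"
  by (rule gensI[of "{}"]) (simp_all add: qhull_superset)

abbreviation len_bound :: "nat \<Rightarrow> 'a set \<Rightarrow> 'a set \<Rightarrow> 'a set \<Rightarrow> nat \<Rightarrow> bool" where
  "len_bound e Q U V t \<equiv> len_le R (p ^ e) Q U V t"

lemma qstepE:
  assumes "\<not> qstep R q Q U V" "y \<in> V"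
  obtains s where "s \<in> carrier R - Q" "(s [^] q) \<otimes> y \<in> U"
  using assms by (auto simp: qstep_def)

text \<open>A chain N between U and W induces the chains of intersections with V and of sums with V.
  If both have no counted step at k, then N has none: an element y is moved by s into n + v with n
  in the smaller term, the part v lies in V and in the larger term by the modular law, and a second
  factor t moves v down as well.\<close>

lemma len_bound_add:
  assumes Q: "primeideal Q R" and V: "fsub e V" and UV: "U \<subseteq> V" and VW: "V \<subseteq> W"
    and a: "len_bound e Q U V a" and b: "len_bound e Q V W b" and W: "fsub e W"
  shows "len_bound e Q U W (a + b)"
proof (rule len_leI)
  fix N :: "nat \<Rightarrow> 'a set" and T
  assume N: "\<And>k. fsub e (N k)" "\<And>k. U \<subseteq> N k" "\<And>k. N k \<subseteq> W" "\<And>k. N k \<subseteq> N (Suc k)"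
  have Vc: "V \<subseteq> carrier R" by (rule fsubD(1)[OF V])
  have Nc: "N k \<subseteq> carrier R" for k by (rule fsubD(1)[OF N(1)])
  let ?A = "\<lambda>k. N k \<inter> V" and ?B = "\<lambda>k. fhull e (N k \<union> V)"
  have A: "fsub e (?A k)" for k
    using fsubD[OF N(1)[of k]] fsubD[OF V] by (intro fsubI) auto
  have B: "fsub e (?B k)" for k using Nc Vc by (intro fsub_fhull) simp
  have "card {k. k < T \<and> qstep R (p ^ e) Q (?A k) (?A (Suc k))} \<le> a"
    by (rule len_leD[OF a, of ?A]) (use A N(2) UV subsetD[OF N(4)] in auto)
  moreover have "card {k. k < T \<and> qstep R (p ^ e) Q (?B k) (?B (Suc k))} \<le> b"
  proof (rule len_leD[OF b, of ?B])
    fix k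
    show "fsub e (?B k)" by (rule B)
    show "V \<subseteq> ?B k" using qhull_superset[of "N k \<union> V" R "p ^ e" "self_module R"] by simp
    show "?B k \<subseteq> W" using N(3)[of k] VW by (intro qhull_least[OF W]) simp
    show "?B k \<subseteq> ?B (Suc k)" using N(4)[of k] by (intro qhull_mono) auto
  qed
  moreover have "{k. k < T \<and> qstep R (p ^ e) Q (N k) (N (Suc k))} \<subseteq>
      {k. k < T \<and> qstep R (p ^ e) Q (?A k) (?A (Suc k))} \<union> {k. k < T \<and> qstep R (p ^ e) Q (?B k) (?B (Suc k))}"
  proof
    fix k assume k: "k \<in> {k. k < T \<and> qstep R (p ^ e) Q (N k) (N (Suc k))}"
    show "k \<in> {k. k < T \<and> qstep R (p ^ e) Q (?A k) (?A (Suc k))} \<union> {k. k < T \<and> qstep R (p ^ e) Q (?B k) (?B (Suc k))}"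
    proof (rule ccontr)
      assume "\<not> ?thesis"
      then have nA: "\<not> qstep R (p ^ e) Q (?A k) (?A (Suc k))" and nB: "\<not> qstep R (p ^ e) Q (?B k) (?B (Suc k))" using k by auto
      have "\<exists>s\<in>carrier R - Q. (s [^] (p ^ e)) \<otimes> y \<in> N k" if y: "y \<in> N (Suc k)" for y
      proof -
        have yc: "y \<in> carrier R" using y Nc by auto
        have "y \<in> ?B (Suc k)" using y by (simp add: qhull_base)
        from qstepE[OF nB this] obtain s where s: "s \<in> carrier R - Q" "(s [^] (p ^ e)) \<otimes> y \<in> ?B k" .
        from S.qhull_UnE[OF N(1) V s(2)] obtain n v where nv: "n \<in> N k" "v \<in> V" "(s [^] (p ^ e)) \<otimes> y = n \<oplus> v" by auto
        have c: "n \<in> carrier R" "v \<in> carrier R" using nv Nc Vc by auto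
        have "n \<oplus> v \<in> N (Suc k)" using fsubD(4)[OF N(1), of s y "Suc k"] s y nv(3) by simp
        then have "v \<oplus> n \<in> N (Suc k)" using c by (simp add: a_comm)
        then have "v \<in> N (Suc k)" using fsub_cancel[OF N(1)] nv(1) N(4) c by blast
        then have "v \<in> ?A (Suc k)" using nv by simp
        from qstepE[OF nA this] obtain t where t: "t \<in> carrier R - Q" "(t [^] (p ^ e)) \<otimes> v \<in> ?A k" .
        have "((t \<otimes> s) [^] (p ^ e)) \<otimes> y = (t [^] (p ^ e)) \<otimes> n \<oplus> (t [^] (p ^ e)) \<otimes> v"
          using s t yc c nv(3) by (simp add: nat_pow_distrib m_assoc r_distr)
        moreover have "(t [^] (p ^ e)) \<otimes> n \<oplus> (t [^] (p ^ e)) \<otimes> v \<in> N k"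
          by (rule fsubD(3)[OF N(1) fsubD(4)[OF N(1)]]) (use t nv in auto)
        ultimately show ?thesis using prod_notin_prime[OF Q t(1) s(1)] by (intro bexI[of _ "t \<otimes> s"]) simp_all
      qed
      then have "\<not> qstep R (p ^ e) Q (N k) (N (Suc k))" unfolding qstep_def by blast
      then show False using k by simp
    qed
  qed
  then have "card {k. k < T \<and> qstep R (p ^ e) Q (N k) (N (Suc k))} \<le>
      card ({k. k < T \<and> qstep R (p ^ e) Q (?A k) (?A (Suc k))} \<union> {k. k < T \<and> qstep R (p ^ e) Q (?B k) (?B (Suc k))})"
    by (intro card_mono) simp_all
  moreover have "card ({k. k < T \<and> qstep R (p ^ e) Q (?A k) (?A (Suc k))} \<union> {k. k < T \<and> qstep R (p ^ e) Q (?B k) (?B (Suc k))})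
      \<le> card {k. k < T \<and> qstep R (p ^ e) Q (?A k) (?A (Suc k))} + card {k. k < T \<and> qstep R (p ^ e) Q (?B k) (?B (Suc k))}"
    by (rule card_Un_le)
  ultimately show "card {k. k < T \<and> qstep R (p ^ e) Q (N k) (N (Suc k))} \<le> a + b" by linarith
qed

lemma len_bound_zero:
  assumes "\<And>y. y \<in> V \<Longrightarrow> \<exists>s\<in>carrier R - Q. (s [^] (p ^ e)) \<otimes> y \<in> U"
  shows "len_bound e Q U V 0"
proof (rule len_leI)
  fix N :: "nat \<Rightarrow> 'a set" and T
  assume N: "\<And>k. fsub e (N k)" "\<And>k. U \<subseteq> N k" "\<And>k. N k \<subseteq> V" "\<And>k. N k \<subseteq> N (Suc k)"
  have "\<not> qstep R (p ^ e) Q (N k) (N (Suc k))" for k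
    unfolding qstep_def using assms N(2)[of k] N(3)[of "Suc k"] by blast
  then show "card {k. k < T \<and> qstep R (p ^ e) Q (N k) (N (Suc k))} \<le> 0" by simp
qed

text \<open>At Q the quotient is a \<kappa>(Q)-space spanned by a, hence of dimension at most 1.
  Concretely, a first counted step contains x + r^(p^e) a with r outside Q, so r^(p^e) a lies in
  every later term, and r itself is a denominator that excludes a second counted step.\<close>

lemma len_bound_cyclic:
  assumes Q: "primeideal Q R" and U: "fsub e U" and a: "a \<in> carrier R"
    and QaU: "\<And>u. u \<in> Q \<Longrightarrow> (u [^] (p ^ e)) \<otimes> a \<in> U"
  shows "len_bound e Q U (fhull e (insert a U)) 1"
proof (rule len_leI)
  fix N :: "nat \<Rightarrow> 'a set" and T
  assume N: "\<And>k. fsub e (N k)" "\<And>k. U \<subseteq> N k" "\<And>k. N k \<subseteq> fhull e (insert a U)" "\<And>k. N k \<subseteq> N (Suc k)"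
  have one: "\<one> \<in> carrier R - Q" using one_notin_prime[OF Q] by simp
  have Nc: "N k \<subseteq> carrier R" for k by (rule fsubD(1)[OF N(1)])
  have Uc: "U \<subseteq> carrier R" by (rule fsubD(1)[OF U])
  have mono: "N i \<subseteq> N j" if "i \<le> j" for i j using N(4) that by (rule lift_Suc_mono_le)
  let ?S = "{k. k < T \<and> qstep R (p ^ e) Q (N k) (N (Suc k))}"
  have less: False if k: "k \<in> ?S" "k' \<in> ?S" "k < k'" for k k'
  proof -
    obtain y where y: "y \<in> N (Suc k)" "\<And>s. s \<in> carrier R - Q \<Longrightarrow> (s [^] (p ^ e)) \<otimes> y \<notin> N k"
      using k(1) unfolding qstep_def by auto
    obtain z where z: "z \<in> N (Suc k')" "\<And>s. s \<in> carrier R - Q \<Longrightarrow> (s [^] (p ^ e)) \<otimes> z \<notin> N k'"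
      using k(2) unfolding qstep_def by auto
    have ac: "a \<in> carrier (self_module R)" using a by simp
    obtain x r where xr: "x \<in> U" "r \<in> carrier R" "y = x \<oplus> (r [^] (p ^ e)) \<otimes> a"
      using S.qhull_insertE[OF U ac subsetD[OF N(3) y(1)]] by auto
    obtain x' r' where xr': "x' \<in> U" "r' \<in> carrier R" "z = x' \<oplus> (r' [^] (p ^ e)) \<otimes> a"
      using S.qhull_insertE[OF U ac subsetD[OF N(3) z(1)]] by auto
    have xc: "x \<in> carrier R" "x' \<in> carrier R" using xr xr' Uc by auto
    have "r \<notin> Q"
    proof
      assume "r \<in> Q"
      then have "y \<in> U" using xr(1,3) QaU fsubD(3)[OF U] by simp
      then have "(\<one> [^] (p ^ e)) \<otimes> y \<in> N k" using N(2)[of k] subsetD[OF Uc, of y] by auto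
      then show False using y(2)[OF one] by simp
    qed
    then have r: "r \<in> carrier R - Q" using xr by simp
    have "(r [^] (p ^ e)) \<otimes> a \<oplus> x \<in> N (Suc k)" using y(1) xr xc a by (simp add: a_comm)
    moreover have "x \<in> N (Suc k)" using xr(1) N(2) by auto
    ultimately have "(r [^] (p ^ e)) \<otimes> a \<in> N (Suc k)" using fsub_cancel[OF N(1)] xr(2) a by simp
    then have ra: "(r [^] (p ^ e)) \<otimes> a \<in> N k'" using mono[of "Suc k" k'] k(3) by auto
    have "(r [^] (p ^ e)) \<otimes> z = (r [^] (p ^ e)) \<otimes> x' \<oplus> (r' [^] (p ^ e)) \<otimes> ((r [^] (p ^ e)) \<otimes> a)"
      using xr xr' xc a by (simp add: r_distr m_lcomm)
    moreover have "x' \<in> N k'" using xr'(1) N(2) by auto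
    ultimately have "(r [^] (p ^ e)) \<otimes> z \<in> N k'"
      using xr(2) xr'(2) ra by (auto intro!: fsubD(3)[OF N(1)] fsubD(4)[OF N(1)])
    then show False using z(2)[OF r] by simp
  qed
  have eq: "k = k'" if "k \<in> ?S" "k' \<in> ?S" for k k'
    using less[OF that] less[OF that(2,1)] by (cases k k' rule: linorder_cases) blast+
  have "finite ?S" by simp
  from card_le_Suc0_iff_eq[OF this] have "card ?S \<le> Suc 0" by (rule iffD2) (intro ballI eq)
  then show "card ?S \<le> 1" by simp
qed

text \<open>The bound t is required over every U above \<open>U0\<close>, because each generator is
  adjoined to the span of \<open>U0\<close> and the generators already present.\<close>

lemma len_bound_list:
  assumes Q: "primeideal Q R"
    and step: "\<And>a U. a \<in> set as \<Longrightarrow> fsub e U \<Longrightarrow> U0 \<subseteq> U \<Longrightarrow> len_bound e Q U (fhull e (insert a U)) t"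
    and U0: "fsub e U0" and as: "set as \<subseteq> carrier R"
  shows "len_bound e Q U0 (fhull e (U0 \<union> set as)) (length as * t)"
  using step as
proof (induction as)
  case Nil
  have "len_bound e Q U0 U0 0"
    by (rule len_bound_zero)
      (use primeideal.I_notcarr[OF Q] ideal.one_imp_carrier[OF primeideal.axioms(1)[OF Q]] fsubD(1)[OF U0] in
        \<open>auto intro!: bexI[of _ \<one>]\<close>)
  then show ?case using qhull_qsub_eq[OF U0] by simp
next
  case (Cons a as)
  have U0c: "U0 \<subseteq> carrier R" by (rule fsubD(1)[OF U0])
  have ac: "U0 \<union> set as \<subseteq> carrier R" "a \<in> carrier R" using Cons.prems U0c by auto
  let ?V = "fhull e (U0 \<union> set as)" and ?W = "fhull e (U0 \<union> set (a # as))"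
  have V: "fsub e ?V" by (rule fsub_fhull[OF ac(1)])
  have W: "fsub e ?W" by (rule fsub_fhull) (use ac in simp)
  have 1: "len_bound e Q U0 ?V (length as * t)" using Cons by simp
  have U0V: "U0 \<subseteq> ?V" using qhull_superset[of "U0 \<union> set as" R "p ^ e" "self_module R"] by simp
  have "len_bound e Q ?V (fhull e (insert a ?V)) t" by (rule Cons.prems(1)[OF _ V U0V]) simp
  moreover have "?W \<subseteq> fhull e (insert a ?V)"
  proof (rule qhull_least)
    show "fsub e (fhull e (insert a ?V))" by (rule fsub_fhull) (use ac fsubD(1)[OF V] in simp)
    show "U0 \<union> set (a # as) \<subseteq> fhull e (insert a ?V)"
    proof
      fix x assume "x \<in> U0 \<union> set (a # as)"
      then have "x \<in> insert a ?V" by (auto intro: qhull_base)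
      then show "x \<in> fhull e (insert a ?V)" by (rule qhull_base)
    qed
  qed
  ultimately have 2: "len_bound e Q ?V ?W t" by (rule len_le_mono[OF _ subset_refl _ le_refl])
  have "?V \<subseteq> ?W" by (rule qhull_mono) auto
  from len_bound_add[OF Q V U0V this 1 2 W] show ?case by (simp add: add.commute)
qed

definition prodl :: "'a list \<Rightarrow> 'a" where
  "prodl xs = foldr (\<otimes>) xs \<one>"

lemma prodl_simps [simp]: "prodl [] = \<one>" "prodl (x # xs) = x \<otimes> prodl xs"
  by (simp_all add: prodl_def)

lemma prodl_closed [simp]: "set xs \<subseteq> carrier R \<Longrightarrow> prodl xs \<in> carrier R"
  by (induction xs) auto

text \<open>Equal to 1 + h + ... + h^(m-1), the number of words of length less than m in h letters.
  It bounds the length at Q of R modulo the m-th power of Q when Q has h generators.\<close>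

fun nest_len :: "nat \<Rightarrow> nat \<Rightarrow> nat" where
  "nest_len h 0 = 0"
| "nest_len h (Suc m) = Suc (h * nest_len h m)"

text \<open>The constant \<open>nest_len h m\<close> does not depend on \<open>e\<close>, which is what makes the count useful.\<close>

lemma len_bound_nilpotent:
  assumes Q: "primeideal Q R" and us: "Q \<subseteq> fhull 0 (set us)" "set us \<subseteq> Q"
    and U: "fsub e U" and a: "a \<in> carrier R" and s: "s \<in> carrier R - Q"
    and nil: "\<And>rs. length rs = m \<Longrightarrow> set rs \<subseteq> Q \<Longrightarrow> ((s \<otimes> prodl rs) [^] (p ^ e)) \<otimes> a \<in> U"
  shows "len_bound e Q U (fhull e (insert a U)) (nest_len (length us) m)"
  using U a nil
proof (induction m arbitrary: a U)
  case 0
  have sa: "(s [^] (p ^ e)) \<otimes> a \<in> U" using "0.prems"(3)[of "[]"] s by simp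
  have ac: "a \<in> carrier (self_module R)" using 0 by simp
  have "(s [^] (p ^ e)) \<otimes> y \<in> U" if y: "y \<in> fhull e (insert a U)" for y
  proof -
    obtain x r where xr: "x \<in> U" "r \<in> carrier R" "y = x \<oplus> (r [^] (p ^ e)) \<otimes> a"
      using S.qhull_insertE[OF "0.prems"(1) ac y] by auto
    have xc: "x \<in> carrier R" using xr fsubD(1)[OF "0.prems"(1)] by auto
    have "(s [^] (p ^ e)) \<otimes> y = (s [^] (p ^ e)) \<otimes> x \<oplus> (r [^] (p ^ e)) \<otimes> ((s [^] (p ^ e)) \<otimes> a)"
      using xr xc s 0 by (simp add: r_distr m_lcomm)
    then show ?thesis using xr s sa
      by (auto intro!: fsubD(3)[OF "0.prems"(1)] fsubD(4)[OF "0.prems"(1)])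
  qed
  then have "len_bound e Q U (fhull e (insert a U)) 0" using s by (intro len_bound_zero) auto
  then show ?case by simp
next
  case (Suc m)
  interpret Q: primeideal Q R by fact
  have Qc: "Q \<subseteq> carrier R" by (rule ideal_in_carrier[OF Q.is_ideal])
  have Uc: "U \<subseteq> carrier R" by (rule fsubD(1)[OF Suc.prems(1)])
  \<comment> \<open>The submodule V spanned by U and the u^(p^e) a splits the quotient: each new
    generator is killed by products of one factor fewer, while above V only a cyclic quotient killed
    by Q is left, which accounts for the summand 1.\<close>
  let ?as = "map (\<lambda>u. (u [^] (p ^ e)) \<otimes> a) us"
  have asc: "set ?as \<subseteq> carrier R" using us(2) Qc Suc.prems(2) by auto
  let ?V = "fhull e (U \<union> set ?as)"
  have V: "fsub e ?V" by (rule fsub_fhull) (use Uc asc in simp)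
  have "len_bound e Q U ?V (length ?as * nest_len (length us) m)"
  proof (rule len_bound_list[OF Q _ Suc.prems(1) asc])
    fix b U' assume b: "b \<in> set ?as" and U': "fsub e U'" "U \<subseteq> U'"
    obtain u where u: "u \<in> set us" "b = (u [^] (p ^ e)) \<otimes> a" using b by auto
    have uc: "u \<in> Q" "u \<in> carrier R" using u us Qc by auto
    show "len_bound e Q U' (fhull e (insert b U')) (nest_len (length us) m)"
    proof (rule Suc.IH[OF U'(1)])
      show "b \<in> carrier R" using b asc by auto
      fix rs assume rs: "length rs = m" "set rs \<subseteq> Q"
      have rc: "prodl rs \<in> carrier R" using rs Qc by simp
      have "((s \<otimes> prodl (u # rs)) [^] (p ^ e)) \<otimes> a \<in> U" using rs uc by (intro Suc.prems(3)) auto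
      moreover have "((s \<otimes> prodl (u # rs)) [^] (p ^ e)) \<otimes> a = ((s \<otimes> prodl rs) [^] (p ^ e)) \<otimes> b"
        using s rc uc Suc.prems(2) by (simp add: u nat_pow_distrib m_ac)
      ultimately show "((s \<otimes> prodl rs) [^] (p ^ e)) \<otimes> b \<in> U'" using U'(2) by auto
    qed
  qed
  then have 1: "len_bound e Q U ?V (length us * nest_len (length us) m)" by simp
  have "len_bound e Q ?V (fhull e (insert a ?V)) 1"
  proof (rule len_bound_cyclic[OF Q V Suc.prems(2)])
    fix u assume u: "u \<in> Q"
    \<comment> \<open>Since Frobenius is additive this set is an ideal, so it contains all of Q as
      soon as it contains the generators \<open>us\<close>.\<close>
    let ?S = "{x \<in> carrier R. a \<otimes> (x [^] (p ^ e)) \<in> ?V}"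
    have S: "fsub 0 ?S" by (rule fsub_vimage_frob[of 0 e]) (use V Suc.prems(2) in simp_all)
    have "set us \<subseteq> ?S"
    proof
      fix x assume x: "x \<in> set us"
      then have xc: "x \<in> carrier R" using us(2) Qc by auto
      have "(x [^] (p ^ e)) \<otimes> a \<in> ?V" using x by (intro qhull_base) auto
      then show "x \<in> ?S" using xc Suc.prems(2) by (simp add: m_comm)
    qed
    then have "fhull 0 (set us) \<subseteq> ?S" by (rule qhull_least[OF S])
    then have "u \<in> ?S" using u us(1) by auto
    then show "(u [^] (p ^ e)) \<otimes> a \<in> ?V" using Suc.prems(2) by (simp add: m_comm)
  qed
  moreover have UV: "U \<subseteq> ?V" using qhull_superset[of "U \<union> set ?as" R "p ^ e" "self_module R"] by simp
  have "fhull e (insert a U) \<subseteq> fhull e (insert a ?V)" by (rule qhull_mono) (use UV in auto)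
  ultimately have 2: "len_bound e Q ?V (fhull e (insert a U)) 1" by (rule len_le_mono[OF _ subset_refl _ le_refl])
  have W: "fsub e (fhull e (insert a U))" by (rule fsub_fhull) (use Uc Suc.prems(2) in simp)
  have VW: "?V \<subseteq> fhull e (insert a U)"
  proof (rule qhull_least[OF W])
    show "U \<union> set ?as \<subseteq> fhull e (insert a U)"
    proof
      fix x assume "x \<in> U \<union> set ?as"
      then show "x \<in> fhull e (insert a U)"
      proof
        assume "x \<in> set ?as"
        then obtain u where "u \<in> set us" "x = (u [^] (p ^ e)) \<otimes> a" by auto
        then show ?thesis using us(2) Qc fsubD(4)[OF W, of u a] qhull_base[of a "insert a U" R "p ^ e" "self_module R"] by auto
      qed (simp add: qhull_base)
    qed
  qed
  from len_bound_add[OF Q V UV VW 1 2 W] show ?case by simp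
qed

text \<open>The spans of the tails of \<open>zs\<close> increase as the tails grow, and each new
  entry gives a counted step, so an independent list is no longer than the length allows.\<close>

lemma strict_length_le:
  assumes B: "B \<subseteq> carrier R" and zs: "strict R (p ^ e) Q B zs" and t: "len_bound e Q (fhull e B) (carrier R) t"
  shows "length zs \<le> t"
proof -
  let ?T = "length zs"
  \<comment> \<open>Tails rather than initial segments, because \<open>strict\<close> compares an
    entry with the entries after it.\<close>
  let ?N = "\<lambda>k. fhull e (B \<union> set (drop (?T - k) zs))"
  have zc: "set zs \<subseteq> carrier R" by (rule strict_carrier[OF zs])
  have c: "B \<union> set (drop k zs) \<subseteq> carrier R" for k using B zc set_drop_subset[of k zs] by auto
  have st: "strict R (p ^ e) Q B (drop k zs)" for k
    using zs
  proof (induction zs arbitrary: k)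
    case (Cons z zs)
    then show ?case by (cases k) auto
  qed simp
  have "card {k. k < ?T \<and> qstep R (p ^ e) Q (?N k) (?N (Suc k))} \<le> t"
  proof (rule len_leD[OF t, of ?N])
    fix k
    show "fsub e (?N k)" by (rule fsub_fhull[OF c])
    show "?N k \<subseteq> carrier R" by (rule fhull_carrier[OF c])
    show "fhull e B \<subseteq> ?N k" by (rule qhull_mono) simp
    have "set (drop (?T - k) zs) \<subseteq> set (drop (?T - Suc k) zs)" by (rule set_drop_subset_set_drop) simp
    then show "?N k \<subseteq> ?N (Suc k)" by (intro qhull_mono) auto
  qed
  moreover have "qstep R (p ^ e) Q (?N k) (?N (Suc k))" if k: "k < ?T" for k
  proof -
    have d: "drop (?T - Suc k) zs = zs ! (?T - Suc k) # drop (?T - k) zs"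
      using k by (subst Cons_nth_drop_Suc[symmetric]) (simp_all add: Suc_diff_Suc)
    from st[of "?T - Suc k"] have "\<forall>s\<in>carrier R - Q. (s [^] (p ^ e)) \<otimes> (zs ! (?T - Suc k)) \<notin> ?N k" unfolding d by simp
    moreover have "zs ! (?T - Suc k) \<in> ?N (Suc k)" by (rule qhull_base) (simp add: d)
    ultimately show ?thesis unfolding qstep_def by blast
  qed
  then have "{k. k < ?T \<and> qstep R (p ^ e) Q (?N k) (?N (Suc k))} = {..<?T}" by auto
  ultimately show ?thesis by simp
qed

end

text \<open>A gap between \<beta> and \<rho> keeps the error terms summable relative to \<rho>^e;
  with \<beta> = \<rho> a factor e could appear.\<close>

lemma real_recurrence_bound:
  fixes g :: "nat \<Rightarrow> real"
  assumes g: "\<And>e. 0 \<le> g e" and rec: "\<And>e. g (Suc e) \<le> \<nu> * g e + C * \<beta> ^ Suc e"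
    and \<rho>: "\<nu> \<le> \<rho>" "\<beta> < \<rho>" and \<beta>: "0 \<le> \<beta>" and C: "0 \<le> C"
  shows "\<exists>K\<ge>0. \<forall>e. g e \<le> K * \<rho> ^ e"
proof -
  \<comment> \<open>Chosen so that -D \<beta>^e solves the inhomogeneous recurrence with factor
    \<rho>; subtracting it makes the induction close without loss.\<close>
  define D where "D = C * \<beta> / (\<rho> - \<beta>)"
  have D: "0 \<le> D" "D * (\<rho> - \<beta>) = C * \<beta>" using \<rho> \<beta> C by (simp_all add: D_def)
  have "g e \<le> (g 0 + D) * \<rho> ^ e - D * \<beta> ^ e" for e
  proof (induction e)
    case (Suc e)
    have "g (Suc e) \<le> \<rho> * g e + C * \<beta> ^ Suc e"
      using rec[of e] mult_right_mono[OF \<rho>(1) g[of e]] by linarith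
    also have "\<rho> * g e \<le> \<rho> * ((g 0 + D) * \<rho> ^ e - D * \<beta> ^ e)"
      using Suc \<rho> \<beta> by (intro mult_left_mono) auto
    also have "\<rho> * ((g 0 + D) * \<rho> ^ e - D * \<beta> ^ e) + C * \<beta> ^ Suc e
        = (g 0 + D) * \<rho> ^ Suc e - D * \<beta> ^ Suc e + \<beta> ^ e * (C * \<beta> - D * (\<rho> - \<beta>))"
      by (simp add: algebra_simps)
    finally show ?case using D(2) by simp
  qed simp
  moreover have "0 \<le> D * \<beta> ^ e" for e using D \<beta> by simp
  ultimately have "g e \<le> (g 0 + D) * \<rho> ^ e" for e by (smt (verit))
  then show ?thesis using g[of 0] D by (intro exI[of _ "g 0 + D"]) auto
qed

lemma (in cring) not_primeE:
  assumes "ideal I R" "I \<noteq> carrier R" "\<not> primeideal I R"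
  obtains a b where "a \<in> carrier R" "b \<in> carrier R" "a \<otimes> b \<in> I" "a \<notin> I" "b \<notin> I"
  using primeidealI[OF assms(1) is_cring assms(2)[symmetric]] assms(3) by blast

section \<open>Chains by powers of x and a lower bound for generators\<close>

context frob
begin

lemma fsub0_ideal:
  assumes "fsub 0 U"
  shows "ideal U R"
proof (rule idealI[OF ring_axioms])
  note h = fsubD[OF assms]
  show "subgroup U (add_monoid R)"
    by (rule add.subgroupI) (use h S.qsub_neg[OF assms] in \<open>auto simp: a_inv_def[symmetric]\<close>)
  fix r x assume rx: "r \<in> U" "x \<in> carrier R"
  then show "x \<otimes> r \<in> U" by (intro fsub0_mult[OF assms])
  then show "r \<otimes> x \<in> U" using rx h(1) by (simp add: m_comm subset_iff)
qed

lemma genideal_subset_fhull: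
  assumes "A \<subseteq> carrier R"
  shows "Idl A \<subseteq> fhull 0 A"
  by (rule genideal_minimal[OF fsub0_ideal[OF fsub_fhull[OF assms]] qhull_superset])

text \<open>The layers x^(q-j), ..., x^(q-1) times \<open>ys\<close>, lowest power first, so that
  all entries after a layer are deeper in the filtration. The recursion starts with the layer next
  to x^q, which already belongs to the base ideal.\<close>

fun chain_list :: "nat \<Rightarrow> 'a \<Rightarrow> 'a list \<Rightarrow> nat \<Rightarrow> 'a list" where
  "chain_list q x ys 0 = []"
| "chain_list q x ys (Suc j) = map (\<lambda>y. (x [^] (q - Suc j)) \<otimes> y) ys @ chain_list q x ys j"

lemma length_chain_list [simp]: "length (chain_list q x ys j) = j * length ys"
  by (induction j) auto

lemma set_chain_list:
  "z \<in> set (chain_list q x ys j) \<Longrightarrow> \<exists>i y. q - j \<le> i \<and> i < q \<and> y \<in> set ys \<and> z = (x [^] i) \<otimes> y" if "j \<le> q"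
  using that
proof (induction j)
  case (Suc j)
  from Suc.prems consider "z \<in> set (map (\<lambda>y. (x [^] (q - Suc j)) \<otimes> y) ys)" | "z \<in> set (chain_list q x ys j)" by auto
  then show ?case
  proof cases
    case 1
    then show ?thesis using Suc.prems by (auto intro!: exI[of _ "q - Suc j"])
  next
    case 2
    from Suc.IH[OF this] Suc.prems obtain i y where "q - j \<le> i" "i < q" "y \<in> set ys" "z = (x [^] i) \<otimes> y" by auto
    then show ?thesis by (intro exI[of _ i] exI[of _ y]) auto
  qed
qed simp

text \<open>Adds the layer x^i. As i < p^e, the base ideal and the deeper layers lie in P + x^i Q,
  so modulo P every combination is x^i c with c in the span of Q and the later \<open>ys\<close>. A
  relation gives x^i (s^(p^e) y - c) in P; since x is not in the prime P, the second factor lies in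
  P, hence in Q, against the independence of \<open>ys\<close> at Q.\<close>

lemma strict_map_aux:
  assumes P: "primeideal P R" and Q: "primeideal Q R" and PQ: "P \<subseteq> Q" and x: "x \<in> Q" "x \<notin> P"
    and i: "i < p ^ e" and ys: "strict R (p ^ e) Q Q ys"
    and L: "strict R (p ^ e) Q (adjoin P (x [^] (p ^ e))) L"
    and Lset: "\<And>z. z \<in> set L \<Longrightarrow> \<exists>t\<in>Q. z = (x [^] i) \<otimes> t"
  shows "strict R (p ^ e) Q (adjoin P (x [^] (p ^ e))) (map (\<lambda>y. (x [^] i) \<otimes> y) ys @ L)"
  using ys
proof (induction ys)
  case Nil
  then show ?case using L by simp
next
  case (Cons y ys)
  have IP: "ideal P R" and IQ: "ideal Q R" using P Q by (simp_all add: primeideal.axioms)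
  have Pc: "P \<subseteq> carrier R" and Qc: "Q \<subseteq> carrier R" by (simp_all add: ideal_in_carrier IP IQ)
  have xc: "x \<in> carrier R" using x Qc by auto
  let ?J = "adjoin P (x [^] (p ^ e))"
  let ?L = "map (\<lambda>y. (x [^] i) \<otimes> y) ys @ L"
  let ?xi = "x [^] i"
  have xi: "?xi \<in> carrier R" using xc by simp
  have yc: "y \<in> carrier R" "set ys \<subseteq> carrier R" using strict_carrier[OF Cons.prems] by auto
  let ?H = "fhull e (Q \<union> set ys)"
  have H: "fsub e ?H" by (rule fsub_fhull) (use Qc yc in simp)
  note h = fsubD[OF H]
  have PP: "fsub e P" by (rule ideal_fsub[OF IP])
  let ?T = "{u \<in> carrier R. \<exists>c\<in>?H. u \<ominus> ?xi \<otimes> c \<in> P}"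
  have T: "fsub e ?T"
  proof (rule fsubI)
    have "\<zero> \<ominus> ?xi \<otimes> \<zero> = \<zero>" using xi by (simp add: minus_eq)
    then show "\<zero> \<in> ?T" using h(2) fsubD(2)[OF PP] by (auto intro!: bexI[of _ \<zero>])
  next
    fix u v assume "u \<in> ?T" "v \<in> ?T"
    then obtain c d where cd: "u \<in> carrier R" "v \<in> carrier R" "c \<in> ?H" "d \<in> ?H" "u \<ominus> ?xi \<otimes> c \<in> P" "v \<ominus> ?xi \<otimes> d \<in> P" by auto
    have "(u \<oplus> v) \<ominus> a \<otimes> (c \<oplus> d) = (u \<ominus> a \<otimes> c) \<oplus> (v \<ominus> a \<otimes> d)" if a: "a \<in> carrier R" for a
    proof -
      have "c \<in> carrier R" "d \<in> carrier R" using cd h(1) by auto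
      then show ?thesis using a cd(1,2) by algebra
    qed
    from this[OF xi] have "(u \<oplus> v) \<ominus> ?xi \<otimes> (c \<oplus> d) \<in> P" using fsubD(3)[OF PP] cd by simp
    then show "u \<oplus> v \<in> ?T" using cd h(3) by (auto intro!: bexI[of _ "c \<oplus> d"])
  next
    fix r u assume r: "r \<in> carrier R" and "u \<in> ?T"
    then obtain c where c: "u \<in> carrier R" "c \<in> ?H" "u \<ominus> ?xi \<otimes> c \<in> P" by auto
    have "b \<otimes> u \<ominus> a \<otimes> (b \<otimes> c) = b \<otimes> (u \<ominus> a \<otimes> c)" if a: "a \<in> carrier R" "b \<in> carrier R" for a b
    proof -
      have "c \<in> carrier R" using c h(1) by auto
      then show ?thesis using a c(1) by algebra
    qed
    from this[OF xi, of "r [^] (p ^ e)"]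
    have "(r [^] (p ^ e)) \<otimes> u \<ominus> ?xi \<otimes> ((r [^] (p ^ e)) \<otimes> c) \<in> P" using fsubD(4)[OF PP r c(3)] r by simp
    then show "(r [^] (p ^ e)) \<otimes> u \<in> ?T" using c r h(4)[OF r c(2)] by (auto intro!: bexI[of _ "(r [^] (p ^ e)) \<otimes> c"])
  qed auto
  have TI: "i0 \<oplus> ?xi \<otimes> c \<in> ?T" if "i0 \<in> P" "c \<in> ?H" for i0 c
  proof -
    have c: "i0 \<in> carrier R" "c \<in> carrier R" using that Pc h(1) by auto
    have "(i0 \<oplus> b) \<ominus> b = i0" if "b \<in> carrier R" for b using that c(1) by algebra
    then have "(i0 \<oplus> ?xi \<otimes> c) \<ominus> ?xi \<otimes> c = i0" using c xi by simp
    then show ?thesis using that c xi by (auto intro!: bexI[of _ c])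
  qed
  have QH: "t \<in> ?H" if "t \<in> Q" for t using that by (simp add: qhull_base)
  have P0: "\<zero> \<in> P" by (rule fsubD(2)[OF PP])
  have "?J \<union> set ?L \<subseteq> ?T"
  proof
    fix u assume "u \<in> ?J \<union> set ?L"
    then consider "u \<in> ?J" | y' where "y' \<in> set ys" "u = ?xi \<otimes> y'" | "u \<in> set L" by auto
    then show "u \<in> ?T"
    proof cases
      case 1
      then obtain i0 r where ir: "i0 \<in> P" "r \<in> carrier R" "u = i0 \<oplus> r \<otimes> (x [^] (p ^ e))"
        using mem_adjoin[of "x [^] (p ^ e)" u P] xc by auto
      obtain k where k: "p ^ e = i + Suc k" using i less_iff_Suc_add by auto
      have "x [^] (p ^ e) = ?xi \<otimes> ((x [^] k) \<otimes> x)" unfolding k using xc by (simp add: nat_pow_mult[symmetric] m_assoc)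
      then have "r \<otimes> (x [^] (p ^ e)) = ?xi \<otimes> ((r \<otimes> (x [^] k)) \<otimes> x)" using ir(2) xc by (simp add: m_ac)
      moreover have "(r \<otimes> (x [^] k)) \<otimes> x \<in> Q" using ir(2) xc x by (intro ideal_mult_left[OF IQ]) auto
      ultimately show ?thesis using TI[OF ir(1) QH] ir(3) by simp
    next
      case 2
      then have "y' \<in> ?H" "y' \<in> carrier R" using yc by (auto intro: qhull_base)
      then show ?thesis using TI[OF P0, of y'] 2 xi by simp
    next
      case 3
      then obtain t where t: "t \<in> Q" "u = ?xi \<otimes> t" using Lset by blast
      then have "t \<in> carrier R" using Qc by auto
      then show ?thesis using TI[OF P0 QH[OF t(1)]] t xi by simp
    qed
  qed
  then have incl: "fhull e (?J \<union> set ?L) \<subseteq> ?T" by (rule qhull_least[OF T])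
  have "(s [^] (p ^ e)) \<otimes> (?xi \<otimes> y) \<notin> fhull e (?J \<union> set ?L)" if s: "s \<in> carrier R - Q" for s
  proof
    assume "(s [^] (p ^ e)) \<otimes> (?xi \<otimes> y) \<in> fhull e (?J \<union> set ?L)"
    with incl have "(s [^] (p ^ e)) \<otimes> (?xi \<otimes> y) \<in> ?T" by (rule subsetD)
    then obtain c where c: "c \<in> ?H" "(s [^] (p ^ e)) \<otimes> (?xi \<otimes> y) \<ominus> ?xi \<otimes> c \<in> P" by auto
    have cc: "c \<in> carrier R" using c h(1) by auto
    have "b \<otimes> (a \<otimes> y) \<ominus> a \<otimes> c = a \<otimes> (b \<otimes> y \<ominus> c)" if "a \<in> carrier R" "b \<in> carrier R" for a b
      using that cc yc(1) by algebra
    from this[OF xi, of "s [^] (p ^ e)"] have "?xi \<otimes> ((s [^] (p ^ e)) \<otimes> y \<ominus> c) \<in> P" using c s by simp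
    moreover have "?xi \<notin> P" using pow_notin_prime[OF P, of x i] x xc by simp
    moreover have "(s [^] (p ^ e)) \<otimes> y \<ominus> c \<in> carrier R" using s yc cc by simp
    ultimately have "(s [^] (p ^ e)) \<otimes> y \<ominus> c \<in> P" using primeideal.I_prime[OF P xi, of "(s [^] (p ^ e)) \<otimes> y \<ominus> c"] by blast
    then have "(s [^] (p ^ e)) \<otimes> y \<ominus> c \<in> ?H" using PQ by (intro QH) auto
    then have "(s [^] (p ^ e)) \<otimes> y \<in> ?H" using fsub_cancel_diff[OF H _ c(1)] s yc by simp
    then show False using Cons.prems s by simp
  qed
  then show ?case using Cons xi yc by simp
qed

lemma strict_chain_list:
  assumes P: "primeideal P R" and Q: "primeideal Q R" and PQ: "P \<subseteq> Q" and x: "x \<in> Q" "x \<notin> P"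
    and ys: "strict R (p ^ e) Q Q ys" and j: "j \<le> p ^ e"
  shows "strict R (p ^ e) Q (adjoin P (x [^] (p ^ e))) (chain_list (p ^ e) x ys j)"
  using j
proof (induction j)
  case (Suc j)
  have IQ: "ideal Q R" using Q by (simp add: primeideal.axioms)
  have xc: "x \<in> carrier R" using ideal_in_carrier[OF IQ] x by auto
  have yc: "set ys \<subseteq> carrier R" by (rule strict_carrier[OF ys])
  have "\<exists>t\<in>Q. z = (x [^] (p ^ e - Suc j)) \<otimes> t" if z: "z \<in> set (chain_list (p ^ e) x ys j)" for z
  proof -
    have "j \<le> p ^ e" using Suc.prems by simp
    from set_chain_list[OF this z] obtain i y where iy: "p ^ e - j \<le> i" "y \<in> set ys" "z = (x [^] i) \<otimes> y" by blast
    have "p ^ e - Suc j < i" using iy(1) Suc.prems by linarith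
    then obtain k where k: "i = (p ^ e - Suc j) + Suc k" using less_iff_Suc_add by auto
    have y: "y \<in> carrier R" using iy yc by auto
    have "z = (x [^] (p ^ e - Suc j)) \<otimes> (((x [^] k) \<otimes> y) \<otimes> x)"
      unfolding iy(3) k using xc y by (simp add: nat_pow_mult[symmetric] m_ac)
    moreover have "((x [^] k) \<otimes> y) \<otimes> x \<in> Q" using xc y x by (intro ideal_mult_left[OF IQ]) auto
    ultimately show ?thesis by blast
  qed
  then show ?case using strict_map_aux[OF P Q PQ x _ ys Suc.IH, of "p ^ e - Suc j"] Suc.prems by simp
qed simp

text \<open>Filtering \<open>R / (P + (x\<^sup>q))\<close> by the powers of \<open>x\<close> yields \<open>q\<close> layers, each surjecting onto \<open>R / Q\<close>.
  Comparing lengths at \<open>Q\<close> bounds the number of generators of \<open>R / P\<close> from below.\<close>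

lemma gens_lower_bound:
  assumes P: "primeideal P R" and Q: "primeideal Q R" and PQ: "P \<subseteq> Q" and x: "x \<in> Q" "x \<notin> P"
    and us: "Q \<subseteq> fhull 0 (set us)" "set us \<subseteq> Q" and s: "s \<in> carrier R - Q"
    and nil: "\<And>rs. length rs = m \<Longrightarrow> set rs \<subseteq> Q \<Longrightarrow> s \<otimes> prodl rs \<in> adjoin P x"
    and ys: "qbasis R (p ^ e) Q ys" and g: "gens e P g"
  shows "p ^ e * length ys \<le> g * nest_len (length us) m"
proof -
  have IP: "ideal P R" and IQ: "ideal Q R" using P Q by (simp_all add: primeideal.axioms)
  have Pc: "P \<subseteq> carrier R" and Qc: "Q \<subseteq> carrier R" by (simp_all add: ideal_in_carrier IP IQ)
  have xc: "x \<in> carrier R" using x Qc by auto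
  let ?L = "nest_len (length us) m"
  let ?J = "adjoin P (x [^] (p ^ e))"
  have xq: "x [^] (p ^ e) \<in> carrier R" using xc by simp
  have J: "ideal ?J R" by (rule adjoin_ideal[OF IP xq])
  have Jc: "?J \<subseteq> carrier R" by (rule ideal_in_carrier[OF J])
  have Js: "fsub e ?J" by (rule ideal_fsub[OF J])
  obtain A where A: "finite A" "card A \<le> g" "A \<subseteq> carrier R" "carrier R \<subseteq> fhull e (P \<union> A)" using g by (rule gensE)
  obtain as where as: "set as = A" "distinct as" using finite_distinct_list[OF A(1)] by blast
  have las: "length as \<le> g" using distinct_card[OF as(2)] as(1) A(2) by simp
  have asc: "set as \<subseteq> carrier R" using as A by simp
  \<comment> \<open>Frobenius maps P + (x) into P + (x^(p^e)). The number m of factors stays the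
    same, which keeps the length per generator independent of e.\<close>
  have mem: "(s \<otimes> prodl rs) [^] (p ^ e) \<in> ?J" if rs: "length rs = m" "set rs \<subseteq> Q" for rs
  proof -
    obtain i r where ir: "i \<in> P" "r \<in> carrier R" "s \<otimes> prodl rs = i \<oplus> r \<otimes> x"
      using nil[OF rs] mem_adjoin[OF xc] by auto
    have ic: "i \<in> carrier R" using ir Pc by auto
    have "(s \<otimes> prodl rs) [^] (p ^ e) = i [^] (p ^ e) \<oplus> (r [^] (p ^ e)) \<otimes> (x [^] (p ^ e))"
      using ir ic xc by (simp add: frob_add nat_pow_distrib)
    then show ?thesis unfolding mem_adjoin[OF xq] using ideal_frob_pow[OF IP ir(1)] ir(2)
      by (intro bexI[of _ "i [^] (p ^ e)"] bexI[of _ "r [^] (p ^ e)"]) auto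
  qed
  have "len_bound e Q ?J (fhull e (?J \<union> set as)) (length as * ?L)"
  proof (rule len_bound_list[OF Q _ Js asc])
    fix a U assume a: "a \<in> set as" and U: "fsub e U" "?J \<subseteq> U"
    have ac: "a \<in> carrier R" using a asc by auto
    show "len_bound e Q U (fhull e (insert a U)) ?L"
      by (rule len_bound_nilpotent[OF Q us U(1) ac s])
        (use ideal_mult_right[OF J ac mem] U(2) in auto)
  qed
  moreover have "carrier R \<subseteq> fhull e (?J \<union> set as)"
    using A(4) qhull_mono[of "P \<union> A" "?J \<union> set as" R "p ^ e" "self_module R"] subset_adjoin[OF IP xq] as(1) by blast
  ultimately have "len_bound e Q ?J (carrier R) (g * ?L)"
    using las by (elim len_le_mono) simp_all
  then have bd: "len_bound e Q (fhull e ?J) (carrier R) (g * ?L)" using qhull_qsub_eq[OF Js] by simp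
  have "strict R (p ^ e) Q Q ys" using ys by (simp add: qbasis_def)
  from strict_chain_list[OF P Q PQ x this le_refl]
  have "length (chain_list (p ^ e) x ys (p ^ e)) \<le> g * ?L" by (rule strict_length_le[OF Jc _ bd])
  then show ?thesis by simp
qed

lemma prodl_append: "set xs \<subseteq> carrier R \<Longrightarrow> set ys \<subseteq> carrier R \<Longrightarrow> prodl (xs @ ys) = prodl xs \<otimes> prodl ys"
  by (induction xs) (auto simp: m_assoc)

text \<open>Localizing a product of primes at Q: every factor other than Q contributes an element
  outside Q to s, and m counts the factors equal to Q.\<close>

lemma avoid_prime:
  assumes Q: "primeideal Q R" and Ps: "\<And>P. P \<in> set Ps \<Longrightarrow> P \<subseteq> carrier R \<and> (P \<subseteq> Q \<longrightarrow> P = Q)"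
  shows "\<exists>s\<in>carrier R - Q. \<exists>m. \<forall>rs. length rs = m \<longrightarrow> set rs \<subseteq> Q \<longrightarrow>
    (\<exists>xs. list_all2 (\<in>) xs Ps \<and> prodl xs = s \<otimes> prodl rs)"
  using Ps
proof (induction Ps)
  case Nil
  have "\<one> \<in> carrier R - Q" using one_notin_prime[OF Q] by simp
  then show ?case by (intro bexI[of _ \<one>] exI[of _ 0]) auto
next
  case (Cons P Ps)
  have Qc: "Q \<subseteq> carrier R" using Q by (simp add: primeideal.axioms ideal_in_carrier)
  have "\<exists>s\<in>carrier R - Q. \<exists>m. \<forall>rs. length rs = m \<longrightarrow> set rs \<subseteq> Q \<longrightarrow>
    (\<exists>xs. list_all2 (\<in>) xs Ps \<and> prodl xs = s \<otimes> prodl rs)"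
    by (rule Cons.IH) (rule Cons.prems, simp)
  then obtain s m where s: "s \<in> carrier R - Q"
    and m: "\<And>rs. length rs = m \<Longrightarrow> set rs \<subseteq> Q \<Longrightarrow> \<exists>xs. list_all2 (\<in>) xs Ps \<and> prodl xs = s \<otimes> prodl rs"
    by blast
  show ?case
  proof (cases "P = Q")
    case True
    have "\<exists>xs. list_all2 (\<in>) xs (P # Ps) \<and> prodl xs = s \<otimes> prodl rs" if rs: "length rs = Suc m" "set rs \<subseteq> Q" for rs
    proof -
      obtain r rs' where r: "rs = r # rs'" using rs by (cases rs) auto
      then obtain xs where xs: "list_all2 (\<in>) xs Ps" "prodl xs = s \<otimes> prodl rs'" using m[of rs'] rs by auto
      have c: "r \<in> carrier R" "set rs' \<subseteq> carrier R" using r rs Qc by auto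
      show ?thesis using xs r True rs s c by (intro exI[of _ "r # xs"]) (simp add: m_lcomm)
    qed
    then show ?thesis using s by (intro bexI[of _ s] exI[of _ "Suc m"]) auto
  next
    case False
    then obtain t where t: "t \<in> P" "t \<notin> Q" "t \<in> carrier R" using Cons.prems[of P] by auto
    have "\<exists>xs. list_all2 (\<in>) xs (P # Ps) \<and> prodl xs = (t \<otimes> s) \<otimes> prodl rs" if rs: "length rs = m" "set rs \<subseteq> Q" for rs
    proof -
      obtain xs where xs: "list_all2 (\<in>) xs Ps" "prodl xs = s \<otimes> prodl rs" using m[OF rs] by auto
      have "prodl rs \<in> carrier R" using rs Qc by simp
      then show ?thesis using xs t s by (intro exI[of _ "t # xs"]) (simp add: m_assoc)
    qed
    moreover have "t \<otimes> s \<in> carrier R - Q" using prod_notin_prime[OF Q _ s] t by simp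
    ultimately show ?thesis by blast
  qed
qed

end

section \<open>Products of primes and the rank of a prime\<close>

locale F_finite_ring = frob R p + noetherian_ring R for R (structure) and p +
  assumes ex_gens: "\<exists>n. qgen R (p ^ 1) (self_module R) {} n"

context F_finite_ring
begin

text \<open>If a b lies in I with neither factor in I, then (I + (a)) (I + (b)) lies in I, so the
  lists for the two larger ideals can be concatenated. The empty list serves the unit ideal, where
  the empty product is 1.\<close>

lemma ideal_contains_prime_product:
  assumes "ideal I R"
  shows "\<exists>Ps. (\<forall>P\<in>set Ps. primeideal P R \<and> I \<subseteq> P) \<and> (\<forall>xs. list_all2 (\<in>) xs Ps \<longrightarrow> prodl xs \<in> I)"
  using assms
proof (induction I rule: ideal_induct)
  case (step I)
  have Ic: "I \<subseteq> carrier R" by (rule ideal_in_carrier[OF step.hyps])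
  consider "I = carrier R" | "primeideal I R" | "I \<noteq> carrier R" "\<not> primeideal I R" by blast
  then show ?case
  proof cases
    case 1
    then show ?thesis by (intro exI[of _ "[]"]) auto
  next
    case 2
    then show ?thesis using Ic by (intro exI[of _ "[I]"]) (auto simp: list_all2_Cons2)
  next
    case 3
    from not_primeE[OF step.hyps 3] obtain a b where ab: "a \<in> carrier R" "b \<in> carrier R" "a \<otimes> b \<in> I" "a \<notin> I" "b \<notin> I" .
    have J: "I \<subset> adjoin I a" "I \<subset> adjoin I b"
      using subset_adjoin[OF step.hyps] gen_adjoin[OF step.hyps] ab by auto
    note Ja = adjoin_ideal[OF step.hyps ab(1)] and Jb = adjoin_ideal[OF step.hyps ab(2)]
    obtain Ps where Ps: "\<And>P. P \<in> set Ps \<Longrightarrow> primeideal P R \<and> adjoin I a \<subseteq> P"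
      "\<And>xs. list_all2 (\<in>) xs Ps \<Longrightarrow> prodl xs \<in> adjoin I a" using step.IH[OF Ja J(1)] by blast
    obtain Qs where Qs: "\<And>P. P \<in> set Qs \<Longrightarrow> primeideal P R \<and> adjoin I b \<subseteq> P"
      "\<And>xs. list_all2 (\<in>) xs Qs \<Longrightarrow> prodl xs \<in> adjoin I b" using step.IH[OF Jb J(2)] by blast
    have "prodl xs \<in> I" if xs: "list_all2 (\<in>) xs (Ps @ Qs)" for xs
    proof -
      obtain us vs where uv: "xs = us @ vs" "list_all2 (\<in>) us Ps" "list_all2 (\<in>) vs Qs"
        using xs by (auto simp: list_all2_append2)
      have c: "set zs \<subseteq> carrier R" if "list_all2 (\<in>) zs Rs" "\<And>P. P \<in> set Rs \<Longrightarrow> primeideal P R" for zs Rs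
      proof
        fix z assume "z \<in> set zs"
        then obtain n where "n < length zs" "z = zs ! n" by (auto simp: in_set_conv_nth)
        then have "Rs ! n \<in> set Rs" "z \<in> Rs ! n" using that(1) by (auto simp: list_all2_conv_all_nth)
        then obtain P where "P \<in> set Rs" "z \<in> P" by blast
        then show "z \<in> carrier R" using that(2)[of P] ideal_in_carrier[of P] by (auto simp: primeideal.axioms)
      qed
      have cc: "set us \<subseteq> carrier R" "set vs \<subseteq> carrier R" using c[OF uv(2)] c[OF uv(3)] Ps(1) Qs(1) by blast+
      obtain i r where ir: "i \<in> I" "r \<in> carrier R" "prodl us = i \<oplus> r \<otimes> a" using Ps(2)[OF uv(2)] mem_adjoin[OF ab(1)] by auto
      obtain j t where jt: "j \<in> I" "t \<in> carrier R" "prodl vs = j \<oplus> t \<otimes> b" using Qs(2)[OF uv(3)] mem_adjoin[OF ab(2)] by auto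
      have ijc: "i \<in> carrier R" "j \<in> carrier R" using ir jt Ic by auto
      have "prodl xs = (i \<oplus> r \<otimes> a) \<otimes> (j \<oplus> t \<otimes> b)" using prodl_append[OF cc] uv(1) ir jt by simp
      also have "\<dots> = (j \<oplus> t \<otimes> b) \<otimes> i \<oplus> ((r \<otimes> a) \<otimes> j \<oplus> (r \<otimes> t) \<otimes> (a \<otimes> b))"
        using ijc ir(2) jt(2) ab(1,2) by algebra
      also have "\<dots> \<in> I"
      proof (intro fsubD(3)[OF ideal_fsub[OF step.hyps, of 0]])
        show "(j \<oplus> t \<otimes> b) \<otimes> i \<in> I" by (rule ideal_mult_left[OF step.hyps _ ir(1)]) (use ijc jt ab in simp)
        show "(r \<otimes> a) \<otimes> j \<in> I" by (rule ideal_mult_left[OF step.hyps _ jt(1)]) (use ir ab in simp)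
        show "(r \<otimes> t) \<otimes> (a \<otimes> b) \<in> I" by (rule ideal_mult_left[OF step.hyps _ ab(3)]) (use ir jt in simp)
      qed
      finally show ?thesis .
    qed
    moreover have "\<forall>P\<in>set (Ps @ Qs). primeideal P R \<and> I \<subseteq> P" using Ps(1) Qs(1) J by fastforce
    ultimately show ?thesis by blast
  qed
qed

text \<open>If Q is minimal over I, a power of Q lies in I after localizing at Q: in a product of
  primes above I that lies in I, each factor inside Q equals Q.\<close>

lemma prime_over_ideal_nilpotent:
  assumes I: "ideal I R" and Q: "primeideal Q R"
    and min: "\<And>P. primeideal P R \<Longrightarrow> I \<subseteq> P \<Longrightarrow> P \<subseteq> Q \<Longrightarrow> P = Q"
  shows "\<exists>s\<in>carrier R - Q. \<exists>m. \<forall>rs. length rs = m \<longrightarrow> set rs \<subseteq> Q \<longrightarrow> s \<otimes> prodl rs \<in> I"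
proof -
  obtain Ps where Ps: "\<And>P. P \<in> set Ps \<Longrightarrow> primeideal P R \<and> I \<subseteq> P"
    "\<And>xs. list_all2 (\<in>) xs Ps \<Longrightarrow> prodl xs \<in> I" using ideal_contains_prime_product[OF I] by blast
  have "P \<subseteq> carrier R \<and> (P \<subseteq> Q \<longrightarrow> P = Q)" if "P \<in> set Ps" for P
    using Ps(1)[OF that] min[of P] ideal_in_carrier[of P] by (auto simp: primeideal.axioms)
  from avoid_prime[OF Q this] obtain s m where "s \<in> carrier R - Q"
    "\<forall>rs. length rs = m \<longrightarrow> set rs \<subseteq> Q \<longrightarrow> (\<exists>xs. list_all2 (\<in>) xs Ps \<and> prodl xs = s \<otimes> prodl rs)" by blast
  note sm = this
  have "s \<otimes> prodl rs \<in> I" if rs: "length rs = m" "set rs \<subseteq> Q" for rs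
  proof -
    obtain xs where xs: "list_all2 (\<in>) xs Ps" "prodl xs = s \<otimes> prodl rs" using sm(2) rs by blast
    show ?thesis using Ps(2)[OF xs(1)] xs(2) by simp
  qed
  then show ?thesis using sm(1) by (intro bexI[of _ s] exI[of _ m]) simp_all
qed

lemma finite_gen_list:
  assumes I: "ideal I R"
  shows "\<exists>us. I \<subseteq> fhull 0 (set us) \<and> set us \<subseteq> I"
proof -
  obtain A where A: "A \<subseteq> carrier R" "finite A" "I = Idl A" using finetely_gen[OF I] by blast
  obtain us where "set us = A" using finite_list[OF A(2)] by blast
  then show ?thesis using genideal_subset_fhull[OF A(1)] genideal_self[OF A(1)] A(3) by auto
qed

text \<open>This is \<open>[\<kappa>(Q) : \<kappa>(Q)\<^sup>p]\<close>.\<close>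

definition rank :: "'a set \<Rightarrow> nat" where
  "rank Q = (LEAST n. \<exists>ys. qbasis R (p ^ 1) Q ys \<and> length ys = n)"

lemma rank_basis1:
  assumes Q: "primeideal Q R"
  shows "\<exists>ys. qbasis R (p ^ 1) Q ys \<and> length ys = rank Q"
proof -
  obtain n where "gens 1 {} n" using ex_gens by blast
  then obtain A where A: "finite A" "A \<subseteq> carrier R" "carrier R \<subseteq> fhull 1 ({} \<union> A)" by (rule gensE)
  obtain as where as: "set as = A" using finite_list[OF A(1)] by blast
  obtain ys where "qbasis R (p ^ 1) Q ys" using exists_qbasis[OF Q, of 1 as] A as by auto
  then have "\<exists>n ys. qbasis R (p ^ 1) Q ys \<and> length ys = n" by blast
  then show ?thesis unfolding rank_def by (rule LeastI_ex)
qed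

text \<open>Any finite generating set of F_*R bounds the ranks of all primes at once. This makes a
  prime of largest rank available.\<close>

lemma rank_bounded: "\<exists>G. \<forall>Q. primeideal Q R \<longrightarrow> rank Q \<le> G"
proof -
  obtain n where "gens 1 {} n" using ex_gens by blast
  then obtain A where A: "finite A" "A \<subseteq> carrier R" "carrier R \<subseteq> fhull 1 ({} \<union> A)" by (rule gensE)
  obtain as where as: "set as = A" using finite_list[OF A(1)] by blast
  have "rank Q \<le> length as" if Q: "primeideal Q R" for Q
  proof -
    obtain ys where ys: "qbasis R (p ^ 1) Q ys" "length ys \<le> length as" using exists_qbasis[OF Q, of 1 as] A as by auto
    have "rank Q \<le> length ys" unfolding rank_def by (rule Least_le) (use ys in blast)
    then show ?thesis using ys(2) by simp
  qed
  then show ?thesis by blast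
qed

lemma rank_basis:
  assumes Q: "primeideal Q R"
  shows "\<exists>ys. qbasis R (p ^ e) Q ys \<and> length ys = rank Q ^ e"
proof -
  obtain ys where ys: "qbasis R (p ^ 1) Q ys" "length ys = rank Q" using rank_basis1[OF Q] by blast
  show ?thesis using qbasis_power[OF Q ys(1), of e] ys(2) by simp
qed

lemma rank_pos:
  assumes Q: "primeideal Q R"
  shows "1 \<le> rank Q"
proof (rule ccontr)
  assume "\<not> 1 \<le> rank Q"
  moreover obtain ys where ys: "qbasis R (p ^ 1) Q ys" "length ys = rank Q" using rank_basis1[OF Q] by blast
  ultimately have "length ys = 0" by linarith
  then have "ys = []" by simp
  with ys(1) have "qbasis R (p ^ 1) Q []" by simp
  then obtain d where d: "d \<in> carrier R - Q" "\<And>r. r \<in> carrier R \<Longrightarrow> (d [^] (p ^ 1)) \<otimes> r \<in> fhull 1 (Q \<union> set [])"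
    unfolding qbasis_def by blast
  have I: "ideal Q R" using Q by (simp add: primeideal.axioms)
  have "(d [^] (p ^ 1)) \<otimes> \<one> \<in> Q" using d(2)[OF one_closed] qhull_qsub_eq[OF ideal_fsub[OF I, of 1]] by simp
  then have "d [^] (p ^ 1) \<in> Q" using d by simp
  then show False using pow_notin_prime[OF Q d(1)] by blast
qed

end

context F_finite_ring
begin

subsection \<open>Growth of the number of generators of \<open>F\<^sup>e\<^sub>*(R / I)\<close>\<close>

text \<open>The estimate \<mu>(F^e_*(R / I)) = O(B^e). It speaks of some number n of generators
  instead of the minimal one, so that finite generation is part of the claim.\<close>

definition grows :: "'a set \<Rightarrow> real \<Rightarrow> bool" where
  "grows I B \<longleftrightarrow> (\<exists>C\<ge>0. \<forall>e. \<exists>n. gens e I n \<and> real n \<le> C * B ^ e)"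

lemma grows_mono:
  assumes "grows I B" "0 \<le> B" "B \<le> B'"
  shows "grows I B'"
proof -
  obtain C where C: "C \<ge> 0" "\<And>e. \<exists>n. gens e I n \<and> real n \<le> C * B ^ e" using assms(1) unfolding grows_def by blast
  have "\<exists>n. gens e I n \<and> real n \<le> C * B' ^ e" for e
  proof -
    obtain n where n: "gens e I n" "real n \<le> C * B ^ e" using C(2) by blast
    have "C * B ^ e \<le> C * B' ^ e" using assms C(1) by (intro mult_left_mono power_mono) auto
    then show ?thesis using n by (intro exI[of _ n]) simp
  qed
  then show ?thesis unfolding grows_def using C(1) by blast
qed

lemma grows_colon:
  assumes I: "ideal I R" and a: "a \<in> carrier R"
    and J: "grows (adjoin I a) B" and K: "grows {r \<in> carrier R. r \<otimes> a \<in> I} B"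
  shows "grows I B"
proof -
  obtain C where C: "C \<ge> 0" "\<And>e. \<exists>n. gens e (adjoin I a) n \<and> real n \<le> C * B ^ e" using J unfolding grows_def by blast
  obtain D where D: "D \<ge> 0" "\<And>e. \<exists>n. gens e {r \<in> carrier R. r \<otimes> a \<in> I} n \<and> real n \<le> D * B ^ e" using K unfolding grows_def by blast
  have "\<exists>n. gens e I n \<and> real n \<le> (C + D) * B ^ e" for e
  proof -
    obtain m where m: "gens e (adjoin I a) m" "real m \<le> C * B ^ e" using C(2) by blast
    obtain n where n: "gens e {r \<in> carrier R. r \<otimes> a \<in> I} n" "real n \<le> D * B ^ e" using D(2) by blast
    show ?thesis using gens_colon[OF I a m(1) n(1)] m(2) n(2)
      by (intro exI[of _ "m + n"]) (simp add: algebra_simps)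
  qed
  then show ?thesis unfolding grows_def using C(1) D(1) by (intro exI[of _ "C + D"]) simp
qed

text \<open>A basis at P generates d F_*(R / P) up to a denominator d outside P, so
  \<open>gens_step\<close> gives a recurrence with factor \<open>rank P\<close> and error from R /
  (P + (d)). The element d is fixed before \<beta> and \<rho>, so one growth bound for P + (d)
  serves every \<rho>.\<close>

lemma prime_grows:
  assumes P: "primeideal P R"
  obtains d where "d \<in> carrier R" "d \<notin> P"
    "\<And>\<beta> \<rho>. \<lbrakk>0 \<le> \<beta>; \<beta> < \<rho>; real (rank P) \<le> \<rho>; grows (adjoin P d) \<beta>\<rbrakk> \<Longrightarrow> grows P \<rho>"
proof -
  have I: "ideal P R" using P by (simp add: primeideal.axioms)
  obtain ys where ys: "qbasis R (p ^ 1) P ys" "length ys = rank P" using rank_basis1[OF P] by blast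
  obtain d0 where d0: "d0 \<in> carrier R - P" "\<And>r. r \<in> carrier R \<Longrightarrow> (d0 [^] (p ^ 1)) \<otimes> r \<in> fhull 1 (P \<union> set ys)"
    using ys(1) unfolding qbasis_def by blast
  have "strict R (p ^ 1) P P ys" using ys(1) unfolding qbasis_def by blast
  then have yc: "set ys \<subseteq> carrier R" by (rule strict_carrier)
  define d where "d = d0 [^] (p ^ 1)"
  have d: "d \<in> carrier R - P" unfolding d_def by (rule pow_notin_prime[OF P d0(1)])
  have "grows P \<rho>" if b: "0 \<le> \<beta>" "\<beta> < \<rho>" "real (rank P) \<le> \<rho>" "grows (adjoin P d) \<beta>" for \<beta> \<rho>
  proof -
    obtain C where C: "C \<ge> 0" "\<And>e. \<exists>n. gens e (adjoin P d) n \<and> real n \<le> C * \<beta> ^ e" using b(4) unfolding grows_def by blast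
    from choice[OF allI, of "\<lambda>e n. gens e (adjoin P d) n \<and> real n \<le> C * \<beta> ^ e", OF C(2)]
    obtain c where c: "\<And>e. gens e (adjoin P d) (c e)" "\<And>e. real (c e) \<le> C * \<beta> ^ e" by blast
    \<comment> \<open>The value 1 at e = 0 reflects that R / P is cyclic.\<close>
    define g where "g = rec_nat 1 (\<lambda>e m. rank P * m + c (Suc e))"
    have g: "g 0 = 1" "g (Suc e) = rank P * g e + c (Suc e)" for e by (simp_all add: g_def)
    have gg: "gens e P (g e)" for e
    proof (induction e)
      case 0
      have c1: "P \<union> {\<one>} \<subseteq> carrier R" using ideal_in_carrier[OF I] by simp
      have "r \<in> fhull 0 (P \<union> {\<one>})" if "r \<in> carrier R" for r
      proof -
        have "\<one> \<in> fhull 0 (P \<union> {\<one>})" by (rule qhull_base) simp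
        from fsub0_mult[OF fsub_fhull[OF c1] that this] show ?thesis using that by simp
      qed
      then show ?case unfolding g by (intro gensI[of "{\<one>}"]) auto
    next
      case (Suc e)
      have "gens (1 + e) P (rank P * g e + c (Suc e))"
      proof (rule gens_step[OF I _ _ yc _ _ Suc.IH])
        show "card (set ys) \<le> rank P" using card_length[of ys] ys(2) by simp
        show "d \<otimes> r \<in> fhull 1 (P \<union> set ys)" if "r \<in> carrier R" for r unfolding d_def by (rule d0(2)[OF that])
        show "gens (1 + e) (adjoin P d) (c (Suc e))" using c(1)[of "Suc e"] by simp
      qed (use d in simp_all)
      then show ?case by (simp add: g)
    qed
    have "\<exists>K\<ge>0. \<forall>e. real (g e) \<le> K * \<rho> ^ e"
    proof (rule real_recurrence_bound[of "\<lambda>e. real (g e)" "real (rank P)" C \<beta> \<rho>])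
      show "real (g (Suc e)) \<le> real (rank P) * real (g e) + C * \<beta> ^ Suc e" for e
        using c(2)[of "Suc e"] by (simp add: g)
    qed (use b C(1) in simp_all)
    then show ?thesis unfolding grows_def using gg by blast
  qed
  then show thesis using that[of d] d by simp
qed

lemma real_power_growth_le:
  fixes u L K \<rho> :: real
  assumes "\<And>e::nat. u ^ e \<le> L * (K * \<rho> ^ e)" "0 < \<rho>"
  shows "u \<le> \<rho>"
proof (rule ccontr)
  assume "\<not> u \<le> \<rho>"
  then have "1 < u / \<rho>" using assms(2) by simp
  then obtain e where "L * K < (u / \<rho>) ^ e" using real_arch_pow by blast
  then have "L * K * \<rho> ^ e < u ^ e" using assms(2) by (simp add: power_divide field_simps)
  then show False using assms(1)[of e] by (simp add: mult.assoc)
qed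

text \<open>Both statements are proved in a single Noetherian induction: the growth bound for larger ideals
  yields the drop of the rank for \<open>I\<close>, which in turn yields the growth bound for \<open>I\<close>.
  This replaces Kunz' formula and needs neither localization nor Krull's height theorem.\<close>

lemma rank_drop_and_growth:
  assumes "ideal I R"
  shows "(primeideal I R \<longrightarrow> (\<forall>Q. primeideal Q R \<longrightarrow> I \<subset> Q \<longrightarrow> p * rank Q \<le> rank I)) \<and>
    (\<forall>B\<ge>0. (\<forall>Q. primeideal Q R \<longrightarrow> I \<subseteq> Q \<longrightarrow> real (rank Q) \<le> B) \<longrightarrow> grows I B)"
  using assms
proof (induction I rule: ideal_induct)
  case (step I)
  have IH1: "p * rank Q \<le> rank P" if "primeideal P R" "primeideal Q R" "I \<subset> P" "P \<subset> Q" for P Q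
    using step.IH[of P] that by (simp add: primeideal.axioms)
  have IH2: "grows J B" if "ideal J R" "I \<subset> J" "0 \<le> B" "\<And>Q. primeideal Q R \<Longrightarrow> J \<subseteq> Q \<Longrightarrow> real (rank Q) \<le> B" for J B
    using step.IH[OF that(1,2)] that(3,4) by blast
  have adj: "ideal (adjoin I d) R" "I \<subset> adjoin I d" if "d \<in> carrier R" "d \<notin> I" for d
    using adjoin_ideal[OF step.hyps] subset_adjoin[OF step.hyps] gen_adjoin[OF step.hyps] that by auto
  have drop: "p * rank Q \<le> rank I" if I: "primeideal I R" and Q: "primeideal Q R" "I \<subset> Q" for Q
  proof -
    let ?S = "{Q. primeideal Q R \<and> I \<subset> Q}"
    obtain G where G: "\<And>Q. primeideal Q R \<Longrightarrow> rank Q \<le> G" using rank_bounded by blast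
    have fin: "finite (rank ` ?S)" by (rule finite_subset[of _ "{..G}"]) (use G in auto)
    have ne: "rank ` ?S \<noteq> {}" using Q by blast
    \<comment> \<open>It suffices to treat a prime of largest rank among those strictly above
      I.\<close>
    obtain P where PS: "Max (rank ` ?S) = rank P" "P \<in> ?S" using Max_in[OF fin ne] by (rule imageE)
    then have P: "primeideal P R" "I \<subset> P" "rank P = Max (rank ` ?S)" by simp_all
    have max: "rank Q \<le> rank P" if "primeideal Q R" "I \<subset> Q" for Q
      unfolding P(3) using that by (intro Max_ge[OF fin]) blast
    let ?b = "real (rank P)"
    have b1: "1 \<le> ?b" using rank_pos[OF P(1)] by simp
    obtain x where x: "x \<in> P" "x \<notin> I" using P(2) by blast
    have PI: "ideal P R" using P by (simp add: primeideal.axioms)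
    have xc: "x \<in> carrier R" using ideal_in_carrier[OF PI] x by blast
    \<comment> \<open>A prime strictly between I and P would have rank at least p times that of P by
      the induction hypothesis, against the choice of P. So P is minimal over I + (x) for any x in P
      outside I, whatever its height.\<close>
    have min: "Q' = P" if Q': "primeideal Q' R" "adjoin I x \<subseteq> Q'" "Q' \<subseteq> P" for Q'
    proof (rule ccontr)
      assume "Q' \<noteq> P"
      then have "Q' \<subset> P" "I \<subset> Q'" using Q' adj(2)[OF xc x(2)] by auto
      then have "p * rank P \<le> rank Q'" "rank Q' \<le> rank P" using IH1[OF Q'(1) P(1)] max[OF Q'(1)] by auto
      moreover have "2 * rank P \<le> p * rank P" using p_gt_1 by (intro mult_le_mono1) simp
      ultimately show False using rank_pos[OF P(1)] by linarith
    qed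
    obtain s m where s: "s \<in> carrier R - P" and m: "\<And>rs. length rs = m \<Longrightarrow> set rs \<subseteq> P \<Longrightarrow> s \<otimes> prodl rs \<in> adjoin I x"
      using prime_over_ideal_nilpotent[OF adj(1)[OF xc x(2)] P(1) min] by blast
    obtain us where us: "P \<subseteq> fhull 0 (set us)" "set us \<subseteq> P" using finite_gen_list[OF PI] by blast
    let ?L = "nest_len (length us) m"
    have lower: "p ^ e * rank P ^ e \<le> g * ?L" if "gens e I g" for e g
    proof -
      obtain ys where ys: "qbasis R (p ^ e) P ys" "length ys = rank P ^ e" using rank_basis[OF P(1)] by blast
      show ?thesis using gens_lower_bound[OF I P(1) psubset_imp_subset[OF P(2)] x us s m ys(1) that] ys(2) by simp
    qed
    obtain d where d: "d \<in> carrier R" "d \<notin> I"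
      and dg: "\<And>\<beta> \<rho>. \<lbrakk>0 \<le> \<beta>; \<beta> < \<rho>; real (rank I) \<le> \<rho>; grows (adjoin I d) \<beta>\<rbrakk> \<Longrightarrow> grows I \<rho>"
      using prime_grows[OF I] by blast
    \<comment> \<open>Every prime above I + (d) lies strictly above I, so by the choice of P its
      rank is at most that of P.\<close>
    have gd: "grows (adjoin I d) ?b"
    proof (rule IH2[OF adj[OF d]])
      fix Q assume "primeideal Q R" "adjoin I d \<subseteq> Q"
      then show "real (rank Q) \<le> ?b" using max[of Q] adj(2)[OF d] by auto
    qed simp
    have main: "real p * ?b \<le> \<rho>" if r: "?b < \<rho>" "real (rank I) \<le> \<rho>" for \<rho>
    proof -
      obtain K where K: "K \<ge> 0" "\<And>e. \<exists>n. gens e I n \<and> real n \<le> K * \<rho> ^ e"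
        using dg[OF _ r gd] unfolding grows_def by auto
      show ?thesis
      proof (rule real_power_growth_le[of _ "real ?L" K])
        fix e
        obtain n where n: "gens e I n" "real n \<le> K * \<rho> ^ e" using K(2) by blast
        have "(real p * ?b) ^ e = real (p ^ e * rank P ^ e)" by (simp add: power_mult_distrib)
        also have "\<dots> \<le> real (n * ?L)" using lower[OF n(1)] by (rule of_nat_mono)
        also have "\<dots> = real ?L * real n" by simp
        also have "\<dots> \<le> real ?L * (K * \<rho> ^ e)" using n(2) by (intro mult_left_mono) auto
        finally show "(real p * ?b) ^ e \<le> real ?L * (K * \<rho> ^ e)" .
      qed (use r b1 in linarith)
    qed
    have "real p * ?b \<le> real (rank I)"
    proof (rule ccontr)
      assume a: "\<not> real p * ?b \<le> real (rank I)"
      have p2: "real p \<ge> 2" using p_gt_1 by simp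
      have bb: "?b < real p * ?b" using mult_strict_right_mono[of 1 "real p" ?b] p2 b1 by simp
      \<comment> \<open>The recurrence needs \<rho> strictly above \<open>rank P\<close>; as p > 1
        there is still room below p \<open>rank P\<close> for a contradiction.\<close>
      obtain z where "?b < z" "z < real p * ?b" using dense[OF bb] by blast
      moreover define \<rho> where "\<rho> = max (real (rank I)) z"
      moreover have "real (rank I) < real p * ?b" using a by simp
      ultimately have "?b < \<rho>" "\<rho> < real p * ?b" unfolding \<rho>_def less_max_iff_disj max_less_iff_conj by blast+
      moreover have "real (rank I) \<le> \<rho>" by (simp add: \<rho>_def)
      ultimately show False using main[of \<rho>] by simp
    qed
    then have "real (p * rank P) \<le> real (rank I)" by simp
    then have "p * rank P \<le> rank I" by (simp only: of_nat_le_iff)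
    moreover have "p * rank Q \<le> p * rank P" by (rule mult_le_mono2[OF max[OF Q]])
    ultimately show ?thesis by linarith
  qed
  have growth: "grows I B" if B: "0 \<le> B" "\<And>Q. primeideal Q R \<Longrightarrow> I \<subseteq> Q \<Longrightarrow> real (rank Q) \<le> B" for B
  proof -
    consider "I = carrier R" | "primeideal I R" | "I \<noteq> carrier R" "\<not> primeideal I R" by blast
    then show ?thesis
    proof cases
      case 1
      show ?thesis unfolding grows_def 1 using gens_carrier by (intro exI[of _ 0]) force
    next
      case 2
      obtain d where d: "d \<in> carrier R" "d \<notin> I"
        and dg: "\<And>\<beta> \<rho>. \<lbrakk>0 \<le> \<beta>; \<beta> < \<rho>; real (rank I) \<le> \<rho>; grows (adjoin I d) \<beta>\<rbrakk> \<Longrightarrow> grows I \<rho>"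
        using prime_grows[OF 2] by blast
      \<comment> \<open>The drop is now known for I itself, so the error over I + (d) has the
        smaller base \<open>rank I\<close> / p and the sharp value \<rho> = \<open>rank I\<close> is
        admissible.\<close>
      let ?b = "real (rank I) / real p"
      have p2: "real p > 1" using p_gt_1 by simp
      have r1: "1 \<le> real (rank I)" using rank_pos[OF 2] by simp
      have bl: "?b < real (rank I)" using p2 r1 by (simp add: divide_less_eq)
      have "grows (adjoin I d) ?b"
      proof (rule IH2[OF adj[OF d]])
        fix Q assume Q: "primeideal Q R" "adjoin I d \<subseteq> Q"
        then have "p * rank Q \<le> rank I" using drop[OF 2 Q(1)] adj(2)[OF d] by auto
        then have "real (p * rank Q) \<le> real (rank I)" by (rule of_nat_mono)
        then show "real (rank Q) \<le> ?b" using p2 by (simp add: le_divide_eq mult.commute)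
      qed simp
      then have "grows I (real (rank I))" using dg[OF _ bl] by simp
      moreover have "real (rank I) \<le> B" using B(2)[OF 2] by simp
      ultimately show ?thesis using grows_mono[of I "real (rank I)" B] by simp
    next
      case 3
      from not_primeE[OF step.hyps 3] obtain a b where ab: "a \<in> carrier R" "b \<in> carrier R" "a \<otimes> b \<in> I" "a \<notin> I" "b \<notin> I" .
      \<comment> \<open>Since b lies in (I : a) but not in I, both I + (a) and (I : a) are strictly
        larger than I.\<close>
      let ?K = "{r \<in> carrier R. r \<otimes> a \<in> I}"
      have K: "ideal ?K R" by (rule colon_ideal[OF step.hyps ab(1)])
      have IK: "I \<subset> ?K"
      proof
        show "I \<subseteq> ?K" using ideal_in_carrier[OF step.hyps] ideal_mult_right[OF step.hyps ab(1)] by auto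
        have "b \<in> ?K" using ab(2,3) m_comm[OF ab(2,1)] by simp
        then show "I \<noteq> ?K" using ab(5) by blast
      qed
      have "grows (adjoin I a) B"
        by (rule IH2[OF adj[OF ab(1,4)] B(1)]) (use B(2) adj(2)[OF ab(1,4)] in blast)
      moreover have "grows ?K B"
        by (rule IH2[OF K IK B(1)]) (use B(2) IK in blast)
      ultimately show ?thesis by (rule grows_colon[OF step.hyps ab(1)])
    qed
  qed
  show ?case using drop growth by blast
qed

lemma rank_drop: "primeideal P R \<Longrightarrow> primeideal Q R \<Longrightarrow> P \<subset> Q \<Longrightarrow> p * rank Q \<le> rank P"
  using rank_drop_and_growth[of P] by (simp add: primeideal.axioms)

lemma ideal_growth:
  assumes "ideal I R" "0 \<le> B" "\<And>Q. primeideal Q R \<Longrightarrow> I \<subseteq> Q \<Longrightarrow> real (rank Q) \<le> B"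
  shows "grows I B"
  using rank_drop_and_growth[OF assms(1)] assms(2,3) by blast

end

subsection \<open>Maps from \<open>M\<close> to \<open>F\<^sub>*M\<close>\<close>

locale F_finite_module = F_finite_ring R p + frob_module R p M for R (structure) and p and M (structure)

lemma (in Module.module) qsub_pre:
  assumes f: "\<And>x. x \<in> carrier M \<Longrightarrow> f x \<in> carrier M"
    and add: "\<And>x y. x \<in> carrier M \<Longrightarrow> y \<in> carrier M \<Longrightarrow> f (x \<oplus>\<^bsub>M\<^esub> y) = f x \<oplus>\<^bsub>M\<^esub> f y"
    and smult: "\<And>r x. r \<in> carrier R \<Longrightarrow> x \<in> carrier M \<Longrightarrow> f ((r [^] q) \<odot>\<^bsub>M\<^esub> x) = (r [^] q') \<odot>\<^bsub>M\<^esub> f x"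
    and U: "qsub R q' M U"
  shows "qsub R q M {x \<in> carrier M. f x \<in> U}"
  using qsub_vimage[OF module_axioms _ add smult U] f by simp

lemma (in Module.module) qsub_pre_smult:
  assumes c: "c \<in> carrier R" and U: "qsub R q M U"
  shows "qsub R q M {x \<in> carrier M. c \<odot>\<^bsub>M\<^esub> x \<in> U}"
proof (rule qsub_pre[OF _ _ _ U])
  fix r x assume rx: "r \<in> carrier R" "x \<in> carrier M"
  show "c \<odot>\<^bsub>M\<^esub> ((r [^] q) \<odot>\<^bsub>M\<^esub> x) = (r [^] q) \<odot>\<^bsub>M\<^esub> (c \<odot>\<^bsub>M\<^esub> x)"
    using rx c by (simp add: smult_assoc1[symmetric] m_comm)
qed (use c in \<open>auto simp: smult_r_distr\<close>)

context F_finite_module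
begin

abbreviation mhull :: "nat \<Rightarrow> 'c set \<Rightarrow> 'c set" where
  "mhull e A \<equiv> qhull R (p ^ e) M A"

abbreviation msub :: "nat \<Rightarrow> 'c set \<Rightarrow> bool" where
  "msub e U \<equiv> qsub R (p ^ e) M U"

lemma msub_scalars:
  assumes m: "m \<in> carrier M" and U: "msub e U"
  shows "fsub e {r \<in> carrier R. r \<odot>\<^bsub>M\<^esub> m \<in> U}"
proof (rule fsubI)
  note h = qsubD[OF U]
  show "\<zero> \<in> {r \<in> carrier R. r \<odot>\<^bsub>M\<^esub> m \<in> U}" using h(2) m by simp
  show "x \<oplus> y \<in> {r \<in> carrier R. r \<odot>\<^bsub>M\<^esub> m \<in> U}"
    if "x \<in> {r \<in> carrier R. r \<odot>\<^bsub>M\<^esub> m \<in> U}" "y \<in> {r \<in> carrier R. r \<odot>\<^bsub>M\<^esub> m \<in> U}" for x y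
    using that h(3) m by (simp add: smult_l_distr)
  show "(r [^] (p ^ e)) \<otimes> x \<in> {r \<in> carrier R. r \<odot>\<^bsub>M\<^esub> m \<in> U}"
    if "r \<in> carrier R" "x \<in> {r \<in> carrier R. r \<odot>\<^bsub>M\<^esub> m \<in> U}" for r x
    using that h(4) m by (simp add: smult_assoc1)
qed auto

lemma msub_saturate:
  assumes U: "msub (e + f) U"
  shows "msub e {x \<in> carrier M. \<forall>r\<in>carrier R. (r [^] (p ^ e)) \<odot>\<^bsub>M\<^esub> x \<in> U}"
proof (rule qsubI)
  note h = qsubD[OF U]
  let ?S = "{x \<in> carrier M. \<forall>r\<in>carrier R. (r [^] (p ^ e)) \<odot>\<^bsub>M\<^esub> x \<in> U}"
  show "\<zero>\<^bsub>M\<^esub> \<in> ?S" using h(2) by simp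
  show "x \<oplus>\<^bsub>M\<^esub> y \<in> ?S" if "x \<in> ?S" "y \<in> ?S" for x y
    using that h(3) by (simp add: smult_r_distr)
  show "(t [^] (p ^ e)) \<odot>\<^bsub>M\<^esub> x \<in> ?S" if t: "t \<in> carrier R" and x: "x \<in> ?S" for t x
  proof -
    have "(r [^] (p ^ e)) \<odot>\<^bsub>M\<^esub> ((t [^] (p ^ e)) \<odot>\<^bsub>M\<^esub> x) = ((r \<otimes> t) [^] (p ^ e)) \<odot>\<^bsub>M\<^esub> x" if "r \<in> carrier R" for r
      using that t x by (simp add: nat_pow_distrib smult_assoc1)
    then show ?thesis using t x by simp
  qed
qed auto

lemma msub_saturateD:
  assumes "x \<in> {x \<in> carrier M. \<forall>r\<in>carrier R. (r [^] (p ^ e)) \<odot>\<^bsub>M\<^esub> x \<in> U}"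
  shows "x \<in> U"
proof -
  have x: "x \<in> carrier M" "\<forall>r\<in>carrier R. (r [^] (p ^ e)) \<odot>\<^bsub>M\<^esub> x \<in> U" using assms by simp_all
  from x(2) one_closed have "(\<one> [^] (p ^ e)) \<odot>\<^bsub>M\<^esub> x \<in> U" by (rule bspec)
  then show ?thesis using x(1) by simp
qed

text \<open>As I M lies in W, the quotient M / W is an image of a direct sum of
  \<open>card A\<close> copies of R / I. This turns growth for the ring into growth for the
  module.\<close>

lemma module_gens_quotient:
  assumes A: "finite A" "A \<subseteq> carrier M" "carrier M \<subseteq> mhull 0 A"
    and I: "I \<subseteq> carrier R" and g: "gens e I n" and W: "msub e W"
    and IW: "\<And>i m. i \<in> I \<Longrightarrow> m \<in> carrier M \<Longrightarrow> i \<odot>\<^bsub>M\<^esub> m \<in> W"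
  shows "\<exists>C. finite C \<and> card C \<le> card A * n \<and> C \<subseteq> carrier M \<and> carrier M \<subseteq> mhull e (W \<union> C)"
proof -
  obtain B where B: "finite B" "card B \<le> n" "B \<subseteq> carrier R" "carrier R \<subseteq> fhull e (I \<union> B)" using g by (rule gensE)
  let ?C = "(\<lambda>(m, b). b \<odot>\<^bsub>M\<^esub> m) ` (A \<times> B)"
  have Cc: "?C \<subseteq> carrier M" using subsetD[OF A(2)] subsetD[OF B(3)] by auto
  have WC: "W \<union> ?C \<subseteq> carrier M" using Cc qsubD(1)[OF W] by simp
  let ?H = "mhull e (W \<union> ?C)"
  have H: "msub e ?H" by (rule qsub_qhull[OF WC])
  have "r \<odot>\<^bsub>M\<^esub> m \<in> ?H" if m: "m \<in> A" and r: "r \<in> carrier R" for m r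
  proof -
    have mc: "m \<in> carrier M" using m A by auto
    let ?K = "{r \<in> carrier R. r \<odot>\<^bsub>M\<^esub> m \<in> ?H}"
    have K: "fsub e ?K" by (rule msub_scalars[OF mc H])
    have "fhull e (I \<union> B) \<subseteq> ?K"
    proof (rule qhull_least[OF K])
      show "I \<union> B \<subseteq> ?K"
      proof
        fix x assume x: "x \<in> I \<union> B"
        then have xc: "x \<in> carrier R" using B(3) I by auto
        have "x \<odot>\<^bsub>M\<^esub> m \<in> W \<union> ?C"
        proof (cases "x \<in> I")
          case True
          then show ?thesis using IW[OF True mc] by simp
        next
          case False
          then have "(m, x) \<in> A \<times> B" using x m by simp
          then show ?thesis by (auto intro!: rev_image_eqI[of "(m, x)"])
        qed
        then show "x \<in> ?K" using xc by (simp add: qhull_base)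
      qed
    qed
    then show ?thesis using r B(4) by auto
  qed
  then have "A \<subseteq> {x \<in> carrier M. \<forall>r\<in>carrier R. (r [^] (p ^ 0)) \<odot>\<^bsub>M\<^esub> x \<in> ?H}" using A(2) by auto
  moreover have "msub 0 {x \<in> carrier M. \<forall>r\<in>carrier R. (r [^] (p ^ 0)) \<odot>\<^bsub>M\<^esub> x \<in> ?H}"
    by (rule msub_saturate[of 0 e]) (use H in simp)
  ultimately have "mhull 0 A \<subseteq> {x \<in> carrier M. \<forall>r\<in>carrier R. (r [^] (p ^ 0)) \<odot>\<^bsub>M\<^esub> x \<in> ?H}"
    by (intro qhull_least)
  with A(3) have "carrier M \<subseteq> {x \<in> carrier M. \<forall>r\<in>carrier R. (r [^] (p ^ 0)) \<odot>\<^bsub>M\<^esub> x \<in> ?H}"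
    by (rule subset_trans)
  then have "carrier M \<subseteq> ?H" using msub_saturateD by (meson subset_eq)
  moreover have "card ?C \<le> card A * n"
  proof (rule le_trans)
    show "card ?C \<le> card (A \<times> B)" by (rule card_image_le) (use A B in simp)
    show "card (A \<times> B) \<le> card A * n" using B by (simp add: card_cartesian_product)
  qed
  moreover have "finite ?C" using A B by simp
  ultimately show ?thesis using Cc by (intro exI[of _ ?C] conjI)
qed


text \<open>An R-linear map from L to F_*M. The domain is a parameter because such maps are extended
  one generator at a time.\<close>

definition p_linear_on :: "('c \<Rightarrow> 'c) \<Rightarrow> 'c set \<Rightarrow> bool" where
  "p_linear_on f L \<longleftrightarrow> (\<forall>x\<in>L. f x \<in> carrier M) \<and> (\<forall>x\<in>L. \<forall>y\<in>L. f (x \<oplus>\<^bsub>M\<^esub> y) = f x \<oplus>\<^bsub>M\<^esub> f y) \<and>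
     (\<forall>r\<in>carrier R. \<forall>x\<in>L. f (r \<odot>\<^bsub>M\<^esub> x) = (r [^] p) \<odot>\<^bsub>M\<^esub> f x)"

lemma p_linear_onI:
  assumes "\<And>x. x \<in> L \<Longrightarrow> f x \<in> carrier M"
    "\<And>x y. x \<in> L \<Longrightarrow> y \<in> L \<Longrightarrow> f (x \<oplus>\<^bsub>M\<^esub> y) = f x \<oplus>\<^bsub>M\<^esub> f y"
    "\<And>r x. r \<in> carrier R \<Longrightarrow> x \<in> L \<Longrightarrow> f (r \<odot>\<^bsub>M\<^esub> x) = (r [^] p) \<odot>\<^bsub>M\<^esub> f x"
  shows "p_linear_on f L"
  unfolding p_linear_on_def using assms by simp

lemma p_linear_onD:
  assumes "p_linear_on f L"
  shows "x \<in> L \<Longrightarrow> f x \<in> carrier M"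
    "x \<in> L \<Longrightarrow> y \<in> L \<Longrightarrow> f (x \<oplus>\<^bsub>M\<^esub> y) = f x \<oplus>\<^bsub>M\<^esub> f y"
    "r \<in> carrier R \<Longrightarrow> x \<in> L \<Longrightarrow> f (r \<odot>\<^bsub>M\<^esub> x) = (r [^] p) \<odot>\<^bsub>M\<^esub> f x"
  using assms unfolding p_linear_on_def by simp_all

abbreviation ideal_mult :: "'a set \<Rightarrow> 'c set" where
  "ideal_mult P \<equiv> {u \<odot>\<^bsub>M\<^esub> m |u m. u \<in> P \<and> m \<in> carrier M}"

lemma msub0_smult:
  assumes "msub 0 U" "r \<in> carrier R" "x \<in> U"
  shows "r \<odot>\<^bsub>M\<^esub> x \<in> U"
  using qsubD(4)[OF assms(1,2,3)] assms(2) by simp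

text \<open>A coordinate-free substitute for \<open>L \<rightarrow> (R / P)\<^sup>n \<rightarrow> F\<^sub>*(R / P)\<^sup>n \<rightarrow> F\<^sub>*M\<close>, where \<open>n\<close> is the rank of \<open>L\<close> at \<open>P\<close> and
  the middle map is the Frobenius; \<open>w\<close> is a common denominator.\<close>

definition theta_on :: "'a set \<Rightarrow> 'c set \<Rightarrow> bool" where
  "theta_on P L \<longleftrightarrow> (\<exists>\<theta> w. p_linear_on \<theta> L \<and> (\<forall>u\<in>P. \<forall>m\<in>carrier M. \<theta> (u \<odot>\<^bsub>M\<^esub> m) = \<zero>\<^bsub>M\<^esub>) \<and>
     (\<forall>u\<in>P. \<forall>m\<in>L. u \<odot>\<^bsub>M\<^esub> \<theta> m = \<zero>\<^bsub>M\<^esub>) \<and> w \<in> carrier R - P \<and> (\<forall>m\<in>L. w \<odot>\<^bsub>M\<^esub> m \<in> mhull 0 (\<theta> ` L)))"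

lemma theta_onI:
  assumes "p_linear_on \<theta> L" "\<And>u m. u \<in> P \<Longrightarrow> m \<in> carrier M \<Longrightarrow> \<theta> (u \<odot>\<^bsub>M\<^esub> m) = \<zero>\<^bsub>M\<^esub>"
     "\<And>u m. u \<in> P \<Longrightarrow> m \<in> L \<Longrightarrow> u \<odot>\<^bsub>M\<^esub> \<theta> m = \<zero>\<^bsub>M\<^esub>" "w \<in> carrier R - P"
     "\<And>m. m \<in> L \<Longrightarrow> w \<odot>\<^bsub>M\<^esub> m \<in> mhull 0 (\<theta> ` L)"
  shows "theta_on P L"
  unfolding theta_on_def using assms by (intro exI[of _ \<theta>] exI[of _ w]) simp

text \<open>The larger submodule has the same rank at P, so the old map is composed with
  multiplication by c, which sends L' into L.\<close>

lemma theta_extend_torsion: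
  assumes P: "primeideal P R" and L: "msub 0 L" and L': "msub 0 L'" and LL': "L \<subseteq> L'"
    and PL: "ideal_mult P \<subseteq> L" and c: "c \<in> carrier R - P" and cL: "\<And>z. z \<in> L' \<Longrightarrow> c \<odot>\<^bsub>M\<^esub> z \<in> L"
    and th: "theta_on P L"
  shows "theta_on P L'"
proof -
  obtain \<theta> w where t: "p_linear_on \<theta> L" "\<And>u m. u \<in> P \<Longrightarrow> m \<in> carrier M \<Longrightarrow> \<theta> (u \<odot>\<^bsub>M\<^esub> m) = \<zero>\<^bsub>M\<^esub>"
     "\<And>u m. u \<in> P \<Longrightarrow> m \<in> L \<Longrightarrow> u \<odot>\<^bsub>M\<^esub> \<theta> m = \<zero>\<^bsub>M\<^esub>" and w: "w \<in> carrier R - P"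
     "\<And>m. m \<in> L \<Longrightarrow> w \<odot>\<^bsub>M\<^esub> m \<in> mhull 0 (\<theta> ` L)" using th unfolding theta_on_def by blast
  note am = p_linear_onD[OF t(1)]
  have Lc: "L \<subseteq> carrier M" "L' \<subseteq> carrier M" using qsubD(1)[OF L] qsubD(1)[OF L'] .
  have Pc: "P \<subseteq> carrier R" using P by (simp add: primeideal.axioms ideal_in_carrier)
  let ?t = "\<lambda>z. \<theta> (c \<odot>\<^bsub>M\<^esub> z)"
  have tc: "?t z \<in> carrier M" if "z \<in> L'" for z using am(1)[OF cL[OF that]] .
  have Hc: "?t ` L' \<subseteq> carrier M" using tc by blast
  have H: "msub 0 (mhull 0 (?t ` L'))" by (rule qsub_qhull[OF Hc])
  \<comment> \<open>One factor c moves z into L, w moves it on into the span of the old values, and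
    c^p turns an old value \<theta> l into the new value \<theta> (c l).\<close>
  let ?w = "(c [^] p) \<otimes> (w \<otimes> c)"
  have wP: "?w \<in> carrier R - P" by (intro prod_notin_prime[OF P] pow_notin_prime[OF P] c w(1))
  show ?thesis
  proof (rule theta_onI[of ?t _ _ ?w])
    show "p_linear_on ?t L'"
    proof (rule p_linear_onI)
      show "?t x \<in> carrier M" if "x \<in> L'" for x using tc[OF that] .
      show "?t (x \<oplus>\<^bsub>M\<^esub> y) = ?t x \<oplus>\<^bsub>M\<^esub> ?t y" if "x \<in> L'" "y \<in> L'" for x y
        using am(2)[OF cL[OF that(1)] cL[OF that(2)]] that Lc c by (simp add: smult_r_distr subset_iff)
      show "?t (r \<odot>\<^bsub>M\<^esub> x) = (r [^] p) \<odot>\<^bsub>M\<^esub> ?t x" if "r \<in> carrier R" "x \<in> L'" for r x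
      proof -
        have xc: "x \<in> carrier M" using that Lc by auto
        have "c \<odot>\<^bsub>M\<^esub> (r \<odot>\<^bsub>M\<^esub> x) = r \<odot>\<^bsub>M\<^esub> (c \<odot>\<^bsub>M\<^esub> x)"
          using that(1) xc c by (simp add: smult_assoc1[symmetric] m_comm)
        then show ?thesis using am(3)[OF that(1) cL[OF that(2)]] by simp
      qed
    qed
    show "?t (u \<odot>\<^bsub>M\<^esub> m) = \<zero>\<^bsub>M\<^esub>" if "u \<in> P" "m \<in> carrier M" for u m
    proof -
      have "c \<odot>\<^bsub>M\<^esub> (u \<odot>\<^bsub>M\<^esub> m) = u \<odot>\<^bsub>M\<^esub> (c \<odot>\<^bsub>M\<^esub> m)"
        using that c Pc by (simp add: smult_assoc1[symmetric] m_comm subset_iff)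
      then show ?thesis using t(2)[of u "c \<odot>\<^bsub>M\<^esub> m"] that c by simp
    qed
    show "u \<odot>\<^bsub>M\<^esub> ?t m = \<zero>\<^bsub>M\<^esub>" if "u \<in> P" "m \<in> L'" for u m using t(3)[OF that(1) cL[OF that(2)]] .
    show "?w \<in> carrier R - P" by (rule wP)
    show "?w \<odot>\<^bsub>M\<^esub> z \<in> mhull 0 (?t ` L')" if z: "z \<in> L'" for z
    proof -
      let ?U = "{y \<in> carrier M. (c [^] p) \<odot>\<^bsub>M\<^esub> y \<in> mhull 0 (?t ` L')}"
      have U: "msub 0 ?U" by (rule qsub_pre_smult[OF _ H]) (use c in simp)
      have "\<theta> ` L \<subseteq> ?U"
      proof
        fix y assume "y \<in> \<theta> ` L"
        then obtain l where l: "l \<in> L" "y = \<theta> l" by blast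
        have "(c [^] p) \<odot>\<^bsub>M\<^esub> y = ?t l" using am(3)[of c l] l c by simp
        moreover have "?t l \<in> mhull 0 (?t ` L')" using l LL' by (intro qhull_base) blast
        ultimately show "y \<in> ?U" using am(1)[OF l(1)] l(2) by simp
      qed
      then have "mhull 0 (\<theta> ` L) \<subseteq> ?U" by (rule qhull_least[OF U])
      then have "w \<odot>\<^bsub>M\<^esub> (c \<odot>\<^bsub>M\<^esub> z) \<in> ?U" using w(2)[OF cL[OF z]] by blast
      then have "(c [^] p) \<odot>\<^bsub>M\<^esub> (w \<odot>\<^bsub>M\<^esub> (c \<odot>\<^bsub>M\<^esub> z)) \<in> mhull 0 (?t ` L')" by simp
      moreover have "?w \<odot>\<^bsub>M\<^esub> z = (c [^] p) \<odot>\<^bsub>M\<^esub> (w \<odot>\<^bsub>M\<^esub> (c \<odot>\<^bsub>M\<^esub> z))"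
        using c w(1) z Lc by (simp add: smult_assoc1 subset_iff)
      ultimately show ?thesis by simp
    qed
  qed
qed

text \<open>Here a adds one to the rank at P, and r a is sent to x r^p a. The decomposition l + r a
  is unique only up to a change of r by an element of P; the factor x kills P M, which makes the map
  well defined and its new values annihilated by P.\<close>

lemma theta_extend_free:
  assumes P: "primeideal P R" and L: "msub 0 L" and a: "a \<in> carrier M" and L': "L' = mhull 0 (insert a L)"
    and PL: "ideal_mult P \<subseteq> L" and free: "\<And>c. c \<in> carrier R \<Longrightarrow> c \<odot>\<^bsub>M\<^esub> a \<in> L \<Longrightarrow> c \<in> P"
    and x: "x \<in> carrier R - P" and xP: "\<And>u m. u \<in> P \<Longrightarrow> m \<in> carrier M \<Longrightarrow> x \<odot>\<^bsub>M\<^esub> (u \<odot>\<^bsub>M\<^esub> m) = \<zero>\<^bsub>M\<^esub>"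
    and th: "theta_on P L"
  shows "theta_on P L'"
proof -
  obtain \<theta> w where t: "p_linear_on \<theta> L" "\<And>u m. u \<in> P \<Longrightarrow> m \<in> carrier M \<Longrightarrow> \<theta> (u \<odot>\<^bsub>M\<^esub> m) = \<zero>\<^bsub>M\<^esub>"
     "\<And>u m. u \<in> P \<Longrightarrow> m \<in> L \<Longrightarrow> u \<odot>\<^bsub>M\<^esub> \<theta> m = \<zero>\<^bsub>M\<^esub>" and w: "w \<in> carrier R - P"
     "\<And>m. m \<in> L \<Longrightarrow> w \<odot>\<^bsub>M\<^esub> m \<in> mhull 0 (\<theta> ` L)" using th unfolding theta_on_def by blast
  note am = p_linear_onD[OF t(1)]
  have I: "ideal P R" using P by (simp add: primeideal.axioms)
  have Pc: "P \<subseteq> carrier R" by (rule ideal_in_carrier[OF I])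
  have Lc: "L \<subseteq> carrier M" using qsubD(1)[OF L] .
  have xa: "x \<in> carrier R" using x by simp
  have aL: "insert a L \<subseteq> carrier M" using a Lc by simp
  have L's: "msub 0 L'" unfolding L' by (rule qsub_qhull[OF aL])
  have L'c: "L' \<subseteq> carrier M" using qsubD(1)[OF L's] .
  have LL': "L \<subseteq> L'" "a \<in> L'" unfolding L' by (auto intro: qhull_base)
  have dec: "\<exists>l r. l \<in> L \<and> r \<in> carrier R \<and> z = l \<oplus>\<^bsub>M\<^esub> r \<odot>\<^bsub>M\<^esub> a" if z: "z \<in> L'" for z
    using qhull_insertE[OF L a z[unfolded L']] by (metis nat_pow_eone power_0)
  have comb: "l \<oplus>\<^bsub>M\<^esub> r \<odot>\<^bsub>M\<^esub> a \<in> L'" if "l \<in> L" "r \<in> carrier R" for l r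
    using qsubD(3)[OF L's, of l] msub0_smult[OF L's that(2) LL'(2)] LL'(1) that(1) by blast
  let ?val = "\<lambda>l r. \<theta> l \<oplus>\<^bsub>M\<^esub> (x \<otimes> (r [^] p)) \<odot>\<^bsub>M\<^esub> a"
  define t' where "t' z = (SOME y. \<exists>l r. l \<in> L \<and> r \<in> carrier R \<and> z = l \<oplus>\<^bsub>M\<^esub> r \<odot>\<^bsub>M\<^esub> a \<and> y = ?val l r)" for z
  \<comment> \<open>The difference s of two coefficients lies in P: then \<theta> vanishes on s a,
    and x kills s^p a.\<close>
  have unique: "?val l r = ?val l' r'"
    if h: "l \<in> L" "r \<in> carrier R" "l' \<in> L" "r' \<in> carrier R" "l \<oplus>\<^bsub>M\<^esub> r \<odot>\<^bsub>M\<^esub> a = l' \<oplus>\<^bsub>M\<^esub> r' \<odot>\<^bsub>M\<^esub> a" for l r l' r'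
  proof -
    have c: "l \<in> carrier M" "l' \<in> carrier M" "r \<odot>\<^bsub>M\<^esub> a \<in> carrier M" "r' \<odot>\<^bsub>M\<^esub> a \<in> carrier M" using h Lc a by auto
    let ?s = "r \<ominus> r'"
    have sc: "?s \<in> carrier R" using h by simp
    have sa: "?s \<odot>\<^bsub>M\<^esub> a = r \<odot>\<^bsub>M\<^esub> a \<ominus>\<^bsub>M\<^esub> r' \<odot>\<^bsub>M\<^esub> a" by (rule smult_diff_l[OF h(2,4) a])
    have "l' \<ominus>\<^bsub>M\<^esub> l = (l' \<oplus>\<^bsub>M\<^esub> r' \<odot>\<^bsub>M\<^esub> a) \<ominus>\<^bsub>M\<^esub> (l \<oplus>\<^bsub>M\<^esub> r' \<odot>\<^bsub>M\<^esub> a)"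
      using c by (simp add: M.minus_eq M.minus_add M.a_ac M.r_neg1 M.r_neg2 M.l_neg M.r_neg)
    also have "\<dots> = (l \<oplus>\<^bsub>M\<^esub> r \<odot>\<^bsub>M\<^esub> a) \<ominus>\<^bsub>M\<^esub> (l \<oplus>\<^bsub>M\<^esub> r' \<odot>\<^bsub>M\<^esub> a)" using h(5) by simp
    also have "\<dots> = r \<odot>\<^bsub>M\<^esub> a \<ominus>\<^bsub>M\<^esub> r' \<odot>\<^bsub>M\<^esub> a"
      using c by (simp add: M.minus_eq M.minus_add M.a_ac M.r_neg1 M.r_neg2 M.l_neg M.r_neg)
    finally have ll: "l' \<ominus>\<^bsub>M\<^esub> l = ?s \<odot>\<^bsub>M\<^esub> a" using sa by simp
    have "l' \<ominus>\<^bsub>M\<^esub> l \<in> L" by (rule qsub_diff[OF L h(3,1)])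
    then have sP: "?s \<in> P" using free[OF sc] ll by simp
    have sL: "?s \<odot>\<^bsub>M\<^esub> a \<in> L" using PL sP a by blast
    have "l' = l \<oplus>\<^bsub>M\<^esub> (l' \<ominus>\<^bsub>M\<^esub> l)" using c by (simp add: M.minus_eq M.a_ac M.r_neg1 M.r_neg2 M.l_neg M.r_neg)
    then have "\<theta> l' = \<theta> (l \<oplus>\<^bsub>M\<^esub> ?s \<odot>\<^bsub>M\<^esub> a)" using ll by simp
    also have "\<dots> = \<theta> l \<oplus>\<^bsub>M\<^esub> \<theta> (?s \<odot>\<^bsub>M\<^esub> a)" by (rule am(2)[OF h(1) sL])
    also have "\<theta> (?s \<odot>\<^bsub>M\<^esub> a) = \<zero>\<^bsub>M\<^esub>" by (rule t(2)[OF sP a])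
    finally have th: "\<theta> l' = \<theta> l" using am(1)[OF h(1)] by simp
    have r: "r = r' \<oplus> ?s" using h(2,4) by algebra
    have "r [^] p = r' [^] p \<oplus> ?s [^] p" using frob_add1[OF h(4) sc] r by simp
    then have "(x \<otimes> (r [^] p)) \<odot>\<^bsub>M\<^esub> a = (x \<otimes> (r' [^] p)) \<odot>\<^bsub>M\<^esub> a \<oplus>\<^bsub>M\<^esub> x \<odot>\<^bsub>M\<^esub> ((?s [^] p) \<odot>\<^bsub>M\<^esub> a)"
      using h(2,4) a xa by (simp add: r_distr smult_l_distr smult_assoc1)
    also have "x \<odot>\<^bsub>M\<^esub> ((?s [^] p) \<odot>\<^bsub>M\<^esub> a) = \<zero>\<^bsub>M\<^esub>" using xP[OF ideal_frob_pow[OF I sP, of 1] a] by simp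
    finally have "(x \<otimes> (r [^] p)) \<odot>\<^bsub>M\<^esub> a = (x \<otimes> (r' [^] p)) \<odot>\<^bsub>M\<^esub> a" using h(4) a xa by simp
    then show ?thesis using th by simp
  qed
  have t': "t' (l \<oplus>\<^bsub>M\<^esub> r \<odot>\<^bsub>M\<^esub> a) = ?val l r" if "l \<in> L" "r \<in> carrier R" for l r
  proof -
    let ?Q = "\<lambda>y. \<exists>l' r'. l' \<in> L \<and> r' \<in> carrier R \<and> l \<oplus>\<^bsub>M\<^esub> r \<odot>\<^bsub>M\<^esub> a = l' \<oplus>\<^bsub>M\<^esub> r' \<odot>\<^bsub>M\<^esub> a \<and> y = ?val l' r'"
    have "?Q (?val l r)" using that by blast
    then have "?Q (t' (l \<oplus>\<^bsub>M\<^esub> r \<odot>\<^bsub>M\<^esub> a))" unfolding t'_def by (rule someI)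
    then obtain l' r' where h: "l' \<in> L" "r' \<in> carrier R" "l \<oplus>\<^bsub>M\<^esub> r \<odot>\<^bsub>M\<^esub> a = l' \<oplus>\<^bsub>M\<^esub> r' \<odot>\<^bsub>M\<^esub> a"
      "t' (l \<oplus>\<^bsub>M\<^esub> r \<odot>\<^bsub>M\<^esub> a) = ?val l' r'" by blast
    show ?thesis unfolding h(4) by (rule unique[OF that h(1,2,3), symmetric])
  qed
  have valc: "?val l r \<in> carrier M" if "l \<in> L" "r \<in> carrier R" for l r using am(1)[OF that(1)] that xa a by simp
  have t'L: "t' l = \<theta> l" if "l \<in> L" for l
  proof -
    have "l \<oplus>\<^bsub>M\<^esub> \<zero> \<odot>\<^bsub>M\<^esub> a = l" using that Lc a by auto
    moreover have "?val l \<zero> = \<theta> l" using am(1)[OF that] zero_pow[of 1] xa a by simp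
    ultimately show ?thesis using t'[OF that, of \<zero>] by simp
  qed
  have L0: "\<zero>\<^bsub>M\<^esub> \<in> L" using qsubD(2)[OF L] .
  have t'a: "t' a = x \<odot>\<^bsub>M\<^esub> a"
  proof -
    have "\<zero>\<^bsub>M\<^esub> \<oplus>\<^bsub>M\<^esub> \<one> \<odot>\<^bsub>M\<^esub> a = a" using a by simp
    moreover have "\<theta> \<zero>\<^bsub>M\<^esub> = \<zero>\<^bsub>M\<^esub>" using t(2)[of \<zero> a] a fsubD(2)[OF ideal_fsub[OF I, of 0]] by simp
    ultimately show ?thesis using t'[OF L0 one_closed] xa a by simp
  qed
  have t'c: "t' z \<in> carrier M" if z: "z \<in> L'" for z
  proof -
    obtain l r where lr: "l \<in> L" "r \<in> carrier R" "z = l \<oplus>\<^bsub>M\<^esub> r \<odot>\<^bsub>M\<^esub> a" using dec[OF z] by blast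
    show ?thesis unfolding lr(3) t'[OF lr(1,2)] by (rule valc[OF lr(1,2)])
  qed
  have Hc: "t' ` L' \<subseteq> carrier M" using t'c by blast
  have H: "msub 0 (mhull 0 (t' ` L'))" by (rule qsub_qhull[OF Hc])
  show ?thesis
  proof (rule theta_onI[of t' _ _ "w \<otimes> x"])
    show "p_linear_on t' L'"
    proof (rule p_linear_onI)
      show "t' z \<in> carrier M" if "z \<in> L'" for z using t'c[OF that] .
    next
      fix y z assume y: "y \<in> L'" and z: "z \<in> L'"
      obtain l r where lr: "l \<in> L" "r \<in> carrier R" "y = l \<oplus>\<^bsub>M\<^esub> r \<odot>\<^bsub>M\<^esub> a" using dec[OF y] by blast
      obtain k s where ks: "k \<in> L" "s \<in> carrier R" "z = k \<oplus>\<^bsub>M\<^esub> s \<odot>\<^bsub>M\<^esub> a" using dec[OF z] by blast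
      have c: "l \<in> carrier M" "k \<in> carrier M" "\<theta> l \<in> carrier M" "\<theta> k \<in> carrier M" using lr ks Lc am(1) by auto
      have lk: "l \<oplus>\<^bsub>M\<^esub> k \<in> L" by (rule qsubD(3)[OF L lr(1) ks(1)])
      have "y \<oplus>\<^bsub>M\<^esub> z = (l \<oplus>\<^bsub>M\<^esub> k) \<oplus>\<^bsub>M\<^esub> (r \<oplus> s) \<odot>\<^bsub>M\<^esub> a"
        using c lr(2) ks(2) a by (simp add: lr(3) ks(3) smult_l_distr M.a_ac)
      then have "t' (y \<oplus>\<^bsub>M\<^esub> z) = ?val (l \<oplus>\<^bsub>M\<^esub> k) (r \<oplus> s)" using t'[OF lk, of "r \<oplus> s"] lr(2) ks(2) by simp
      also have "\<dots> = ?val l r \<oplus>\<^bsub>M\<^esub> ?val k s"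
        unfolding am(2)[OF lr(1) ks(1)]
        using c lr(2) ks(2) a xa by (simp add: frob_add1 r_distr smult_l_distr M.a_ac)
      finally show "t' (y \<oplus>\<^bsub>M\<^esub> z) = t' y \<oplus>\<^bsub>M\<^esub> t' z" using t'[OF lr(1,2)] t'[OF ks(1,2)] lr(3) ks(3) by simp
    next
      fix s y assume s: "s \<in> carrier R" and y: "y \<in> L'"
      obtain l r where lr: "l \<in> L" "r \<in> carrier R" "y = l \<oplus>\<^bsub>M\<^esub> r \<odot>\<^bsub>M\<^esub> a" using dec[OF y] by blast
      have c: "l \<in> carrier M" "\<theta> l \<in> carrier M" using lr Lc am(1) by auto
      have sl: "s \<odot>\<^bsub>M\<^esub> l \<in> L" by (rule msub0_smult[OF L s lr(1)])
      have "s \<odot>\<^bsub>M\<^esub> y = s \<odot>\<^bsub>M\<^esub> l \<oplus>\<^bsub>M\<^esub> (s \<otimes> r) \<odot>\<^bsub>M\<^esub> a"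
        using c lr(2) s a by (simp add: lr(3) smult_r_distr smult_assoc1)
      then have "t' (s \<odot>\<^bsub>M\<^esub> y) = ?val (s \<odot>\<^bsub>M\<^esub> l) (s \<otimes> r)" using t'[OF sl, of "s \<otimes> r"] lr(2) s by simp
      also have "\<dots> = (s [^] p) \<odot>\<^bsub>M\<^esub> ?val l r"
        unfolding am(3)[OF s lr(1)]
        using c lr(2) s a xa by (simp add: nat_pow_distrib smult_r_distr smult_assoc1[symmetric] m_lcomm)
      finally show "t' (s \<odot>\<^bsub>M\<^esub> y) = (s [^] p) \<odot>\<^bsub>M\<^esub> t' y" using t'[OF lr(1,2)] lr(3) by simp
    qed
    show "t' (u \<odot>\<^bsub>M\<^esub> m) = \<zero>\<^bsub>M\<^esub>" if "u \<in> P" "m \<in> carrier M" for u m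
    proof -
      have "u \<odot>\<^bsub>M\<^esub> m \<in> L" using PL that by blast
      then show ?thesis using t'L t(2)[OF that] by simp
    qed
    show "u \<odot>\<^bsub>M\<^esub> t' z = \<zero>\<^bsub>M\<^esub>" if u: "u \<in> P" and z: "z \<in> L'" for u z
    proof -
      obtain l r where lr: "l \<in> L" "r \<in> carrier R" "z = l \<oplus>\<^bsub>M\<^esub> r \<odot>\<^bsub>M\<^esub> a" using dec[OF z] by blast
      have uc: "u \<in> carrier R" using u Pc by auto
      have "u \<odot>\<^bsub>M\<^esub> t' z = u \<odot>\<^bsub>M\<^esub> \<theta> l \<oplus>\<^bsub>M\<^esub> u \<odot>\<^bsub>M\<^esub> ((x \<otimes> (r [^] p)) \<odot>\<^bsub>M\<^esub> a)"
        unfolding lr(3) t'[OF lr(1,2)] using am(1)[OF lr(1)] uc lr(2) xa a by (intro smult_r_distr) auto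
      also have "u \<odot>\<^bsub>M\<^esub> ((x \<otimes> (r [^] p)) \<odot>\<^bsub>M\<^esub> a) = x \<odot>\<^bsub>M\<^esub> (u \<odot>\<^bsub>M\<^esub> ((r [^] p) \<odot>\<^bsub>M\<^esub> a))"
        using uc lr(2) xa a by (simp add: smult_assoc1[symmetric] m_ac)
      also have "\<dots> = \<zero>\<^bsub>M\<^esub>" using xP[OF u, of "(r [^] p) \<odot>\<^bsub>M\<^esub> a"] lr(2) a by simp
      finally show ?thesis using t(3)[OF u lr(1)] by simp
    qed
    show "w \<otimes> x \<in> carrier R - P" by (rule prod_notin_prime[OF P w(1) x])
    show "(w \<otimes> x) \<odot>\<^bsub>M\<^esub> z \<in> mhull 0 (t' ` L')" if z: "z \<in> L'" for z
    proof -
      obtain l r where lr: "l \<in> L" "r \<in> carrier R" "z = l \<oplus>\<^bsub>M\<^esub> r \<odot>\<^bsub>M\<^esub> a" using dec[OF z] by blast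
      have lc: "l \<in> carrier M" using lr Lc by auto
      have "\<theta> ` L \<subseteq> t' ` L'"
      proof
        fix y assume "y \<in> \<theta> ` L"
        then obtain k where "k \<in> L" "y = \<theta> k" by blast
        then have "y = t' k" "k \<in> L'" using t'L LL' by auto
        then show "y \<in> t' ` L'" by blast
      qed
      then have "w \<odot>\<^bsub>M\<^esub> l \<in> mhull 0 (t' ` L')" using w(2)[OF lr(1)] qhull_mono by blast
      then have 1: "x \<odot>\<^bsub>M\<^esub> (w \<odot>\<^bsub>M\<^esub> l) \<in> mhull 0 (t' ` L')" by (rule msub0_smult[OF H xa])
      have "t' a \<in> mhull 0 (t' ` L')" using LL'(2) by (intro qhull_base) blast
      then have 2: "(w \<otimes> r) \<odot>\<^bsub>M\<^esub> (x \<odot>\<^bsub>M\<^esub> a) \<in> mhull 0 (t' ` L')"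
        using msub0_smult[OF H, of "w \<otimes> r" "t' a"] t'a w(1) lr by simp
      have "(w \<otimes> x) \<odot>\<^bsub>M\<^esub> z = x \<odot>\<^bsub>M\<^esub> (w \<odot>\<^bsub>M\<^esub> l) \<oplus>\<^bsub>M\<^esub> (w \<otimes> r) \<odot>\<^bsub>M\<^esub> (x \<odot>\<^bsub>M\<^esub> a)"
        using w(1) xa lr(2) lc a by (simp add: lr(3) smult_r_distr smult_assoc1[symmetric] m_ac)
      then show ?thesis using qsubD(3)[OF H 1 2] by simp
    qed
  qed
qed

end

context F_finite_module
begin

text \<open>Adds the generators of M one by one to P M. On P M the zero map works with denominator
  x, and each generator is either torsion or free over the preceding submodule at P.\<close>

lemma theta_exists:
  assumes P: "primeideal P R" and x: "x \<in> carrier R - P"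
    and xP: "\<And>u m. u \<in> P \<Longrightarrow> m \<in> carrier M \<Longrightarrow> x \<odot>\<^bsub>M\<^esub> (u \<odot>\<^bsub>M\<^esub> m) = \<zero>\<^bsub>M\<^esub>"
    and A: "finite A" "A \<subseteq> carrier M" "carrier M \<subseteq> mhull 0 A"
  shows "theta_on P (carrier M)"
proof -
  have Pc: "P \<subseteq> carrier R" using P by (simp add: primeideal.axioms ideal_in_carrier)
  have PM: "ideal_mult P \<subseteq> carrier M" using Pc by auto
  have "theta_on P (mhull 0 (ideal_mult P \<union> A))"
    using A(1,2)
  proof (induction A rule: finite_induct)
    case empty
    let ?L = "mhull 0 (ideal_mult P \<union> {})"
    have Lc: "?L \<subseteq> carrier M" by (rule qhull_carrier) (use PM in simp)
    have z: "msub 0 {\<zero>\<^bsub>M\<^esub>}" by (rule qsubI) auto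
    have "msub 0 {m \<in> carrier M. x \<odot>\<^bsub>M\<^esub> m \<in> {\<zero>\<^bsub>M\<^esub>}}" by (rule qsub_pre_smult[OF _ z]) (use x in simp)
    moreover have "ideal_mult P \<union> {} \<subseteq> {m \<in> carrier M. x \<odot>\<^bsub>M\<^esub> m \<in> {\<zero>\<^bsub>M\<^esub>}}" using PM xP by auto
    ultimately have xL: "?L \<subseteq> {m \<in> carrier M. x \<odot>\<^bsub>M\<^esub> m \<in> {\<zero>\<^bsub>M\<^esub>}}" by (rule qhull_least)
    show ?case
    proof (rule theta_onI[of "\<lambda>_. \<zero>\<^bsub>M\<^esub>" _ _ x])
      show "p_linear_on (\<lambda>_. \<zero>\<^bsub>M\<^esub>) ?L" by (rule p_linear_onI) simp_all
      show "u \<odot>\<^bsub>M\<^esub> \<zero>\<^bsub>M\<^esub> = \<zero>\<^bsub>M\<^esub>" if "u \<in> P" for u using that Pc by auto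
      show "x \<odot>\<^bsub>M\<^esub> m \<in> mhull 0 ((\<lambda>_. \<zero>\<^bsub>M\<^esub>) ` ?L)" if "m \<in> ?L" for m
      proof -
        have "x \<odot>\<^bsub>M\<^esub> m = \<zero>\<^bsub>M\<^esub>" using xL that by blast
        moreover have "\<zero>\<^bsub>M\<^esub> \<in> mhull 0 ((\<lambda>_. \<zero>\<^bsub>M\<^esub>) ` ?L)"
          by (rule qsubD(2)[OF qsub_qhull]) auto
        ultimately show ?thesis by simp
      qed
    qed (use x in simp_all)
  next
    case (insert a A)
    let ?L = "mhull 0 (ideal_mult P \<union> A)" and ?L' = "mhull 0 (ideal_mult P \<union> insert a A)"
    have a: "a \<in> carrier M" and Ac: "ideal_mult P \<union> A \<subseteq> carrier M" using insert.prems PM by auto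
    have L: "msub 0 ?L" by (rule qsub_qhull[OF Ac])
    have L'eq: "?L' = mhull 0 (insert a ?L)"
      using qhull_qhull_Un[OF Ac, of "{a}" "p ^ 0"] a by simp
    have L': "msub 0 ?L'" by (rule qsub_qhull) (use Ac a in simp)
    have PL: "ideal_mult P \<subseteq> ?L" using qhull_superset[of "ideal_mult P \<union> A" R "p ^ 0" M] by simp
    have th: "theta_on P ?L" using insert by simp
    show ?case
    proof (cases "\<exists>c\<in>carrier R - P. c \<odot>\<^bsub>M\<^esub> a \<in> ?L")
      case True
      then obtain c where c: "c \<in> carrier R - P" "c \<odot>\<^bsub>M\<^esub> a \<in> ?L" by blast
      show ?thesis
      proof (rule theta_extend_torsion[OF P L L' _ PL c(1) _ th])
        show "?L \<subseteq> ?L'" by (rule qhull_mono) auto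
        fix z assume "z \<in> ?L'"
        then have "z \<in> mhull 0 (insert a ?L)" unfolding L'eq .
        from qhull_insertE[OF L a this] obtain l r where lr: "l \<in> ?L" "r \<in> carrier R" "z = l \<oplus>\<^bsub>M\<^esub> (r [^] (p ^ 0)) \<odot>\<^bsub>M\<^esub> a" .
        have lc: "l \<in> carrier M" using lr qsubD(1)[OF L] by auto
        have "c \<odot>\<^bsub>M\<^esub> z = c \<odot>\<^bsub>M\<^esub> l \<oplus>\<^bsub>M\<^esub> r \<odot>\<^bsub>M\<^esub> (c \<odot>\<^bsub>M\<^esub> a)"
          using lc lr(2) a c(1) by (simp add: lr(3) smult_r_distr smult_assoc1[symmetric] m_comm)
        moreover have "c \<odot>\<^bsub>M\<^esub> l \<in> ?L" using msub0_smult[OF L _ lr(1)] c(1) by simp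
        moreover have "r \<odot>\<^bsub>M\<^esub> (c \<odot>\<^bsub>M\<^esub> a) \<in> ?L" by (rule msub0_smult[OF L lr(2) c(2)])
        ultimately show "c \<odot>\<^bsub>M\<^esub> z \<in> ?L" using qsubD(3)[OF L] by simp
      qed
    next
      case False
      show ?thesis
        by (rule theta_extend_free[OF P L a L'eq PL _ x xP th]) (use False in blast)
    qed
  qed
  moreover have "mhull 0 (ideal_mult P \<union> A) = carrier M"
  proof
    show "mhull 0 (ideal_mult P \<union> A) \<subseteq> carrier M" by (rule qhull_carrier) (use PM A in simp)
    show "carrier M \<subseteq> mhull 0 (ideal_mult P \<union> A)" using A(3) qhull_mono[of A "ideal_mult P \<union> A" R "p ^ 0" M] by auto
  qed
  ultimately show ?thesis by simp
qed

text \<open>Multiplying \<theta> by a basis y of \<kappa>(P) over \<kappa>(P)^p passes from the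
  values of Frobenius to all of F_*M at P. Using arguments x m' costs only a factor x^p outside P,
  and it later allows the maps for different primes to be added.\<close>

lemma theta_cover:
  assumes P: "primeideal P R" and th: "p_linear_on \<theta> (carrier M)"
    and Pth: "\<And>u m. u \<in> P \<Longrightarrow> m \<in> carrier M \<Longrightarrow> u \<odot>\<^bsub>M\<^esub> \<theta> m = \<zero>\<^bsub>M\<^esub>"
    and w: "w \<in> carrier R - P" "\<And>m. m \<in> carrier M \<Longrightarrow> w \<odot>\<^bsub>M\<^esub> m \<in> mhull 0 (\<theta> ` carrier M)"
    and x: "x \<in> carrier R - P" and ys: "qbasis R (p ^ 1) P ys"
  shows "\<exists>v\<in>carrier R - P. \<forall>m\<in>carrier M. v \<odot>\<^bsub>M\<^esub> m \<in>
    mhull 1 {y \<odot>\<^bsub>M\<^esub> \<theta> (x \<odot>\<^bsub>M\<^esub> m') |y m'. y \<in> set ys \<and> m' \<in> carrier M}"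
proof -
  note am = p_linear_onD[OF th]
  have Pc: "P \<subseteq> carrier R" using P by (simp add: primeideal.axioms ideal_in_carrier)
  obtain d where d: "d \<in> carrier R - P" "\<And>r. r \<in> carrier R \<Longrightarrow> (d [^] (p ^ 1)) \<otimes> r \<in> fhull 1 (P \<union> set ys)"
    using ys unfolding qbasis_def by blast
  have "strict R (p ^ 1) P P ys" using ys unfolding qbasis_def by blast
  then have yc: "set ys \<subseteq> carrier R" by (rule strict_carrier)
  let ?G = "{y \<odot>\<^bsub>M\<^esub> \<theta> (x \<odot>\<^bsub>M\<^esub> m') |y m'. y \<in> set ys \<and> m' \<in> carrier M}"
  have xc: "x \<in> carrier R" using x by simp
  have Gc: "?G \<subseteq> carrier M" using subsetD[OF yc] am(1) xc by auto
  let ?H = "mhull 1 ?G"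
  have H: "msub 1 ?H" by (rule qsub_qhull[OF Gc])
  define D where "D = d [^] (p ^ 1)"
  have DP: "D \<in> carrier R - P" unfolding D_def by (rule pow_notin_prime[OF P d(1)])
  have Dc: "D \<in> carrier R" using DP by simp
  have xp: "x [^] p \<in> carrier R" using xc by simp
  \<comment> \<open>The scalar t is arbitrary, not a p-th power: D t is a combination of
    \<open>ys\<close> modulo P, and P annihilates the values of \<theta>.\<close>
  have DH: "(D \<otimes> t) \<odot>\<^bsub>M\<^esub> ((x [^] p) \<odot>\<^bsub>M\<^esub> \<theta> m) \<in> ?H" if t: "t \<in> carrier R" and m: "m \<in> carrier M" for t m
  proof -
    have tm: "\<theta> m \<in> carrier M" by (rule am(1)[OF m])
    let ?K = "{r \<in> carrier R. r \<odot>\<^bsub>M\<^esub> ((x [^] p) \<odot>\<^bsub>M\<^esub> \<theta> m) \<in> ?H}"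
    have K: "fsub 1 ?K" by (rule msub_scalars[OF _ H]) (use xp tm in simp)
    have "P \<union> set ys \<subseteq> ?K"
    proof
      fix u assume u: "u \<in> P \<union> set ys"
      then have uc: "u \<in> carrier R" using Pc yc by auto
      have "u \<odot>\<^bsub>M\<^esub> ((x [^] p) \<odot>\<^bsub>M\<^esub> \<theta> m) \<in> ?H"
      proof (cases "u \<in> P")
        case True
        have "u \<odot>\<^bsub>M\<^esub> ((x [^] p) \<odot>\<^bsub>M\<^esub> \<theta> m) = (x [^] p) \<odot>\<^bsub>M\<^esub> (u \<odot>\<^bsub>M\<^esub> \<theta> m)"
          using uc xp tm by (simp add: smult_assoc1[symmetric] m_comm)
        then show ?thesis using Pth[OF True m] xp qsubD(2)[OF H] by simp
      next
        case False
        then have uy: "u \<in> set ys" using u by simp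
        have "u \<odot>\<^bsub>M\<^esub> ((x [^] p) \<odot>\<^bsub>M\<^esub> \<theta> m) = u \<odot>\<^bsub>M\<^esub> \<theta> (x \<odot>\<^bsub>M\<^esub> m)" using am(3)[OF xc m] by simp
        moreover have "u \<odot>\<^bsub>M\<^esub> \<theta> (x \<odot>\<^bsub>M\<^esub> m) \<in> ?G" using uy m by blast
        ultimately show ?thesis using qhull_base[of _ ?G R "p ^ 1" M] by simp
      qed
      then show "u \<in> ?K" using uc by simp
    qed
    then have "fhull 1 (P \<union> set ys) \<subseteq> ?K" by (rule qhull_least[OF K])
    moreover have "D \<otimes> t \<in> fhull 1 (P \<union> set ys)" unfolding D_def by (rule d(2)[OF t])
    ultimately show ?thesis by blast
  qed
  let ?H' = "{z \<in> carrier M. (D \<otimes> (x [^] p)) \<odot>\<^bsub>M\<^esub> z \<in> ?H}"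
  have H': "msub 1 ?H'" by (rule qsub_pre_smult[OF _ H]) (use Dc xp in simp)
  \<comment> \<open>The multiple w m lies in the R-span of the values, whereas \<open>?H'\<close> is
    closed only under p-th powers; hence all R-multiples are tested.\<close>
  let ?U = "{z \<in> carrier M. \<forall>r\<in>carrier R. (r [^] (p ^ 0)) \<odot>\<^bsub>M\<^esub> z \<in> ?H'}"
  have U: "msub 0 ?U" by (rule msub_saturate[of 0 1]) (use H' in simp)
  have "\<theta> ` carrier M \<subseteq> ?U"
  proof
    fix z assume "z \<in> \<theta> ` carrier M"
    then obtain m where m: "m \<in> carrier M" "z = \<theta> m" by blast
    have zc: "z \<in> carrier M" using am(1)[OF m(1)] m(2) by simp
    have "(r [^] (p ^ 0)) \<odot>\<^bsub>M\<^esub> z \<in> ?H'" if r: "r \<in> carrier R" for r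
    proof -
      have "(D \<otimes> (x [^] p)) \<odot>\<^bsub>M\<^esub> (r \<odot>\<^bsub>M\<^esub> z) = (D \<otimes> r) \<odot>\<^bsub>M\<^esub> ((x [^] p) \<odot>\<^bsub>M\<^esub> z)"
        using Dc xp r zc by (simp add: smult_assoc1[symmetric] m_ac)
      then show ?thesis using DH[OF r m(1)] r zc m(2) by simp
    qed
    then show "z \<in> ?U" using zc by simp
  qed
  then have U': "mhull 0 (\<theta> ` carrier M) \<subseteq> ?U" by (rule qhull_least[OF U])
  let ?v = "(D \<otimes> (x [^] p)) \<otimes> w"
  have "?v \<odot>\<^bsub>M\<^esub> m \<in> ?H" if m: "m \<in> carrier M" for m
  proof -
    have "w \<odot>\<^bsub>M\<^esub> m \<in> ?H'" using U' w(2)[OF m] msub_saturateD by blast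
    then show ?thesis using Dc xp w(1) m by (simp add: smult_assoc1)
  qed
  moreover have "?v \<in> carrier R - P" by (intro prod_notin_prime[OF P] DP w(1) pow_notin_prime[OF P x])
  ultimately show ?thesis by blast
qed

section \<open>One family of maps for all minimal primes, and the resulting recurrence\<close>

text \<open>The maps are sums over the primes of multiples c \<theta>, with one basis element of
  each prime per index l. As \<open>x P\<close> lies in every other prime P' and the map for P'
  kills P' M, the arguments \<open>x P\<close> m' isolate the summand of P. Thus \<Gamma> maps
  suffice for all primes together instead of the sum of their ranks. The vanishing condition for
  primes outside S keeps the maps built so far zero on \<open>x Q\<close> M when Q is added.\<close>

lemma phi_exists:
  assumes PP: "\<And>P. P \<in> PP \<Longrightarrow> primeideal P R" and "finite PP"
    and x: "\<And>P. P \<in> PP \<Longrightarrow> x P \<in> carrier R - P" "\<And>P P'. P \<in> PP \<Longrightarrow> P' \<in> PP \<Longrightarrow> P \<noteq> P' \<Longrightarrow> x P \<in> P'"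
    and xP: "\<And>P u m. P \<in> PP \<Longrightarrow> u \<in> P \<Longrightarrow> m \<in> carrier M \<Longrightarrow> x P \<odot>\<^bsub>M\<^esub> (u \<odot>\<^bsub>M\<^esub> m) = \<zero>\<^bsub>M\<^esub>"
    and A: "finite A" "A \<subseteq> carrier M" "carrier M \<subseteq> mhull 0 A"
    and \<Gamma>: "\<And>P. P \<in> PP \<Longrightarrow> rank P \<le> \<Gamma>" and S: "S \<subseteq> PP"
  shows "\<exists>\<phi> :: nat \<Rightarrow> 'c \<Rightarrow> 'c. (\<forall>l. p_linear_on (\<phi> l) (carrier M)) \<and>
    (\<forall>l. \<forall>P\<in>PP - S. \<forall>m\<in>carrier M. \<phi> l (x P \<odot>\<^bsub>M\<^esub> m) = \<zero>\<^bsub>M\<^esub>) \<and>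
    (\<forall>P\<in>S. \<exists>v\<in>carrier R - P. \<forall>m\<in>carrier M. v \<odot>\<^bsub>M\<^esub> m \<in>
      mhull 1 {\<phi> l (x P \<odot>\<^bsub>M\<^esub> m') |l m'. l < \<Gamma> \<and> m' \<in> carrier M})"
  using finite_subset[OF S \<open>finite PP\<close>] S
proof (induction S rule: finite_induct)
  case empty
  have "p_linear_on (\<lambda>_. \<zero>\<^bsub>M\<^esub>) (carrier M)" by (rule p_linear_onI) simp_all
  then show ?case by (intro exI[of _ "\<lambda>_ _. \<zero>\<^bsub>M\<^esub>"]) simp
next
  case (insert Q S)
  then have "S \<subseteq> PP" by simp
  from insert.IH[OF this] obtain \<phi> :: "nat \<Rightarrow> 'c \<Rightarrow> 'c" where \<phi>0: "(\<forall>l. p_linear_on (\<phi> l) (carrier M)) \<and>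
    (\<forall>l. \<forall>P\<in>PP - S. \<forall>m\<in>carrier M. \<phi> l (x P \<odot>\<^bsub>M\<^esub> m) = \<zero>\<^bsub>M\<^esub>) \<and>
    (\<forall>P\<in>S. \<exists>v\<in>carrier R - P. \<forall>m\<in>carrier M. v \<odot>\<^bsub>M\<^esub> m \<in>
      mhull 1 {\<phi> l (x P \<odot>\<^bsub>M\<^esub> m') |l m'. l < \<Gamma> \<and> m' \<in> carrier M})" by (rule exE)
  have \<phi>: "\<And>l. p_linear_on (\<phi> l) (carrier M)"
      "\<And>l P m. P \<in> PP - S \<Longrightarrow> m \<in> carrier M \<Longrightarrow> \<phi> l (x P \<odot>\<^bsub>M\<^esub> m) = \<zero>\<^bsub>M\<^esub>"
      "\<And>P. P \<in> S \<Longrightarrow> \<exists>v\<in>carrier R - P. \<forall>m\<in>carrier M. v \<odot>\<^bsub>M\<^esub> m \<in> mhull 1 {\<phi> l (x P \<odot>\<^bsub>M\<^esub> m') |l m'. l < \<Gamma> \<and> m' \<in> carrier M}"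
    using conjunct1[OF \<phi>0] conjunct1[OF conjunct2[OF \<phi>0]] conjunct2[OF conjunct2[OF \<phi>0]] by simp_all
  have Q: "Q \<in> PP" "Q \<notin> S" "S \<subseteq> PP" using insert by auto
  have "theta_on Q (carrier M)" by (rule theta_exists[OF PP[OF Q(1)] x(1)[OF Q(1)] xP[OF Q(1)] A])
  then obtain \<theta> w where t: "p_linear_on \<theta> (carrier M)" "\<And>u m. u \<in> Q \<Longrightarrow> m \<in> carrier M \<Longrightarrow> \<theta> (u \<odot>\<^bsub>M\<^esub> m) = \<zero>\<^bsub>M\<^esub>"
     "\<And>u m. u \<in> Q \<Longrightarrow> m \<in> carrier M \<Longrightarrow> u \<odot>\<^bsub>M\<^esub> \<theta> m = \<zero>\<^bsub>M\<^esub>" "w \<in> carrier R - Q"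
     "\<And>m. m \<in> carrier M \<Longrightarrow> w \<odot>\<^bsub>M\<^esub> m \<in> mhull 0 (\<theta> ` carrier M)" unfolding theta_on_def by blast
  note am = p_linear_onD[OF t(1)]
  obtain ys where ys: "qbasis R (p ^ 1) Q ys" "length ys = rank Q" using rank_basis1[OF PP[OF Q(1)]] by blast
  have "strict R (p ^ 1) Q Q ys" using ys unfolding qbasis_def by blast
  then have yc: "set ys \<subseteq> carrier R" by (rule strict_carrier)
  \<comment> \<open>Zero beyond the rank of Q pads the list to the common length \<Gamma>.\<close>
  define c where "c l = (if l < length ys then ys ! l else \<zero>)" for l
  have cc: "c l \<in> carrier R" for l using yc by (auto simp: c_def)
  define \<psi> where "\<psi> l m = \<phi> l m \<oplus>\<^bsub>M\<^esub> c l \<odot>\<^bsub>M\<^esub> \<theta> m" for l m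
  have am\<phi>: "\<phi> l m \<in> carrier M" if "m \<in> carrier M" for l m by (rule p_linear_onD(1)[OF \<phi>(1) that])
  have \<psi>: "p_linear_on (\<psi> l) (carrier M)" for l
  proof (rule p_linear_onI)
    show "\<psi> l m \<in> carrier M" if "m \<in> carrier M" for m unfolding \<psi>_def using am\<phi>[OF that] am(1)[OF that] cc by simp
    show "\<psi> l (m \<oplus>\<^bsub>M\<^esub> n) = \<psi> l m \<oplus>\<^bsub>M\<^esub> \<psi> l n" if "m \<in> carrier M" "n \<in> carrier M" for m n
      unfolding \<psi>_def p_linear_onD(2)[OF \<phi>(1) that] am(2)[OF that]
      using am\<phi>[OF that(1)] am\<phi>[OF that(2)] am(1)[OF that(1)] am(1)[OF that(2)] cc
      by (simp add: smult_r_distr M.a_ac)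
    show "\<psi> l (r \<odot>\<^bsub>M\<^esub> m) = (r [^] p) \<odot>\<^bsub>M\<^esub> \<psi> l m" if "r \<in> carrier R" "m \<in> carrier M" for r m
      unfolding \<psi>_def p_linear_onD(3)[OF \<phi>(1) that] am(3)[OF that]
      using am\<phi>[OF that(2)] am(1)[OF that(2)] cc[of l] that(1)
      by (simp add: smult_r_distr smult_assoc1[symmetric] m_comm)
  qed
  have \<theta>0: "\<theta> (x P \<odot>\<^bsub>M\<^esub> m) = \<zero>\<^bsub>M\<^esub>" if "P \<in> PP" "P \<noteq> Q" "m \<in> carrier M" for P m
    by (rule t(2)[OF x(2)[OF that(1) Q(1) that(2)] that(3)])
  have \<psi>\<phi>: "\<psi> l (x P \<odot>\<^bsub>M\<^esub> m) = \<phi> l (x P \<odot>\<^bsub>M\<^esub> m)" if "P \<in> PP" "P \<noteq> Q" "m \<in> carrier M" for P m l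
    unfolding \<psi>_def \<theta>0[OF that] using am\<phi>[of "x P \<odot>\<^bsub>M\<^esub> m" l] x(1)[OF that(1)] that(3) cc[of l] by simp
  have \<psi>Q: "\<psi> l (x Q \<odot>\<^bsub>M\<^esub> m) = c l \<odot>\<^bsub>M\<^esub> \<theta> (x Q \<odot>\<^bsub>M\<^esub> m)" if "m \<in> carrier M" for m l
    unfolding \<psi>_def using \<phi>(2)[of Q m l] Q that am(1)[of "x Q \<odot>\<^bsub>M\<^esub> m"] x(1)[OF Q(1)] cc[of l] by simp
  have "\<exists>v\<in>carrier R - P. \<forall>m\<in>carrier M. v \<odot>\<^bsub>M\<^esub> m \<in> mhull 1 {\<psi> l (x P \<odot>\<^bsub>M\<^esub> m') |l m'. l < \<Gamma> \<and> m' \<in> carrier M}"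
    if P: "P \<in> insert Q S" for P
  proof (cases "P = Q")
    case True
    obtain v where v: "v \<in> carrier R - Q" "\<And>m. m \<in> carrier M \<Longrightarrow> v \<odot>\<^bsub>M\<^esub> m \<in>
      mhull 1 {y \<odot>\<^bsub>M\<^esub> \<theta> (x Q \<odot>\<^bsub>M\<^esub> m') |y m'. y \<in> set ys \<and> m' \<in> carrier M}"
      using theta_cover[OF PP[OF Q(1)] t(1,3,4,5) x(1)[OF Q(1)] ys(1)] by blast
    have "{y \<odot>\<^bsub>M\<^esub> \<theta> (x Q \<odot>\<^bsub>M\<^esub> m') |y m'. y \<in> set ys \<and> m' \<in> carrier M} \<subseteq> {\<psi> l (x Q \<odot>\<^bsub>M\<^esub> m') |l m'. l < \<Gamma> \<and> m' \<in> carrier M}"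
    proof
      fix z assume "z \<in> {y \<odot>\<^bsub>M\<^esub> \<theta> (x Q \<odot>\<^bsub>M\<^esub> m') |y m'. y \<in> set ys \<and> m' \<in> carrier M}"
      then obtain y m' where z: "y \<in> set ys" "m' \<in> carrier M" "z = y \<odot>\<^bsub>M\<^esub> \<theta> (x Q \<odot>\<^bsub>M\<^esub> m')" by blast
      obtain l where l: "l < length ys" "y = ys ! l" using z(1) by (auto simp: in_set_conv_nth)
      have "z = \<psi> l (x Q \<odot>\<^bsub>M\<^esub> m')" using \<psi>Q[OF z(2), of l] l z(3) by (simp add: c_def)
      moreover have "l < \<Gamma>" using l(1) ys(2) \<Gamma>[OF Q(1)] by simp
      ultimately show "z \<in> {\<psi> l (x Q \<odot>\<^bsub>M\<^esub> m') |l m'. l < \<Gamma> \<and> m' \<in> carrier M}" using z(2) by blast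
    qed
    from qhull_mono[OF this, of R "p ^ 1" M] show ?thesis unfolding True using v by blast
  next
    case False
    then have P': "P \<in> S" "P \<in> PP" using P Q(3) by auto
    have "{\<phi> l (x P \<odot>\<^bsub>M\<^esub> m') |l m'. l < \<Gamma> \<and> m' \<in> carrier M} \<subseteq> {\<psi> l (x P \<odot>\<^bsub>M\<^esub> m') |l m'. l < \<Gamma> \<and> m' \<in> carrier M}"
    proof
      fix z assume "z \<in> {\<phi> l (x P \<odot>\<^bsub>M\<^esub> m') |l m'. l < \<Gamma> \<and> m' \<in> carrier M}"
      then obtain l m' where z: "l < \<Gamma>" "m' \<in> carrier M" "z = \<phi> l (x P \<odot>\<^bsub>M\<^esub> m')" by blast
      have "z = \<psi> l (x P \<odot>\<^bsub>M\<^esub> m')" using \<psi>\<phi>[OF P'(2) False z(2), of l] z(3) by simp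
      then show "z \<in> {\<psi> l (x P \<odot>\<^bsub>M\<^esub> m') |l m'. l < \<Gamma> \<and> m' \<in> carrier M}" using z(1,2) by blast
    qed
    from qhull_mono[OF this, of R "p ^ 1" M] show ?thesis using \<phi>(3)[OF P'(1)] by blast
  qed
  moreover have "\<psi> l (x P \<odot>\<^bsub>M\<^esub> m) = \<zero>\<^bsub>M\<^esub>" if "P \<in> PP - insert Q S" "m \<in> carrier M" for l P m
    using \<psi>\<phi>[of P m l] \<phi>(2)[of P m l] that by simp
  ultimately show ?case using \<psi> by (intro exI[of _ \<psi>]) blast
qed

text \<open>Regarded as linear maps F^e_*M -> F^(e+1)_*M, the \<phi> send g generators to \<Gamma> g
  elements whose span contains F^(e+1)_*(J M); the quotient is controlled by R / J and the
  generators \<open>A0\<close>.\<close>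

lemma phi_step:
  assumes \<phi>: "\<And>l. p_linear_on (\<phi> l) (carrier M)" and A0: "finite A0" "A0 \<subseteq> carrier M" "carrier M \<subseteq> mhull 0 A0"
    and J: "J \<subseteq> carrier R"
      "\<And>r m. r \<in> J \<Longrightarrow> m \<in> carrier M \<Longrightarrow> r \<odot>\<^bsub>M\<^esub> m \<in> mhull 1 {\<phi> l m' |l m'. l < \<Gamma> \<and> m' \<in> carrier M}"
    and g: "qgen R (p ^ e) M {} g" and n: "gens (1 + e) J n"
  shows "qgen R (p ^ (1 + e)) M {} (\<Gamma> * g + card A0 * n)"
proof -
  obtain A where A: "finite A" "card A \<le> g" "A \<subseteq> carrier M" "carrier M \<subseteq> mhull e A" using g by (auto simp: qgen_def)
  let ?B = "(\<lambda>(l, a). \<phi> l a) ` ({..<\<Gamma>} \<times> A)"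
  have Bc: "?B \<subseteq> carrier M" using p_linear_onD(1)[OF \<phi>] subsetD[OF A(3)] by auto
  let ?W = "mhull (1 + e) ?B"
  have W: "msub (1 + e) ?W" by (rule qsub_qhull[OF Bc])
  have \<phi>W: "\<phi> l m \<in> ?W" if l: "l < \<Gamma>" and m: "m \<in> carrier M" for l m
  proof -
    let ?K = "{m \<in> carrier M. \<phi> l m \<in> ?W}"
    have K: "msub e ?K"
    proof (rule qsub_pre[OF _ _ _ W])
      fix r m assume rm: "r \<in> carrier R" "m \<in> carrier M"
      have "\<phi> l ((r [^] (p ^ e)) \<odot>\<^bsub>M\<^esub> m) = ((r [^] (p ^ e)) [^] p) \<odot>\<^bsub>M\<^esub> \<phi> l m"
        using p_linear_onD(3)[OF \<phi>, of "r [^] (p ^ e)" m l] rm by simp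
      moreover have "(r [^] (p ^ e)) [^] p = r [^] (p ^ (1 + e))" using frob_pow[OF rm(1), of e 1] by (simp add: add.commute)
      ultimately show "\<phi> l ((r [^] (p ^ e)) \<odot>\<^bsub>M\<^esub> m) = (r [^] (p ^ (1 + e))) \<odot>\<^bsub>M\<^esub> \<phi> l m" by simp
    qed (use p_linear_onD(1,2)[OF \<phi>] in simp_all)
    have "A \<subseteq> ?K"
    proof
      fix a assume a: "a \<in> A"
      then have "\<phi> l a \<in> ?B" using l by (auto intro!: rev_image_eqI[of "(l, a)"])
      then have "\<phi> l a \<in> ?W" by (rule qhull_base)
      then show "a \<in> ?K" using a A(3) by blast
    qed
    then have "mhull e A \<subseteq> ?K" by (rule qhull_least[OF K])
    then show ?thesis using A(4) m by auto
  qed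
  \<comment> \<open>W is closed under p^(1+e)-th powers only, but r^p \<phi>(m) = \<phi>(r m) is
    again a value, so all p-th power multiples of values stay in W.\<close>
  let ?U = "{z \<in> carrier M. \<forall>r\<in>carrier R. (r [^] (p ^ 1)) \<odot>\<^bsub>M\<^esub> z \<in> ?W}"
  have U: "msub 1 ?U" by (rule msub_saturate[OF W])
  have "{\<phi> l m' |l m'. l < \<Gamma> \<and> m' \<in> carrier M} \<subseteq> ?U"
  proof
    fix z assume "z \<in> {\<phi> l m' |l m'. l < \<Gamma> \<and> m' \<in> carrier M}"
    then obtain l m where lm: "l < \<Gamma>" "m \<in> carrier M" "z = \<phi> l m" by blast
    have "(r [^] (p ^ 1)) \<odot>\<^bsub>M\<^esub> z \<in> ?W" if r: "r \<in> carrier R" for r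
      using p_linear_onD(3)[OF \<phi> r lm(2), of l] \<phi>W[OF lm(1), of "r \<odot>\<^bsub>M\<^esub> m"] r lm by simp
    then show "z \<in> ?U" using p_linear_onD(1)[OF \<phi> lm(2)] lm(3) by simp
  qed
  then have HU: "mhull 1 {\<phi> l m' |l m'. l < \<Gamma> \<and> m' \<in> carrier M} \<subseteq> ?U" by (rule qhull_least[OF U])
  have JW: "r \<odot>\<^bsub>M\<^esub> m \<in> ?W" if "r \<in> J" "m \<in> carrier M" for r m
    using subsetD[OF HU J(2)[OF that]] by (rule msub_saturateD)
  obtain C where C: "finite C" "card C \<le> card A0 * n" "C \<subseteq> carrier M" "carrier M \<subseteq> mhull (1 + e) (?W \<union> C)"
    using module_gens_quotient[OF A0 J(1) n W JW] by blast
  have fB: "finite ?B" using A(1) by simp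
  have "carrier M \<subseteq> mhull (1 + e) (?B \<union> C)" using C(4) qhull_qhull_Un[OF Bc C(3)] by simp
  moreover have "card (?B \<union> C) \<le> \<Gamma> * g + card A0 * n"
  proof -
    have "card ?B \<le> card ({..<\<Gamma>} \<times> A)" by (rule card_image_le) (use A in simp)
    also have "\<dots> \<le> \<Gamma> * g" using A by (simp add: card_cartesian_product)
    finally show ?thesis using card_Un_le[of ?B C] C(2) by linarith
  qed
  ultimately show ?thesis unfolding qgen_def using fB C Bc by (intro exI[of _ "?B \<union> C"]) simp
qed

end

subsection \<open>The limit\<close>

text \<open>Because p >= 2, the term C / p^e is at least 2 C / p^(e+1): one half pays for the error
  of the recurrence, the other is the next correction term. So a + C / p^e decreases and has the
  same limit as a.\<close>

lemma almost_decreasing_limit: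
  fixes a :: "nat \<Rightarrow> real" and p :: nat
  assumes a: "\<And>e. 0 \<le> a e" and rec: "\<And>e. a (Suc e) \<le> a e + C / real p ^ Suc e" and p: "p \<ge> 2" and C: "C \<ge> 0"
  shows "convergent a" "0 \<le> lim a" "lim a \<le> a e + C / real p ^ e"
proof -
  define b where "b e = a e + C / real p ^ e" for e
  have "b (Suc e) \<le> b e" for e
  proof -
    have "2 * (C / real p ^ Suc e) \<le> real p * (C / real p ^ Suc e)"
      using p C by (intro mult_right_mono) auto
    also have "\<dots> = C / real p ^ e" using p by simp
    finally show ?thesis unfolding b_def using rec[of e] by linarith
  qed
  then have dec: "decseq b" by (simp add: decseq_Suc_iff)
  have b0: "0 \<le> b e" for e unfolding b_def using a[of e] C by simp
  obtain L where L: "b \<longlonglongrightarrow> L" "\<And>e. L \<le> b e" using decseq_convergent[OF dec, of 0] b0 by blast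
  have "(\<lambda>e. C * (1 / real p) ^ e) \<longlonglongrightarrow> C * 0"
    by (intro tendsto_mult tendsto_const LIMSEQ_power_zero) (use p in simp)
  then have "(\<lambda>e. C / real p ^ e) \<longlonglongrightarrow> 0" by (simp add: power_divide)
  from tendsto_diff[OF L(1) this] have lim: "a \<longlonglongrightarrow> L" by (simp add: b_def)
  then show "convergent a" by (rule convergentI)
  have "lim a = L" using lim by (rule limI)
  moreover have "0 \<le> L" by (rule LIMSEQ_le_const[OF lim]) (use a in blast)
  ultimately show "0 \<le> lim a" "lim a \<le> a e + C / real p ^ e" using L(2)[of e] by (simp_all add: b_def)
qed

lemma almost_decreasing_limit_shift:
  fixes a :: "nat \<Rightarrow> real" and p :: nat
  assumes a: "\<And>e. 0 \<le> a e" and rec: "\<And>e. e \<ge> k \<Longrightarrow> a (Suc e) \<le> a e + C / real p ^ Suc e" and p: "p \<ge> 2" and C: "C \<ge> 0"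
  shows "convergent a \<and> (\<exists>K. \<forall>e. lim a \<le> a e + K / real p ^ e)"
proof -
  define b where "b e = a (e + k)" for e
  have b: "convergent b" "0 \<le> lim b" "lim b \<le> b e + C / real p ^ e" for e
  proof -
    have "b (Suc e) \<le> b e + C / real p ^ Suc e" for e
    proof -
      have "C / real p ^ Suc (e + k) \<le> C / real p ^ Suc e"
        by (rule divide_left_mono) (use p C in \<open>auto intro!: power_increasing\<close>)
      then show ?thesis using rec[of "e + k"] by (simp add: b_def)
    qed
    from almost_decreasing_limit[of b C p, OF _ this p C] a
    show "convergent b" "0 \<le> lim b" "lim b \<le> b e + C / real p ^ e" by (simp_all add: b_def)
  qed
  obtain L where "b \<longlonglongrightarrow> L" using b(1) by (auto simp: convergent_def)
  moreover from this have "lim b = L" by (rule limI)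
  ultimately have aL: "a \<longlonglongrightarrow> lim b" unfolding b_def by (simp add: LIMSEQ_ignore_initial_segment LIMSEQ_offset)
  then have la: "lim a = lim b" by (rule limI)
  \<comment> \<open>The factor p^k undoes the index shift. The summand \<open>lim b\<close> makes
    the bound hold for e < k too, where no recurrence is available: there K / p^e is already at
    least the limit.\<close>
  define K where "K = (C + lim b) * real p ^ k"
  have "lim a \<le> a e + K / real p ^ e" for e
  proof (cases "e \<ge> k")
    case True
    then obtain j where j: "e = j + k" by (metis add.commute le_iff_add)
    have "K / real p ^ e = (C + lim b) / real p ^ j" using p by (simp add: K_def j power_add)
    moreover have "C / real p ^ j \<le> (C + lim b) / real p ^ j" using b(2) p by (intro divide_right_mono) auto
    ultimately show ?thesis using b(3)[of j] la by (simp add: b_def j)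
  next
    case False
    then have "real p ^ e \<le> real p ^ k" using p by (intro power_increasing) auto
    then have "1 \<le> real p ^ k / real p ^ e" using p by (simp add: le_divide_eq)
    then have "(C + lim b) * 1 \<le> (C + lim b) * (real p ^ k / real p ^ e)" using C b(2) by (intro mult_left_mono) auto
    then have "lim b \<le> K / real p ^ e" using C by (simp add: K_def)
    then show ?thesis using a[of e] la by linarith
  qed
  then show ?thesis using aL by (auto intro: convergentI)
qed

section \<open>Minimal primes and the maximal rank\<close>

context F_finite_ring
begin

lemma prime_contains_factor:
  assumes P: "primeideal P R" and Ps: "\<And>P'. P' \<in> set Ps \<Longrightarrow> P' \<subseteq> carrier R"
    and prod: "\<And>xs. list_all2 (\<in>) xs Ps \<Longrightarrow> prodl xs \<in> P"
  shows "\<exists>P'\<in>set Ps. P' \<subseteq> P"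
  using Ps prod
proof (induction Ps)
  case Nil
  have "\<one> \<notin> P" using one_notin_prime[OF P] by simp
  then show ?case using Nil(2)[of "[]"] by simp
next
  case (Cons P' Ps)
  show ?case
  proof (cases "P' \<subseteq> P")
    case False
    then obtain t where t: "t \<in> P'" "t \<notin> P" "t \<in> carrier R" using Cons.prems(1)[of P'] by auto
    have "prodl xs \<in> P" if xs: "list_all2 (\<in>) xs Ps" for xs
    proof -
      have "set xs \<subseteq> carrier R"
      proof
        fix z assume "z \<in> set xs"
        then obtain n where "n < length xs" "z = xs ! n" by (auto simp: in_set_conv_nth)
        then have "Ps ! n \<in> set (P' # Ps)" "z \<in> Ps ! n" using xs by (auto simp: list_all2_conv_all_nth)
        then show "z \<in> carrier R" using Cons.prems(1) by blast
      qed
      then have c: "prodl xs \<in> carrier R" by simp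
      have "prodl (t # xs) \<in> P" using xs t by (intro Cons.prems(2)) simp
      then show ?thesis using primeideal.I_prime[OF P t(3) c] t(2) by simp
    qed
    then show ?thesis using Cons.IH Cons.prems(1) by auto
  qed simp
qed

text \<open>Everything is read off a list of primes with product zero. Each prime contains a member
  of the list, so the minimal primes are minimal members; an element of all of them lies in every
  listed prime, and its power of exponent the length of the list vanishes.\<close>

lemma min_primes_props:
  shows "finite (min_primes R)" "min_primes R \<noteq> {}"
    "primeideal Q R \<Longrightarrow> \<exists>P\<in>min_primes R. P \<subseteq> Q"
    "\<exists>e0. \<forall>r\<in>carrier R. (\<forall>P\<in>min_primes R. r \<in> P) \<longrightarrow> r [^] (p ^ e0) = \<zero>"
proof -
  obtain Ps where Ps: "\<And>P. P \<in> set Ps \<Longrightarrow> primeideal P R \<and> {\<zero>} \<subseteq> P"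
    "\<And>xs. list_all2 (\<in>) xs Ps \<Longrightarrow> prodl xs \<in> {\<zero>}" using ideal_contains_prime_product[OF zeroideal] by blast
  have Psc: "P \<subseteq> carrier R" if "P \<in> set Ps" for P
    using Ps(1)[OF that] by (simp add: primeideal.axioms ideal_in_carrier)
  have contains: "\<exists>P\<in>set Ps. P \<subseteq> Q" if Q: "primeideal Q R" for Q
  proof (rule prime_contains_factor[OF Q Psc])
    have "\<zero> \<in> Q" using fsubD(2)[OF ideal_fsub[of Q 0]] Q by (simp add: primeideal.axioms)
    then show "prodl xs \<in> Q" if "list_all2 (\<in>) xs Ps" for xs using Ps(2)[OF that] by simp
  qed
  have "min_primes R \<subseteq> set Ps"
  proof
    fix P assume "P \<in> min_primes R"
    then have P: "primeideal P R" "\<And>Q. primeideal Q R \<Longrightarrow> Q \<subseteq> P \<Longrightarrow> Q = P" by (auto simp: min_primes_def)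
    from contains[OF P(1)] obtain P' where "P' \<in> set Ps" "P' \<subseteq> P" by blast
    then show "P \<in> set Ps" using P(2)[of P'] Ps(1)[of P'] by auto
  qed
  then show "finite (min_primes R)" by (rule finite_subset) simp
  have cov: "\<exists>P\<in>min_primes R. P \<subseteq> Q" if Q: "primeideal Q R" for Q
  proof -
    let ?S = "{P \<in> set Ps. P \<subseteq> Q}"
    have "finite ?S" "?S \<noteq> {}" using contains[OF Q] by auto
    from finite_has_minimal[OF this] obtain P where P: "P \<in> ?S" "\<forall>P'\<in>?S. P' \<subseteq> P \<longrightarrow> P = P'"
      by (rule bexE)
    have "P' = P" if P': "primeideal P' R" "P' \<subseteq> P" for P'
    proof -
      from contains[OF P'(1)] obtain P'' where P'': "P'' \<in> set Ps" "P'' \<subseteq> P'" by blast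
      then have "P'' \<in> ?S" "P'' \<subseteq> P" using P' P(1) by auto
      then have "P = P''" using bspec[OF P(2), of P''] by simp
      then show ?thesis using P'' P' by blast
    qed
    then have "P \<in> min_primes R" using Ps(1) P(1) by (auto simp: min_primes_def)
    then show ?thesis using P(1) by blast
  qed
  show "primeideal Q R \<Longrightarrow> \<exists>P\<in>min_primes R. P \<subseteq> Q" by (rule cov)
  \<comment> \<open>The empty product would give 1 = 0.\<close>
  have "Ps \<noteq> []" using Ps(2)[of "[]"] char_one_not_zero by auto
  then obtain Q where "Q \<in> set Ps" by (cases Ps) auto
  then show "min_primes R \<noteq> {}" using cov[of Q] Ps(1) by blast
  have "r [^] (p ^ length Ps) = \<zero>" if r: "r \<in> carrier R" "\<forall>P\<in>min_primes R. r \<in> P" for r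
  proof -
    let ?n = "length Ps"
    have "r \<in> P" if "P \<in> set Ps" for P using cov[of P] Ps(1)[OF that] r(2) by blast
    then have "list_all2 (\<in>) (replicate ?n r) Ps" by (simp add: list_all2_conv_all_nth)
    then have "prodl (replicate ?n r) = \<zero>" using Ps(2) by blast
    moreover have "prodl (replicate n r) = r [^] n" for n using r(1) by (induction n) (auto simp: m_comm)
    ultimately have z: "r [^] ?n = \<zero>" by simp
    \<comment> \<open>Any power of p above the length of the list serves; n < 2^n <= p^n provides a
      uniform one.\<close>
    have "?n < 2 ^ ?n" by (rule less_exp)
    also have "2 ^ ?n \<le> p ^ ?n" using p_gt_1 by (intro power_mono) auto
    finally have "p ^ ?n = ?n + (p ^ ?n - ?n)" by simp
    then have "r [^] (p ^ ?n) = r [^] ?n \<otimes> r [^] (p ^ ?n - ?n)" using r(1) by (metis nat_pow_mult)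
    then show ?thesis using z r(1) by simp
  qed
  then show "\<exists>e0. \<forall>r\<in>carrier R. (\<forall>P\<in>min_primes R. r \<in> P) \<longrightarrow> r [^] (p ^ e0) = \<zero>" by blast
qed

text \<open>No other minimal prime is contained in P, so each contributes an element outside P;
  their product is outside P by primality.\<close>

lemma min_prime_separator:
  assumes P: "P \<in> min_primes R"
  shows "\<exists>x\<in>carrier R - P. \<forall>P'\<in>min_primes R. P' \<noteq> P \<longrightarrow> x \<in> P'"
proof -
  have pP: "primeideal P R" using P by (simp add: min_primes_def)
  have "\<exists>x\<in>carrier R - P. \<forall>P'\<in>S. x \<in> P'" if "finite S" "S \<subseteq> min_primes R - {P}" for S
    using that
  proof (induction S rule: finite_induct)
    case empty
    have "\<one> \<in> carrier R - P" using one_notin_prime[OF pP] by simp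
    then show ?case by blast
  next
    case (insert Q S)
    then obtain x where x: "x \<in> carrier R - P" "\<And>P'. P' \<in> S \<Longrightarrow> x \<in> P'" by auto
    have Q: "primeideal Q R" "Q \<noteq> P" using insert.prems by (auto simp: min_primes_def)
    then have "\<not> Q \<subseteq> P" using P by (auto simp: min_primes_def)
    then obtain t where t: "t \<in> Q" "t \<notin> P" by blast
    have QI: "ideal Q R" using Q by (simp add: primeideal.axioms)
    have tc: "t \<in> carrier R" using t ideal_in_carrier[OF QI] by blast
    have "x \<otimes> t \<in> Q" using ideal_mult_left[OF QI _ t(1)] x(1) by simp
    moreover have "x \<otimes> t \<in> P'" if "P' \<in> S" for P'
    proof -
      have "ideal P' R" using that insert.prems by (auto simp: min_primes_def primeideal.axioms)
      then show ?thesis by (rule ideal_mult_right[OF _ tc x(2)[OF that]])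
    qed
    moreover have "x \<otimes> t \<in> carrier R - P" using prod_notin_prime[OF pP x(1)] t tc by simp
    ultimately show ?case by blast
  qed
  from this[of "min_primes R - {P}"] min_primes_props(1) show ?thesis by blast
qed

text \<open>This is p^\<gamma>, as \<open>powr_frob_gamma\<close> confirms.\<close>

definition max_rank :: nat where
  "max_rank = Max (rank ` min_primes R)"

lemma rank_le_max_rank: "P \<in> min_primes R \<Longrightarrow> rank P \<le> max_rank"
  unfolding max_rank_def using min_primes_props(1) by (intro Max_ge) auto

lemma max_rank_pos: "1 \<le> max_rank"
proof -
  obtain P where P: "P \<in> min_primes R" using min_primes_props(2) by blast
  then have "1 \<le> rank P" using rank_pos by (simp add: min_primes_def)
  then show ?thesis using rank_le_max_rank[OF P] by linarith
qed

text \<open>A prime above J lies strictly above some minimal prime, so the drop of the rank gains a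
  factor p. This is the origin of the error C / p^e.\<close>

lemma small_growth:
  assumes J: "ideal J R" and nJ: "\<And>P. P \<in> min_primes R \<Longrightarrow> \<not> J \<subseteq> P"
  shows "grows J (real max_rank / real p)"
proof (rule ideal_growth[OF J])
  fix Q assume Q: "primeideal Q R" "J \<subseteq> Q"
  obtain P where P: "P \<in> min_primes R" "P \<subseteq> Q" using min_primes_props(3)[OF Q(1)] by blast
  then have "P \<subset> Q" "primeideal P R" using nJ[OF P(1)] Q(2) by (auto simp: min_primes_def)
  then have "p * rank Q \<le> rank P" using rank_drop Q(1) by blast
  then have "p * rank Q \<le> max_rank" using rank_le_max_rank[OF P(1)] by linarith
  then have "real (p * rank Q) \<le> real max_rank" by (rule of_nat_mono)
  then show "real (rank Q) \<le> real max_rank / real p" using p_gt_1 by (simp add: le_divide_eq mult.commute)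
qed simp

lemma ex_gens_all: "\<exists>n. gens e {\<zero>} n"
proof -
  obtain G where "\<And>Q. primeideal Q R \<Longrightarrow> rank Q \<le> G" using rank_bounded by blast
  then have "grows {\<zero>} (real G)" by (intro ideal_growth[OF zeroideal]) simp_all
  then show ?thesis unfolding grows_def by blast
qed

end

section \<open>Iterated push-forwards and the recurrence for M\<close>

lemma (in frob_module) qsub_frob_push:
  "qsub R (p ^ e) (frob_push R p f M) U \<longleftrightarrow> qsub R (p ^ (e + f)) M U"
  by (auto simp: qsub_def frob_pow)

lemma (in frob_module) qgen_frob_push:
  "qgen R (p ^ e) (frob_push R p f M) {} n \<longleftrightarrow> qgen R (p ^ (e + f)) M {} n"
  by (simp add: qgen_def qhull_def qsub_frob_push)

context F_finite_module
begin

lemma ex_qgen: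
  assumes A0: "finite A0" "A0 \<subseteq> carrier M" "carrier M \<subseteq> mhull 0 A0"
  shows "\<exists>n. qgen R (p ^ e) M {} n"
proof -
  obtain n where n: "gens e {\<zero>} n" using ex_gens_all by blast
  have W: "msub e {\<zero>\<^bsub>M\<^esub>}" by (rule qsubI) auto
  obtain C where C: "finite C" "C \<subseteq> carrier M" "carrier M \<subseteq> mhull e ({\<zero>\<^bsub>M\<^esub>} \<union> C)"
    using module_gens_quotient[OF A0 _ n W] by auto
  have H: "msub e (mhull e C)" by (rule qsub_qhull[OF C(2)])
  have "mhull e ({\<zero>\<^bsub>M\<^esub>} \<union> C) \<subseteq> mhull e C"
    by (rule qhull_least[OF H]) (use qsubD(2)[OF H] qhull_superset[of C R "p ^ e" M] in simp)
  then show ?thesis unfolding qgen_def using C by (intro exI[of _ "card C"] exI[of _ C]) simp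
qed

text \<open>The hypothesis asks that the nilradical annihilate M, not that R be reduced, since this
  is what a push-forward can achieve without changing the ring. The constant C must serve all e and
  g.\<close>

lemma reduced_recurrence:
  assumes A0: "finite A0" "A0 \<subseteq> carrier M" "carrier M \<subseteq> mhull 0 A0"
    and red: "\<And>r m. r \<in> carrier R \<Longrightarrow> (\<And>P. P \<in> min_primes R \<Longrightarrow> r \<in> P) \<Longrightarrow> m \<in> carrier M \<Longrightarrow> r \<odot>\<^bsub>M\<^esub> m = \<zero>\<^bsub>M\<^esub>"
  shows "\<exists>C\<ge>0. \<forall>e g. qgen R (p ^ e) M {} g \<longrightarrow>
    (\<exists>n. real n \<le> C * (real max_rank / real p) ^ Suc e \<and> qgen R (p ^ Suc e) M {} (max_rank * g + n))"
proof -
  let ?PP = "min_primes R"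
  have "\<exists>x. \<forall>P\<in>?PP. x P \<in> carrier R - P \<and> (\<forall>P'\<in>?PP. P' \<noteq> P \<longrightarrow> x P \<in> P')"
    using min_prime_separator by (intro bchoice) blast
  then obtain x where x: "\<And>P. P \<in> ?PP \<Longrightarrow> x P \<in> carrier R - P"
    "\<And>P P'. P \<in> ?PP \<Longrightarrow> P' \<in> ?PP \<Longrightarrow> P \<noteq> P' \<Longrightarrow> x P \<in> P'" by blast
  have prime: "primeideal P R" if "P \<in> ?PP" for P using that by (simp add: min_primes_def)
  have idl: "ideal P R" if "P \<in> ?PP" for P using prime[OF that] by (simp add: primeideal.axioms)
  have xP: "x P \<odot>\<^bsub>M\<^esub> (u \<odot>\<^bsub>M\<^esub> m) = \<zero>\<^bsub>M\<^esub>" if P: "P \<in> ?PP" and u: "u \<in> P" and m: "m \<in> carrier M" for P u m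
  proof -
    have c: "x P \<in> carrier R" "u \<in> carrier R" using x(1)[OF P] u ideal_in_carrier[OF idl[OF P]] by auto
    \<comment> \<open>The product lies in every minimal prime, by u for P and by \<open>x P\<close>
      for the others, hence it is nilpotent and acts as zero.\<close>
    have "x P \<otimes> u \<in> P'" if P': "P' \<in> ?PP" for P'
    proof (cases "P' = P")
      case True
      then show ?thesis using ideal_mult_left[OF idl[OF P] c(1) u] by simp
    next
      case False
      then show ?thesis using ideal_mult_right[OF idl[OF P'] c(2) x(2)[OF P P']] by simp
    qed
    then have "(x P \<otimes> u) \<odot>\<^bsub>M\<^esub> m = \<zero>\<^bsub>M\<^esub>" using red c m by simp
    then show ?thesis using c m by (simp add: smult_assoc1)
  qed
  obtain \<phi> :: "nat \<Rightarrow> 'c \<Rightarrow> 'c" where \<phi>0: "(\<forall>l. p_linear_on (\<phi> l) (carrier M)) \<and>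
    (\<forall>l. \<forall>P\<in>?PP - ?PP. \<forall>m\<in>carrier M. \<phi> l (x P \<odot>\<^bsub>M\<^esub> m) = \<zero>\<^bsub>M\<^esub>) \<and>
    (\<forall>P\<in>?PP. \<exists>v\<in>carrier R - P. \<forall>m\<in>carrier M. v \<odot>\<^bsub>M\<^esub> m \<in>
      mhull 1 {\<phi> l (x P \<odot>\<^bsub>M\<^esub> m') |l m'. l < max_rank \<and> m' \<in> carrier M})"
    using phi_exists[of ?PP x, OF prime min_primes_props(1) x xP A0 rank_le_max_rank subset_refl] by (rule exE)
  have \<phi>: "\<And>l. p_linear_on (\<phi> l) (carrier M)" using \<phi>0 by blast
  let ?G = "{\<phi> l m' |l m'. l < max_rank \<and> m' \<in> carrier M}"
  have Gc: "?G \<subseteq> carrier M" using p_linear_onD(1)[OF \<phi>] by auto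
  let ?H = "mhull 1 ?G"
  have H: "msub 1 ?H" by (rule qsub_qhull[OF Gc])
  have v: "\<exists>v\<in>carrier R - P. \<forall>m\<in>carrier M. v \<odot>\<^bsub>M\<^esub> m \<in> ?H" if P: "P \<in> ?PP" for P
  proof -
    have "{\<phi> l (x P \<odot>\<^bsub>M\<^esub> m') |l m'. l < max_rank \<and> m' \<in> carrier M} \<subseteq> ?G"
    proof
      fix z assume "z \<in> {\<phi> l (x P \<odot>\<^bsub>M\<^esub> m') |l m'. l < max_rank \<and> m' \<in> carrier M}"
      then obtain l m' where z: "z = \<phi> l (x P \<odot>\<^bsub>M\<^esub> m')" "l < max_rank" "m' \<in> carrier M" by blast
      have "x P \<odot>\<^bsub>M\<^esub> m' \<in> carrier M" using x(1)[OF P] z(3) by simp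
      then show "z \<in> ?G" using z(1,2) by blast
    qed
    from qhull_mono[OF this, of R "p ^ 1" M] show ?thesis
      using bspec[OF conjunct2[OF conjunct2[OF \<phi>0]] P] by blast
  qed
  \<comment> \<open>The annihilator of M modulo the span of the images. Each minimal prime P misses
    some v in it, so \<open>small_growth\<close> applies.\<close>
  let ?J = "{r \<in> carrier R. \<forall>m\<in>carrier M. r \<odot>\<^bsub>M\<^esub> m \<in> ?H}"
  have "fsub 0 ?J"
  proof (rule fsubI)
    note h = qsubD[OF H]
    show "\<zero> \<in> ?J" using h(2) by simp
    show "r \<oplus> s \<in> ?J" if "r \<in> ?J" "s \<in> ?J" for r s using that h(3) by (simp add: smult_l_distr)
    show "(r [^] (p ^ 0)) \<otimes> s \<in> ?J" if "r \<in> carrier R" "s \<in> ?J" for r s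
    proof -
      have "(r \<otimes> s) \<odot>\<^bsub>M\<^esub> m = s \<odot>\<^bsub>M\<^esub> (r \<odot>\<^bsub>M\<^esub> m)" if "m \<in> carrier M" for m
        using that \<open>r \<in> carrier R\<close> \<open>s \<in> ?J\<close> by (simp add: smult_assoc1[symmetric] m_comm)
      then show ?thesis using that by simp
    qed
  qed auto
  then have J: "ideal ?J R" by (rule fsub0_ideal)
  have "grows ?J (real max_rank / real p)"
  proof (rule small_growth[OF J])
    show "\<not> ?J \<subseteq> P" if P: "P \<in> ?PP" for P using v[OF P] by blast
  qed
  then obtain C where C: "C \<ge> 0" "\<And>e. \<exists>n. gens e ?J n \<and> real n \<le> C * (real max_rank / real p) ^ e"
    unfolding grows_def by blast
  let ?C = "real (card A0) * C"
  have "\<exists>n. real n \<le> ?C * (real max_rank / real p) ^ Suc e \<and> qgen R (p ^ Suc e) M {} (max_rank * g + n)"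
    if g: "qgen R (p ^ e) M {} g" for e g
  proof -
    obtain n where n: "gens (Suc e) ?J n" "real n \<le> C * (real max_rank / real p) ^ Suc e" using C(2) by blast
    have "qgen R (p ^ (1 + e)) M {} (max_rank * g + card A0 * n)"
      by (rule phi_step[OF \<phi> A0 _ _ g]) (use n(1) in auto)
    moreover have "real (card A0 * n) \<le> ?C * (real max_rank / real p) ^ Suc e"
      using mult_left_mono[OF n(2), of "real (card A0)"] by (simp add: mult.assoc)
    ultimately show ?thesis by (intro exI[of _ "card A0 * n"]) simp
  qed
  then show ?thesis using C(1) by (intro exI[of _ ?C]) simp
qed

lemma F_finite_module_frob_push: "F_finite_module R p (frob_push R p e M)"
  by (intro F_finite_module.intro F_finite_ring_axioms frob_module.intro frob_axioms frob_push_module)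

text \<open>Passing from \<open>M\<close> to \<open>F\<^sup>k\<^sub>*M\<close> for large \<open>k\<close> makes the nilradical act as zero and only shifts the sequence.\<close>

lemma hilbert_kunz_limit:
  assumes A0: "finite A0" "A0 \<subseteq> carrier M" "carrier M \<subseteq> mhull 0 A0"
  defines "a \<equiv> \<lambda>e. real (min_gens R (frob_push R p e M)) / real max_rank ^ e"
  shows "convergent a \<and> (\<exists>C. \<forall>e. lim a \<le> a e + C / real p ^ e)"
proof -
  let ?\<mu> = "\<lambda>e. min_gens R (frob_push R p e M)"
  have \<mu>: "qgen R (p ^ e) M {} (?\<mu> e)" for e
    using ex_qgen[OF A0, of e] qgen_min_gens by blast
  obtain e0 where e0: "\<And>r. r \<in> carrier R \<Longrightarrow> (\<And>P. P \<in> min_primes R \<Longrightarrow> r \<in> P) \<Longrightarrow> r [^] (p ^ e0) = \<zero>"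
    using min_primes_props(4) by blast
  interpret N: F_finite_module R p "frob_push R p e0 M" by (rule F_finite_module_frob_push)
  obtain B where B: "finite B" "B \<subseteq> carrier M" "carrier M \<subseteq> mhull e0 B"
    using \<mu>[of e0] by (auto simp: qgen_def)
  have "N.mhull 0 B = mhull e0 B" unfolding qhull_def by (simp only: qsub_frob_push add_0)
  then have "carrier (frob_push R p e0 M) \<subseteq> N.mhull 0 B" using B(3) by simp
  moreover have "r \<odot>\<^bsub>frob_push R p e0 M\<^esub> m = \<zero>\<^bsub>frob_push R p e0 M\<^esub>"
    if "r \<in> carrier R" "\<And>P. P \<in> min_primes R \<Longrightarrow> r \<in> P" "m \<in> carrier (frob_push R p e0 M)" for r m
    using e0[OF that(1,2)] that(3) by simp
  ultimately obtain C where C: "C \<ge> 0" "\<And>e g. qgen R (p ^ e) (frob_push R p e0 M) {} g \<Longrightarrow>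
    \<exists>n. real n \<le> C * (real max_rank / real p) ^ Suc e \<and> qgen R (p ^ Suc e) (frob_push R p e0 M) {} (max_rank * g + n)"
    using N.reduced_recurrence[of B] B by auto
  have mr: "real max_rank > 0" using max_rank_pos by simp
  have p0: "real p > 0" using p_gt_1 by simp
  \<comment> \<open>The recurrence for the push-forward at index k = e - e0 has error C
    (\<open>max_rank\<close> / p)^(k+1); dividing by \<open>max_rank\<close>^(e+1) leaves this
    constant over p^(e+1).\<close>
  define D where "D = C * (real p / real max_rank) ^ e0"
  have D: "D \<ge> 0" unfolding D_def using C(1) mr p0 by simp
  have "a (Suc e) \<le> a e + D / real p ^ Suc e" if e: "e \<ge> e0" for e
  proof -
    obtain k where k: "e = k + e0" using e by (metis add.commute le_iff_add)
    have "qgen R (p ^ k) (frob_push R p e0 M) {} (?\<mu> e)" using \<mu>[of e] by (simp add: qgen_frob_push k)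
    from C(2)[OF this] obtain n where n: "real n \<le> C * (real max_rank / real p) ^ Suc k"
      "qgen R (p ^ Suc k) (frob_push R p e0 M) {} (max_rank * ?\<mu> e + n)" by blast
    have "qgen R (p ^ Suc e) M {} (max_rank * ?\<mu> e + n)" using n(2) unfolding qgen_frob_push by (simp add: k)
    then have "?\<mu> (Suc e) \<le> max_rank * ?\<mu> e + n" by (rule min_gens_le)
    then have "real (?\<mu> (Suc e)) \<le> real (max_rank * ?\<mu> e + n)" by (rule of_nat_mono)
    also have "\<dots> \<le> real max_rank * real (?\<mu> e) + C * (real max_rank / real p) ^ Suc k" using n(1) by simp
    finally have "a (Suc e) \<le> (real max_rank * real (?\<mu> e) + C * (real max_rank / real p) ^ Suc k) / real max_rank ^ Suc e"
      unfolding a_def using mr by (intro divide_right_mono) auto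
    also have "\<dots> = a e + C * (real max_rank / real p) ^ Suc k / real max_rank ^ Suc e"
      using mr by (simp add: a_def add_divide_distrib)
    also have "C * (real max_rank / real p) ^ Suc k / real max_rank ^ Suc e = D / real p ^ Suc e"
      using mr p0 by (simp add: D_def k power_add power_divide field_simps)
    finally show ?thesis .
  qed
  moreover have "0 \<le> a e" for e by (simp add: a_def)
  ultimately show ?thesis using almost_decreasing_limit_shift[of a e0 D p] D p_gt_1 by auto
qed

end

subsection \<open>Localizations and residue fields\<close>

locale mult_set = cring R for R (structure) +
  fixes S :: "'a set"
  assumes S_carrier: "S \<subseteq> carrier R" and S_one: "\<one> \<in> S" and S_mult: "\<And>s t. s \<in> S \<Longrightarrow> t \<in> S \<Longrightarrow> s \<otimes> t \<in> S"

context mult_set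
begin

abbreviation frac :: "'a \<Rightarrow> 'a \<Rightarrow> ('a \<times> 'a) set" where
  "frac a s \<equiv> loc_frac R S a s"

lemma S_c: "s \<in> S \<Longrightarrow> s \<in> carrier R"
  using S_carrier by blast

lemma loc_rel_iff: "((a, s), (b, t)) \<in> loc_rel R S \<longleftrightarrow> a \<in> carrier R \<and> b \<in> carrier R \<and> s \<in> S \<and> t \<in> S \<and>
     (\<exists>u\<in>S. u \<otimes> (t \<otimes> a) = u \<otimes> (s \<otimes> b))"
  by (simp add: loc_rel_def)

lemma equiv_loc_rel: "equiv (carrier R \<times> S) (loc_rel R S)"
proof (rule equivI)
  show "loc_rel R S \<subseteq> (carrier R \<times> S) \<times> (carrier R \<times> S)" by (auto simp: loc_rel_def)
  show "refl_on (carrier R \<times> S) (loc_rel R S)"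
    using S_one by (auto simp: refl_on_def loc_rel_def intro!: bexI[of _ \<one>])
  show "sym (loc_rel R S)"
  proof (rule symI)
    fix x y assume "(x, y) \<in> loc_rel R S"
    then show "(y, x) \<in> loc_rel R S" by (cases x, cases y) (auto simp: loc_rel_iff intro: sym)
  qed
  show "trans (loc_rel R S)"
  proof (rule transI)
    fix x y z assume xy: "(x, y) \<in> loc_rel R S" and yz: "(y, z) \<in> loc_rel R S"
    obtain a s where x: "x = (a, s)" by (cases x)
    obtain b t where y: "y = (b, t)" by (cases y)
    obtain c w where z: "z = (c, w)" by (cases z)
    obtain u v where uv: "u \<in> S" "v \<in> S" "u \<otimes> (t \<otimes> a) = u \<otimes> (s \<otimes> b)" "v \<otimes> (w \<otimes> b) = v \<otimes> (t \<otimes> c)"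
      using xy yz unfolding x y z loc_rel_iff by blast
    have m: "a \<in> carrier R" "b \<in> carrier R" "c \<in> carrier R" "s \<in> S" "t \<in> S" "w \<in> S"
      using xy yz unfolding x y z loc_rel_iff by blast+
    note c = m(1-3) S_c[OF m(4)] S_c[OF m(5)] S_c[OF m(6)] S_c[OF uv(1)] S_c[OF uv(2)]
    have "(u \<otimes> v \<otimes> t) \<otimes> (w \<otimes> a) = (v \<otimes> w) \<otimes> (u \<otimes> (t \<otimes> a))" using c by (simp add: m_ac)
    also have "\<dots> = (u \<otimes> s) \<otimes> (v \<otimes> (w \<otimes> b))" unfolding uv(3) using c by (simp add: m_ac)
    also have "\<dots> = (u \<otimes> v \<otimes> t) \<otimes> (s \<otimes> c)" unfolding uv(4) using c by (simp add: m_ac)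
    finally show "(x, z) \<in> loc_rel R S" unfolding x z loc_rel_iff
      using m uv(1,2) S_mult[OF S_mult[OF uv(1,2)] m(5)] by blast
  qed
qed

lemma frac_eq_iff:
  assumes "a \<in> carrier R" "b \<in> carrier R" "s \<in> S" "t \<in> S"
  shows "frac a s = frac b t \<longleftrightarrow> (\<exists>u\<in>S. u \<otimes> (t \<otimes> a) = u \<otimes> (s \<otimes> b))"
proof -
  have "frac a s = frac b t \<longleftrightarrow> ((a, s), (b, t)) \<in> loc_rel R S"
    unfolding loc_frac_def by (rule eq_equiv_class_iff[OF equiv_loc_rel]) (use assms in auto)
  then show ?thesis using assms by (simp add: loc_rel_iff)
qed

lemma frac_eqI:
  assumes "a \<in> carrier R" "b \<in> carrier R" "s \<in> S" "t \<in> S" "t \<otimes> a = s \<otimes> b"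
  shows "frac a s = frac b t"
  unfolding frac_eq_iff[OF assms(1-4)] using S_one assms(5) by (intro bexI[of _ \<one>]) simp_all

lemma frac_cancel:
  assumes "a \<in> carrier R" "s \<in> S" "w \<in> S"
  shows "frac (w \<otimes> a) (w \<otimes> s) = frac a s"
  using assms S_c S_mult by (intro frac_eqI) (auto simp: m_ac)

lemma mem_frac:
  assumes "x \<in> frac a s"
  shows "fst x \<in> carrier R" "snd x \<in> S" "frac (fst x) (snd x) = frac a s"
proof -
  obtain b t where x: "x = (b, t)" by (cases x)
  have r: "((a, s), (b, t)) \<in> loc_rel R S" using assms by (simp add: loc_frac_def x)
  then show "fst x \<in> carrier R" "snd x \<in> S" by (simp_all add: loc_rel_iff x)
  show "frac (fst x) (snd x) = frac a s"
    unfolding loc_frac_def using equiv_class_eq[OF equiv_loc_rel r] by (simp add: x)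
qed

lemma frac_self: "a \<in> carrier R \<Longrightarrow> s \<in> S \<Longrightarrow> (a, s) \<in> frac a s"
  unfolding loc_frac_def using equiv_class_self[OF equiv_loc_rel, of "(a, s)"] by simp

text \<open>A union over representatives of a family that does not depend on them is its common
  value, because the classes are nonempty. Both ring operations are evaluated in this way.\<close>

lemma frac_op:
  assumes as: "a \<in> carrier R" "s \<in> S" and bt: "b \<in> carrier R" "t \<in> S"
    and F: "\<And>a' s' b' t'. \<lbrakk>a' \<in> carrier R; s' \<in> S; b' \<in> carrier R; t' \<in> S; frac a' s' = frac a s; frac b' t' = frac b t\<rbrakk>
      \<Longrightarrow> F (a', s') (b', t') = F (a, s) (b, t)"
  shows "(\<Union>x\<in>frac a s. \<Union>y\<in>frac b t. F x y) = F (a, s) (b, t)"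
proof -
  have "F x y = F (a, s) (b, t)" if "x \<in> frac a s" "y \<in> frac b t" for x y
    using F[of "fst x" "snd x" "fst y" "snd y"] mem_frac[OF that(1)] mem_frac[OF that(2)] by simp
  then show ?thesis using frac_self[OF as] frac_self[OF bt] by blast
qed

lemma frac_mult:
  assumes as: "a \<in> carrier R" "s \<in> S" and bt: "b \<in> carrier R" "t \<in> S"
  shows "frac a s \<otimes>\<^bsub>localization R S\<^esub> frac b t = frac (a \<otimes> b) (s \<otimes> t)"
proof -
  have "(\<Union>x\<in>frac a s. \<Union>y\<in>frac b t. frac (fst x \<otimes> fst y) (snd x \<otimes> snd y))
      = frac (fst (a, s) \<otimes> fst (b, t)) (snd (a, s) \<otimes> snd (b, t))"
  proof (rule frac_op[OF as bt])
    fix a' s' b' t' assume h: "a' \<in> carrier R" "s' \<in> S" "b' \<in> carrier R" "t' \<in> S" "frac a' s' = frac a s" "frac b' t' = frac b t"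
    obtain u v where uv: "u \<in> S" "u \<otimes> (s \<otimes> a') = u \<otimes> (s' \<otimes> a)" "v \<in> S" "v \<otimes> (t \<otimes> b') = v \<otimes> (t' \<otimes> b)"
      using h(5,6) frac_eq_iff[OF h(1) as(1) h(2) as(2)] frac_eq_iff[OF h(3) bt(1) h(4) bt(2)] by blast
    note c = h(1,3) as(1) bt(1) S_c[OF h(2)] S_c[OF h(4)] S_c[OF as(2)] S_c[OF bt(2)] S_c[OF uv(1)] S_c[OF uv(3)]
    have "(u \<otimes> v) \<otimes> ((s \<otimes> t) \<otimes> (a' \<otimes> b')) = (u \<otimes> (s \<otimes> a')) \<otimes> (v \<otimes> (t \<otimes> b'))" using c by (simp add: m_ac)
    also have "\<dots> = (u \<otimes> v) \<otimes> ((s' \<otimes> t') \<otimes> (a \<otimes> b))" unfolding uv(2,4) using c by (simp add: m_ac)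
    finally have "frac (a' \<otimes> b') (s' \<otimes> t') = frac (a \<otimes> b) (s \<otimes> t)"
      using c S_mult[OF uv(1,3)] S_mult[OF h(2,4)] S_mult[OF as(2) bt(2)] by (subst frac_eq_iff) auto
    then show "frac (fst (a', s') \<otimes> fst (b', t')) (snd (a', s') \<otimes> snd (b', t'))
      = frac (fst (a, s) \<otimes> fst (b, t)) (snd (a, s) \<otimes> snd (b, t))" by simp
  qed
  then show ?thesis by (simp add: localization_def)
qed

lemma frac_add:
  assumes as: "a \<in> carrier R" "s \<in> S" and bt: "b \<in> carrier R" "t \<in> S"
  shows "frac a s \<oplus>\<^bsub>localization R S\<^esub> frac b t = frac ((t \<otimes> a) \<oplus> (s \<otimes> b)) (s \<otimes> t)"
proof -
  have "(\<Union>x\<in>frac a s. \<Union>y\<in>frac b t. frac ((snd y \<otimes> fst x) \<oplus> (snd x \<otimes> fst y)) (snd x \<otimes> snd y))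
      = frac ((snd (b, t) \<otimes> fst (a, s)) \<oplus> (snd (a, s) \<otimes> fst (b, t))) (snd (a, s) \<otimes> snd (b, t))"
  proof (rule frac_op[OF as bt])
    fix a' s' b' t' assume h: "a' \<in> carrier R" "s' \<in> S" "b' \<in> carrier R" "t' \<in> S" "frac a' s' = frac a s" "frac b' t' = frac b t"
    obtain u v where uv: "u \<in> S" "u \<otimes> (s \<otimes> a') = u \<otimes> (s' \<otimes> a)" "v \<in> S" "v \<otimes> (t \<otimes> b') = v \<otimes> (t' \<otimes> b)"
      using h(5,6) frac_eq_iff[OF h(1) as(1) h(2) as(2)] frac_eq_iff[OF h(3) bt(1) h(4) bt(2)] by blast
    note c = h(1,3) as(1) bt(1) S_c[OF h(2)] S_c[OF h(4)] S_c[OF as(2)] S_c[OF bt(2)] S_c[OF uv(1)] S_c[OF uv(3)]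
    have "(u \<otimes> v) \<otimes> ((s \<otimes> t) \<otimes> (t' \<otimes> a' \<oplus> s' \<otimes> b')) = (v \<otimes> t \<otimes> t') \<otimes> (u \<otimes> (s \<otimes> a')) \<oplus> (u \<otimes> s \<otimes> s') \<otimes> (v \<otimes> (t \<otimes> b'))"
      using c by (simp add: r_distr m_ac)
    also have "\<dots> = (u \<otimes> v) \<otimes> ((s' \<otimes> t') \<otimes> (t \<otimes> a \<oplus> s \<otimes> b))" unfolding uv(2,4) using c by (simp add: r_distr m_ac)
    finally have "frac (t' \<otimes> a' \<oplus> s' \<otimes> b') (s' \<otimes> t') = frac (t \<otimes> a \<oplus> s \<otimes> b) (s \<otimes> t)"
      using c S_mult[OF uv(1,3)] S_mult[OF h(2,4)] S_mult[OF as(2) bt(2)] by (subst frac_eq_iff) auto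
    then show "frac ((snd (b', t') \<otimes> fst (a', s')) \<oplus> (snd (a', s') \<otimes> fst (b', t'))) (snd (a', s') \<otimes> snd (b', t'))
      = frac ((snd (b, t) \<otimes> fst (a, s)) \<oplus> (snd (a, s) \<otimes> fst (b, t))) (snd (a, s) \<otimes> snd (b, t))" by simp
  qed
  then show ?thesis by (simp add: localization_def)
qed

lemma loc_carrier: "x \<in> carrier (localization R S) \<longleftrightarrow> (\<exists>a\<in>carrier R. \<exists>s\<in>S. x = frac a s)"
  by (auto simp: localization_def loc_frac_def quotient_def)

lemma frac_closed: "a \<in> carrier R \<Longrightarrow> s \<in> S \<Longrightarrow> frac a s \<in> carrier (localization R S)"
  using loc_carrier by blast

lemma loc_one: "\<one>\<^bsub>localization R S\<^esub> = frac \<one> \<one>" and loc_zero: "\<zero>\<^bsub>localization R S\<^esub> = frac \<zero> \<one>"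
  by (simp_all add: localization_def)

lemma localization_cring: "cring (localization R S)"
proof (rule cringI)
  let ?L = "localization R S"
  note closed = S_c S_mult S_one
  show "abelian_group ?L"
  proof (rule abelian_groupI)
    fix x y assume "x \<in> carrier ?L" "y \<in> carrier ?L"
    then obtain a s b t where h: "a \<in> carrier R" "s \<in> S" "x = frac a s" "b \<in> carrier R" "t \<in> S" "y = frac b t"
      unfolding loc_carrier by blast
    show "x \<oplus>\<^bsub>?L\<^esub> y \<in> carrier ?L" using h closed by (simp add: frac_add frac_closed)
    show "x \<oplus>\<^bsub>?L\<^esub> y = y \<oplus>\<^bsub>?L\<^esub> x" using h closed by (simp add: frac_add a_comm m_comm)
    fix z assume "z \<in> carrier ?L"
    then obtain c w where z: "c \<in> carrier R" "w \<in> S" "z = frac c w" unfolding loc_carrier by blast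
    have "w \<otimes> (t \<otimes> a \<oplus> s \<otimes> b) \<oplus> s \<otimes> t \<otimes> c = t \<otimes> w \<otimes> a \<oplus> s \<otimes> (w \<otimes> b \<oplus> t \<otimes> c)"
      using h z closed by (simp add: r_distr m_ac a_ac)
    then show "x \<oplus>\<^bsub>?L\<^esub> y \<oplus>\<^bsub>?L\<^esub> z = x \<oplus>\<^bsub>?L\<^esub> (y \<oplus>\<^bsub>?L\<^esub> z)" using h z closed by (simp add: frac_add m_assoc)
  next
    show "\<zero>\<^bsub>?L\<^esub> \<in> carrier ?L" unfolding loc_zero by (rule frac_closed) (simp_all add: S_one)
    fix x assume "x \<in> carrier ?L"
    then obtain a s where h: "a \<in> carrier R" "s \<in> S" "x = frac a s" unfolding loc_carrier by blast
    show "\<zero>\<^bsub>?L\<^esub> \<oplus>\<^bsub>?L\<^esub> x = x" unfolding loc_zero using h closed by (simp add: frac_add)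
    have "frac (\<ominus> a) s \<oplus>\<^bsub>?L\<^esub> x = frac (s \<otimes> (\<ominus> a) \<oplus> s \<otimes> a) (s \<otimes> s)" using h by (simp add: frac_add)
    also have "s \<otimes> (\<ominus> a) \<oplus> s \<otimes> a = \<zero>" using h closed by (simp add: r_minus l_neg)
    also have "frac \<zero> (s \<otimes> s) = frac \<zero> \<one>" using h closed by (intro frac_eqI) auto
    finally show "\<exists>y\<in>carrier ?L. y \<oplus>\<^bsub>?L\<^esub> x = \<zero>\<^bsub>?L\<^esub>" unfolding loc_zero using frac_closed h a_inv_closed by blast
  qed
  show "comm_monoid ?L"
  proof (rule comm_monoidI)
    fix x y assume "x \<in> carrier ?L" "y \<in> carrier ?L"
    then obtain a s b t where h: "a \<in> carrier R" "s \<in> S" "x = frac a s" "b \<in> carrier R" "t \<in> S" "y = frac b t"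
      unfolding loc_carrier by blast
    show "x \<otimes>\<^bsub>?L\<^esub> y \<in> carrier ?L" using h closed by (simp add: frac_mult frac_closed)
    show "x \<otimes>\<^bsub>?L\<^esub> y = y \<otimes>\<^bsub>?L\<^esub> x" using h closed by (simp add: frac_mult m_comm)
    fix z assume "z \<in> carrier ?L"
    then obtain c w where z: "c \<in> carrier R" "w \<in> S" "z = frac c w" unfolding loc_carrier by blast
    show "x \<otimes>\<^bsub>?L\<^esub> y \<otimes>\<^bsub>?L\<^esub> z = x \<otimes>\<^bsub>?L\<^esub> (y \<otimes>\<^bsub>?L\<^esub> z)" using h z closed by (simp add: frac_mult m_assoc)
  next
    show "\<one>\<^bsub>?L\<^esub> \<in> carrier ?L" unfolding loc_one by (rule frac_closed) (simp_all add: S_one)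
    fix x assume "x \<in> carrier ?L"
    then obtain a s where h: "a \<in> carrier R" "s \<in> S" "x = frac a s" unfolding loc_carrier by blast
    show "\<one>\<^bsub>?L\<^esub> \<otimes>\<^bsub>?L\<^esub> x = x" unfolding loc_one using h closed by (simp add: frac_mult)
  qed
  fix x y z assume "x \<in> carrier ?L" "y \<in> carrier ?L" "z \<in> carrier ?L"
  then obtain a s b t c w where h: "a \<in> carrier R" "s \<in> S" "x = frac a s" "b \<in> carrier R" "t \<in> S" "y = frac b t"
    "c \<in> carrier R" "w \<in> S" "z = frac c w" unfolding loc_carrier by blast
  have "(x \<oplus>\<^bsub>?L\<^esub> y) \<otimes>\<^bsub>?L\<^esub> z = frac ((t \<otimes> a \<oplus> s \<otimes> b) \<otimes> c) (s \<otimes> t \<otimes> w)"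
    using h closed by (simp add: frac_add frac_mult)
  also have "\<dots> = frac (w \<otimes> ((t \<otimes> a \<oplus> s \<otimes> b) \<otimes> c)) (w \<otimes> (s \<otimes> t \<otimes> w))"
    using h closed by (intro frac_cancel[symmetric]) auto
  also have "w \<otimes> ((t \<otimes> a \<oplus> s \<otimes> b) \<otimes> c) = (t \<otimes> w) \<otimes> (a \<otimes> c) \<oplus> (s \<otimes> w) \<otimes> (b \<otimes> c)"
    using h closed by (simp add: r_distr l_distr m_ac)
  also have "w \<otimes> (s \<otimes> t \<otimes> w) = (s \<otimes> w) \<otimes> (t \<otimes> w)" using h closed by (simp add: m_ac)
  finally show "(x \<oplus>\<^bsub>?L\<^esub> y) \<otimes>\<^bsub>?L\<^esub> z = x \<otimes>\<^bsub>?L\<^esub> z \<oplus>\<^bsub>?L\<^esub> y \<otimes>\<^bsub>?L\<^esub> z"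
    using h closed by (simp add: frac_add frac_mult)
qed

lemma frac_one_hom: "(\<lambda>a. frac a \<one>) \<in> ring_hom R (localization R S)"
  by (rule ring_hom_memI) (auto simp: frac_closed frac_mult frac_add S_one loc_one)

end

section \<open>The residue field and its Frobenius degree\<close>

lemma (in cring) prime_complement_mult_set:
  assumes "primeideal Q R"
  shows "mult_set R (carrier R - Q)"
proof
  interpret Q: primeideal Q R by fact
  show "\<one> \<in> carrier R - Q" by (rule one_notin_prime[OF assms])
  show "s \<otimes> t \<in> carrier R - Q" if "s \<in> carrier R - Q" "t \<in> carrier R - Q" for s t
    using Q.I_prime[of s t] that by auto
qed auto

text \<open>A field with a map from R whose kernel is Q and whose image generates it under
  quotients: these properties determine \<kappa>(Q), and later arguments use nothing else about its
  construction.\<close>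

lemma (in cring) residue_field_props:
  assumes Q: "primeideal Q R"
  shows "field (residue_field R Q) \<and> (\<exists>h\<in>ring_hom R (residue_field R Q).
    (\<forall>a\<in>carrier R. h a = \<zero>\<^bsub>residue_field R Q\<^esub> \<longleftrightarrow> a \<in> Q) \<and>
    (\<forall>v\<in>carrier (residue_field R Q). \<exists>a\<in>carrier R. \<exists>s\<in>carrier R - Q. v \<otimes>\<^bsub>residue_field R Q\<^esub> h s = h a))"
proof -
  let ?S = "carrier R - Q"
  interpret Q: primeideal Q R by fact
  interpret S: mult_set R ?S by (rule prime_complement_mult_set[OF Q])
  let ?L = "localization R ?S"
  interpret L: cring ?L by (rule S.localization_cring)
  note Sc = S.S_c S.S_mult S.S_one
  let ?J = "Idl\<^bsub>?L\<^esub> ((\<lambda>a. S.frac a \<one>) ` Q)"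
  \<comment> \<open>An explicit form of the maximal ideal: fractions with numerator in Q. Whether
    the numerator lies in Q does not depend on the representative, since Q is prime.\<close>
  let ?J' = "{S.frac a s |a s. a \<in> Q \<and> s \<in> ?S}"
  have Qc: "a \<in> carrier R" if "a \<in> Q" for a using that by (rule Q.Icarr)
  have J'iff: "S.frac a s \<in> ?J' \<longleftrightarrow> a \<in> Q" if as: "a \<in> carrier R" "s \<in> ?S" for a s
  proof
    assume "S.frac a s \<in> ?J'"
    then obtain b t where bt: "b \<in> Q" "t \<in> ?S" "S.frac a s = S.frac b t" by blast
    then obtain u where u: "u \<in> ?S" "u \<otimes> (t \<otimes> a) = u \<otimes> (s \<otimes> b)" using S.frac_eq_iff[OF as(1) Qc[OF bt(1)] as(2) bt(2)] by blast
    have "u \<otimes> (s \<otimes> b) \<in> Q" using u(1) as(2) bt(1) by (auto intro!: Q.I_l_closed)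
    then have "(u \<otimes> t) \<otimes> a \<in> Q" using u bt(2) as(1) by (simp add: m_assoc)
    moreover have ut: "u \<otimes> t \<in> ?S" by (rule S.S_mult[OF u(1) bt(2)])
    ultimately show "a \<in> Q" using Q.I_prime[of "u \<otimes> t" a] as(1) by blast
  qed (use as in blast)
  have J'ideal: "ideal ?J' ?L"
  proof (rule idealI[OF L.ring_axioms])
    have sub: "?J' \<subseteq> carrier ?L" using S.frac_closed Qc by auto
    have ne: "?J' \<noteq> {}" using Q.zero_closed S.S_one by blast
    have plus: "x \<oplus>\<^bsub>?L\<^esub> y \<in> ?J'" if x: "x \<in> ?J'" and y: "y \<in> ?J'" for x y
    proof -
      obtain a s where a: "a \<in> Q" "s \<in> ?S" "x = S.frac a s" using x by blast
      obtain b t where b: "b \<in> Q" "t \<in> ?S" "y = S.frac b t" using y by blast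
      have "t \<otimes> a \<oplus> s \<otimes> b \<in> Q" using a b by (intro Q.a_closed Q.I_l_closed) auto
      moreover have "x \<oplus>\<^bsub>?L\<^esub> y = S.frac (t \<otimes> a \<oplus> s \<otimes> b) (s \<otimes> t)" using a b Qc by (simp add: S.frac_add)
      ultimately show ?thesis using S.S_mult[OF a(2) b(2)] by blast
    qed
    have neg: "\<ominus>\<^bsub>?L\<^esub> x \<in> ?J'" if x: "x \<in> ?J'" for x
    proof -
      obtain a s where a: "a \<in> Q" "s \<in> ?S" "x = S.frac a s" using x by blast
      have ac: "a \<in> carrier R" by (rule Qc[OF a(1)])
      have "S.frac (\<ominus> a) s \<oplus>\<^bsub>?L\<^esub> x = S.frac (s \<otimes> (\<ominus> a) \<oplus> s \<otimes> a) (s \<otimes> s)" using a(2,3) ac by (simp add: S.frac_add)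
      also have "s \<otimes> (\<ominus> a) \<oplus> s \<otimes> a = \<zero>" using a(2) ac by (simp add: r_minus l_neg)
      also have "S.frac \<zero> (s \<otimes> s) = S.frac \<zero> \<one>" using S.S_mult[OF a(2) a(2)] S.S_one by (intro S.frac_eqI) auto
      finally have "S.frac (\<ominus> a) s \<oplus>\<^bsub>?L\<^esub> x = \<zero>\<^bsub>?L\<^esub>" by (simp add: S.loc_zero)
      then have "\<ominus>\<^bsub>?L\<^esub> x = S.frac (\<ominus> a) s"
        using a ac by (intro L.minus_equality) (auto intro: S.frac_closed)
      moreover have "\<ominus> a \<in> Q" using a(1) by (rule Q.a_inv_closed)
      ultimately show ?thesis using a(2) by blast
    qed
    show "subgroup ?J' (add_monoid ?L)"
      by (rule L.add.subgroupI[OF sub ne neg plus])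
  next
    fix x y assume x: "x \<in> ?J'" and y: "y \<in> carrier ?L"
    obtain a s where a: "a \<in> Q" "s \<in> ?S" "x = S.frac a s" using x by blast
    obtain b t where b: "b \<in> carrier R" "t \<in> ?S" "y = S.frac b t" using y unfolding S.loc_carrier by blast
    have ac: "a \<in> carrier R" by (rule Qc[OF a(1)])
    have "b \<otimes> a \<in> Q" by (rule Q.I_l_closed[OF a(1) b(1)])
    moreover have "y \<otimes>\<^bsub>?L\<^esub> x = S.frac (b \<otimes> a) (t \<otimes> s)" unfolding a(3) b(3) by (rule S.frac_mult[OF b(1,2) ac a(2)])
    ultimately show yx: "y \<otimes>\<^bsub>?L\<^esub> x \<in> ?J'" using S.S_mult[OF b(2) a(2)] by blast
    have "x \<in> carrier ?L" unfolding a(3) by (rule S.frac_closed[OF ac a(2)])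
    then show "x \<otimes>\<^bsub>?L\<^esub> y \<in> ?J'" using yx L.m_comm[of x y] y by simp
  qed
  have sub: "(\<lambda>a. S.frac a \<one>) ` Q \<subseteq> carrier ?L" using S.frac_closed[OF Qc S.S_one] by blast
  have Jideal: "ideal ?J ?L" by (rule L.genideal_ideal[OF sub])
  have JJ': "?J = ?J'"
  proof
    show "?J \<subseteq> ?J'" by (rule L.genideal_minimal[OF J'ideal]) (use S.S_one in blast)
    show "?J' \<subseteq> ?J"
    proof
      fix x assume "x \<in> ?J'"
      then obtain a s where a: "a \<in> Q" "s \<in> ?S" "x = S.frac a s" by blast
      have ac: "a \<in> carrier R" by (rule Qc[OF a(1)])
      have "S.frac \<one> s \<otimes>\<^bsub>?L\<^esub> S.frac a \<one> = x" using a(2,3) ac S.S_one by (simp add: S.frac_mult)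
      moreover have "S.frac a \<one> \<in> ?J" using L.genideal_self[OF sub] a(1) by blast
      ultimately show "x \<in> ?J" using ideal.I_l_closed[OF Jideal _ S.frac_closed[OF one_closed a(2)], of "S.frac a \<one>"] by simp
    qed
  qed
  have Jiff: "S.frac a s \<in> ?J \<longleftrightarrow> a \<in> Q" if "a \<in> carrier R" "s \<in> ?S" for a s
    using J'iff[OF that] JJ' by simp
  have oneQ: "\<one> \<notin> Q" using S.S_one by simp
  have max: "maximalideal ?J ?L"
  proof (rule maximalidealI[OF Jideal])
    have "\<one>\<^bsub>?L\<^esub> \<notin> ?J" unfolding S.loc_one using Jiff[OF one_closed S.S_one] oneQ by simp
    then show "carrier ?L \<noteq> ?J" using L.one_closed by blast
    fix I assume I: "ideal I ?L" "?J \<subseteq> I" "I \<subseteq> carrier ?L"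
    show "I = ?J \<or> I = carrier ?L"
    proof (rule disjCI)
      assume "I \<noteq> carrier ?L"
      have "x \<in> ?J" if x: "x \<in> I" for x
      proof (rule ccontr)
        assume nJ: "x \<notin> ?J"
        obtain a s where a: "a \<in> carrier R" "s \<in> ?S" "x = S.frac a s" using I(3) x S.loc_carrier by blast
        then have aS: "a \<in> ?S" using nJ Jiff by blast
        have sc: "s \<in> carrier R" using a(2) by simp
        \<comment> \<open>A fraction whose numerator is outside Q is a unit.\<close>
        have "S.frac s a \<otimes>\<^bsub>?L\<^esub> x = S.frac (s \<otimes> a) (a \<otimes> s)" unfolding a(3) by (rule S.frac_mult[OF sc aS a(1,2)])
        also have "\<dots> = \<one>\<^bsub>?L\<^esub>" unfolding S.loc_one
          using S.S_mult[OF aS a(2)] a(1) sc S.S_one by (intro S.frac_eqI) (auto simp: m_comm)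
        finally have "\<one>\<^bsub>?L\<^esub> \<in> I" using ideal.I_l_closed[OF I(1) x S.frac_closed[OF sc aS]] by simp
        then have "I = carrier ?L" by (rule ideal.one_imp_carrier[OF I(1)])
        then show False using \<open>I \<noteq> carrier ?L\<close> by blast
      qed
      then show "I = ?J" using I(2) by blast
    qed
  qed
  have K: "residue_field R Q = ?L Quot ?J" by (simp add: residue_field_def local_ring_def)
  have fld: "field (residue_field R Q)" unfolding K by (rule maximalideal.quotient_is_field[OF max L.is_cring])
  let ?\<pi> = "\<lambda>x. ?J +>\<^bsub>?L\<^esub> x"
  let ?h = "\<lambda>a. ?\<pi> (S.frac a \<one>)"
  have \<pi>: "?\<pi> \<in> ring_hom ?L (residue_field R Q)" unfolding K by (rule ideal.rcos_ring_hom[OF Jideal])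
  have h: "?h \<in> ring_hom R (residue_field R Q)"
    using ring_hom_trans[OF S.frac_one_hom \<pi>] by (simp add: comp_def)
  have zero: "?h a = \<zero>\<^bsub>residue_field R Q\<^esub> \<longleftrightarrow> a \<in> Q" if a: "a \<in> carrier R" for a
  proof -
    have z: "\<zero>\<^bsub>residue_field R Q\<^esub> = ?J" unfolding K by (simp add: FactRing_def)
    have c: "S.frac a \<one> \<in> carrier ?L" by (rule S.frac_closed[OF a S.S_one])
    have "?h a = ?J \<longleftrightarrow> S.frac a \<one> \<in> ?J"
      using ideal.rcos_const_imp_mem[OF Jideal c] L.a_rcos_zero[OF Jideal] by blast
    then show ?thesis unfolding z using Jiff[OF a S.S_one] by simp
  qed
  have surj: "\<exists>a\<in>carrier R. \<exists>s\<in>?S. v \<otimes>\<^bsub>residue_field R Q\<^esub> ?h s = ?h a" if v: "v \<in> carrier (residue_field R Q)" for v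
  proof -
    obtain x where x: "x \<in> carrier ?L" "v = ?\<pi> x" using v unfolding K by (auto simp: FactRing_def A_RCOSETS_defs a_r_coset_def)
    obtain a s where a: "a \<in> carrier R" "s \<in> ?S" "x = S.frac a s" using x S.loc_carrier by blast
    have sc: "s \<in> carrier R" using a(2) by simp
    have "v \<otimes>\<^bsub>residue_field R Q\<^esub> ?h s = ?\<pi> (x \<otimes>\<^bsub>?L\<^esub> S.frac s \<one>)"
      unfolding x(2) by (rule ring_hom_mult[OF \<pi> x(1) S.frac_closed[OF sc S.S_one], symmetric])
    also have "x \<otimes>\<^bsub>?L\<^esub> S.frac s \<one> = S.frac (a \<otimes> s) (s \<otimes> \<one>)" unfolding a(3) by (rule S.frac_mult[OF a(1,2) sc S.S_one])
    also have "\<dots> = S.frac a \<one>" using a sc S.S_one by (intro S.frac_eqI) (auto simp: m_comm)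
    finally show ?thesis using a by blast
  qed
  show ?thesis by (intro conjI fld bexI[OF _ h] ballI zero surj)
qed

text \<open>The additive order of 1 in K divides the prime p, and it is not 1 because 1 and 0 differ
  in a field.\<close>

lemma (in frob) frob_image:
  assumes K: "field K" and h: "h \<in> ring_hom R K"
  shows "frob K p"
proof -
  interpret K: field K by fact
  have c: "\<one>\<^bsub>K\<^esub> \<in> carrier K" by simp
  have pow: "h (add_pow R n \<one>) = add_pow K n \<one>\<^bsub>K\<^esub>" for n :: nat
  proof (induction n)
    case 0
    have "h \<zero> \<oplus>\<^bsub>K\<^esub> h \<zero> = h \<zero>" "h \<zero> \<in> carrier K"
      using ring_hom_add[OF h zero_closed zero_closed] ring_hom_closed[OF h zero_closed] by simp_all
    then have "h \<zero> = \<zero>\<^bsub>K\<^esub>" by (metis K.add.r_cancel_one')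
    then show ?case by simp
  next
    case (Suc n)
    then show ?case using ring_hom_add[OF h, of "add_pow R n \<one>" \<one>] ring_hom_one[OF h] by simp
  qed
  have "add_pow R p \<one> = \<zero>" using add_pow_p[OF one_closed, of 1] by simp
  moreover have "add_pow R (0::nat) \<one> = \<zero>" by simp
  ultimately have "add_pow K p \<one>\<^bsub>K\<^esub> = \<zero>\<^bsub>K\<^esub>" using pow[of p] pow[of 0] by simp
  then have "group.ord (add_monoid K) \<one>\<^bsub>K\<^esub> dvd p"
    using K.add.pow_eq_id[OF c, of p] by simp
  moreover have "group.ord (add_monoid K) \<one>\<^bsub>K\<^esub> \<noteq> 1"
  proof
    assume "group.ord (add_monoid K) \<one>\<^bsub>K\<^esub> = 1"
    then have "\<one>\<^bsub>K\<^esub> = \<zero>\<^bsub>K\<^esub>" by (rule iffD1[OF K.add.ord_eq_1[OF c]])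
    then show False by simp
  qed
  ultimately have "group.ord (add_monoid K) \<one>\<^bsub>K\<^esub> = p"
    using prime_p by (metis prime_nat_iff)
  then have "ring_char K = p" by (simp only: ring_char_def)
  then show ?thesis by (intro frob.intro K.is_cring frob_axioms.intro prime_p)
qed

text \<open>The images of a lifted basis form a basis of F^e_*K over K. Spanning and independence
  are transferred by clearing denominators with q-th powers of elements outside Q.\<close>

lemma (in frob) frob_degree_qbasis:
  assumes Q: "primeideal Q R" and K: "field K" and h: "h \<in> ring_hom R K"
    and zero: "\<And>a. a \<in> carrier R \<Longrightarrow> h a = \<zero>\<^bsub>K\<^esub> \<longleftrightarrow> a \<in> Q"
    and surj: "\<And>v. v \<in> carrier K \<Longrightarrow> \<exists>a\<in>carrier R. \<exists>s\<in>carrier R - Q. v \<otimes>\<^bsub>K\<^esub> h s = h a"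
    and ys: "qbasis R (p ^ e) Q ys"
  shows "frob_degree K p e = length ys"
proof -
  interpret K: field K by fact
  interpret KF: frob K p by (rule frob_image[OF K h])
  interpret hom: ring_hom_cring R K h
    by (intro ring_hom_cring.intro ring_hom_cring_axioms.intro is_cring K.is_cring h)
  let ?V = "frob_push K p e (self_module K)"
  interpret V: vectorspace K ?V
    by (intro vectorspace.intro KF.S.frob_push_module K)
  have Qi: "ideal Q R" using Q by (simp add: primeideal.axioms)
  have Qc: "Q \<subseteq> carrier R" by (rule ideal_in_carrier[OF Qi])
  have oneQ: "\<one> \<in> carrier R - Q" using one_notin_prime[OF Q] by simp
  have span: "V.span A = KF.fhull e A" if "A \<subseteq> carrier K" for A
    using KF.S.span_frob_push[of A e] that by simp
  have hp: "h (a [^] n) = (h a) [^]\<^bsub>K\<^esub> n" if "a \<in> carrier R" for a and n :: nat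
    using that by (induction n) simp_all
  have hnz: "h s \<noteq> \<zero>\<^bsub>K\<^esub>" if "s \<in> carrier R - Q" for s using zero[of s] that by auto
  have in_span: "\<exists>s\<in>carrier R - Q. \<exists>c\<in>fhull e (Q \<union> set zs). ((h s) [^]\<^bsub>K\<^esub> (p ^ e)) \<otimes>\<^bsub>K\<^esub> v = h c"
    if zs: "set zs \<subseteq> carrier R" and v: "v \<in> KF.fhull e (h ` set zs)" for zs v
  proof -
    let ?H = "fhull e (Q \<union> set zs)"
    have H: "fsub e ?H" by (rule fsub_fhull) (use Qc zs in simp)
    note hs = fsubD[OF H]
    \<comment> \<open>Vectors that come from the span in R after clearing a denominator. Closure
      under a scalar r of K uses a quotient representation r h(t) = h(b) and the new denominator s
      t.\<close>
    let ?Z = "{v \<in> carrier K. \<exists>s\<in>carrier R - Q. \<exists>c\<in>?H. ((h s) [^]\<^bsub>K\<^esub> (p ^ e)) \<otimes>\<^bsub>K\<^esub> v = h c}"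
    have Z: "KF.fsub e ?Z"
    proof (rule KF.fsubI)
      show "\<zero>\<^bsub>K\<^esub> \<in> ?Z" using oneQ hs(2) by (auto intro!: bexI[of _ \<one>] bexI[of _ \<zero>])
    next
      fix v w assume "v \<in> ?Z" "w \<in> ?Z"
      then obtain s c t d where a: "v \<in> carrier K" "s \<in> carrier R - Q" "c \<in> ?H" "((h s) [^]\<^bsub>K\<^esub> (p ^ e)) \<otimes>\<^bsub>K\<^esub> v = h c"
        "w \<in> carrier K" "t \<in> carrier R - Q" "d \<in> ?H" "((h t) [^]\<^bsub>K\<^esub> (p ^ e)) \<otimes>\<^bsub>K\<^esub> w = h d" by blast
      have cc: "c \<in> carrier R" "d \<in> carrier R" "s \<in> carrier R" "t \<in> carrier R" using a hs(1) by auto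
      note hc = hom.hom_closed[OF cc(3)] hom.hom_closed[OF cc(4)]
      have "((h (s \<otimes> t)) [^]\<^bsub>K\<^esub> (p ^ e)) \<otimes>\<^bsub>K\<^esub> (v \<oplus>\<^bsub>K\<^esub> w)
          = ((h t) [^]\<^bsub>K\<^esub> (p ^ e)) \<otimes>\<^bsub>K\<^esub> (((h s) [^]\<^bsub>K\<^esub> (p ^ e)) \<otimes>\<^bsub>K\<^esub> v) \<oplus>\<^bsub>K\<^esub> ((h s) [^]\<^bsub>K\<^esub> (p ^ e)) \<otimes>\<^bsub>K\<^esub> (((h t) [^]\<^bsub>K\<^esub> (p ^ e)) \<otimes>\<^bsub>K\<^esub> w)"
        using cc hc a(1,5) by (simp add: K.nat_pow_distrib K.r_distr K.l_distr K.m_ac)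
      also have "\<dots> = h ((t [^] (p ^ e)) \<otimes> c \<oplus> (s [^] (p ^ e)) \<otimes> d)"
        unfolding a(4,8) using cc by (simp add: hp)
      finally have "((h (s \<otimes> t)) [^]\<^bsub>K\<^esub> (p ^ e)) \<otimes>\<^bsub>K\<^esub> (v \<oplus>\<^bsub>K\<^esub> w) = h ((t [^] (p ^ e)) \<otimes> c \<oplus> (s [^] (p ^ e)) \<otimes> d)" .
      moreover have "(t [^] (p ^ e)) \<otimes> c \<oplus> (s [^] (p ^ e)) \<otimes> d \<in> ?H"
        by (rule hs(3)[OF hs(4)[OF cc(4) a(3)] hs(4)[OF cc(3) a(7)]])
      moreover have "s \<otimes> t \<in> carrier R - Q" by (rule prod_notin_prime[OF Q a(2,6)])
      moreover have "v \<oplus>\<^bsub>K\<^esub> w \<in> carrier K" using a(1,5) by simp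
      ultimately show "v \<oplus>\<^bsub>K\<^esub> w \<in> ?Z" by blast
    next
      fix r v assume r: "r \<in> carrier K" and "v \<in> ?Z"
      then obtain s c where a: "v \<in> carrier K" "s \<in> carrier R - Q" "c \<in> ?H" "((h s) [^]\<^bsub>K\<^esub> (p ^ e)) \<otimes>\<^bsub>K\<^esub> v = h c" by blast
      obtain b t where b: "b \<in> carrier R" "t \<in> carrier R - Q" "r \<otimes>\<^bsub>K\<^esub> h t = h b" using surj[OF r] by blast
      have cc: "c \<in> carrier R" "s \<in> carrier R" "t \<in> carrier R" using a b hs(1) by auto
      note hc = hom.hom_closed[OF cc(2)] hom.hom_closed[OF cc(3)]
      have "((h (s \<otimes> t)) [^]\<^bsub>K\<^esub> (p ^ e)) \<otimes>\<^bsub>K\<^esub> ((r [^]\<^bsub>K\<^esub> (p ^ e)) \<otimes>\<^bsub>K\<^esub> v)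
          = ((r \<otimes>\<^bsub>K\<^esub> h t) [^]\<^bsub>K\<^esub> (p ^ e)) \<otimes>\<^bsub>K\<^esub> (((h s) [^]\<^bsub>K\<^esub> (p ^ e)) \<otimes>\<^bsub>K\<^esub> v)"
        using cc hc a(1) r by (simp add: K.nat_pow_distrib K.m_ac)
      also have "\<dots> = h ((b [^] (p ^ e)) \<otimes> c)" unfolding a(4) b(3) using cc b(1) by (simp add: hp)
      finally have "((h (s \<otimes> t)) [^]\<^bsub>K\<^esub> (p ^ e)) \<otimes>\<^bsub>K\<^esub> ((r [^]\<^bsub>K\<^esub> (p ^ e)) \<otimes>\<^bsub>K\<^esub> v) = h ((b [^] (p ^ e)) \<otimes> c)" .
      moreover have "(b [^] (p ^ e)) \<otimes> c \<in> ?H" by (rule hs(4)[OF b(1) a(3)])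
      moreover have "s \<otimes> t \<in> carrier R - Q" by (rule prod_notin_prime[OF Q a(2) b(2)])
      moreover have "(r [^]\<^bsub>K\<^esub> (p ^ e)) \<otimes>\<^bsub>K\<^esub> v \<in> carrier K" using a(1) r by simp
      ultimately show "(r [^]\<^bsub>K\<^esub> (p ^ e)) \<otimes>\<^bsub>K\<^esub> v \<in> ?Z" by blast
    qed auto
    have "h ` set zs \<subseteq> ?Z"
    proof
      fix v assume "v \<in> h ` set zs"
      then obtain z where z: "z \<in> set zs" "v = h z" by blast
      have zc: "z \<in> carrier R" using z zs by auto
      have "((h \<one>) [^]\<^bsub>K\<^esub> (p ^ e)) \<otimes>\<^bsub>K\<^esub> v = h z" using zc z by simp
      moreover have "z \<in> ?H" using z(1) by (intro qhull_base) simp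
      ultimately show "v \<in> ?Z" using oneQ zc z(2) hom.hom_closed by blast
    qed
    then have "KF.fhull e (h ` set zs) \<subseteq> ?Z" by (rule qhull_least[OF Z])
    then show ?thesis using v by blast
  qed
  have indep: "V.lin_indpt (h ` set zs) \<and> card (h ` set zs) = length zs" if "strict R (p ^ e) Q Q zs" for zs
    using that
  proof (induction zs)
    case Nil
    show ?case by (simp add: V.lin_dep_def)
  next
    case (Cons z zs)
    have zc: "z \<in> carrier R" "set zs \<subseteq> carrier R" using strict_carrier[OF Cons.prems] by auto
    have hzs: "h ` set zs \<subseteq> carrier K" using zc hom.hom_closed by auto
    let ?H = "fhull e (Q \<union> set zs)"
    have H: "fsub e ?H" by (rule fsub_fhull) (use Qc zc in simp)
    have nspan: "h z \<notin> V.span (h ` set zs)"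
    proof
      assume "h z \<in> V.span (h ` set zs)"
      then obtain s c where sc: "s \<in> carrier R - Q" "c \<in> ?H" "((h s) [^]\<^bsub>K\<^esub> (p ^ e)) \<otimes>\<^bsub>K\<^esub> h z = h c"
        using in_span[OF zc(2), of "h z"] span[OF hzs] by auto
      have cc: "c \<in> carrier R" "s \<in> carrier R" using sc fsubD(1)[OF H] by auto
      let ?t = "(s [^] (p ^ e)) \<otimes> z"
      have tc: "?t \<in> carrier R" using cc zc by simp
      have "h ?t = h c" using sc(3) cc zc(1) by (simp add: hp)
      then have "h (?t \<ominus> c) = \<zero>\<^bsub>K\<^esub>" using tc cc hom.hom_closed[OF cc(1)] by (simp add: minus_eq K.r_neg)
      then have "?t \<ominus> c \<in> Q" using zero[of "?t \<ominus> c"] tc cc by simp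
      then have "?t \<ominus> c \<in> ?H" by (intro qhull_base) simp
      then have "?t \<in> ?H" by (rule fsub_cancel_diff[OF H _ sc(2) tc])
      then show False using Cons.prems sc(1) by auto
    qed
    have hzV: "h ` set zs \<subseteq> carrier ?V" "h z \<in> carrier ?V" using hzs hom.hom_closed[OF zc(1)] by simp_all
    have nin: "h z \<notin> h ` set zs" using nspan V.in_own_span[OF hzV(1)] by blast
    have IH: "V.lin_indpt (h ` set zs)" "card (h ` set zs) = length zs" using Cons by simp_all
    have "V.lin_indpt (h ` set zs \<union> {h z})"
      using V.lin_dep_iff_in_span[OF hzV(1) IH(1) hzV(2) nin] nspan by blast
    moreover have "h ` set (z # zs) = h ` set zs \<union> {h z}" by auto
    moreover have "card (h ` set zs \<union> {h z}) = length (z # zs)" using IH(2) nin by simp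
    ultimately show ?case by simp
  qed
  have st: "strict R (p ^ e) Q Q ys" using ys unfolding qbasis_def by blast
  have yc: "set ys \<subseteq> carrier R" by (rule strict_carrier[OF st])
  obtain d where d: "d \<in> carrier R - Q" "\<And>r. r \<in> carrier R \<Longrightarrow> (d [^] (p ^ e)) \<otimes> r \<in> fhull e (Q \<union> set ys)"
    using ys unfolding qbasis_def by blast
  have hys: "h ` set ys \<subseteq> carrier K" using yc hom.hom_closed by auto
  let ?HK = "KF.fhull e (h ` set ys)"
  have HK: "KF.fsub e ?HK" by (rule KF.fsub_fhull[OF hys])
  let ?U = "{c \<in> carrier R. h c \<in> ?HK}"
  have U: "fsub e ?U"
  proof (rule fsubI)
    note k = KF.fsubD[OF HK]
    show "\<zero> \<in> ?U" using k(2) by simp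
    show "x \<oplus> y \<in> ?U" if "x \<in> ?U" "y \<in> ?U" for x y using that k(3) by simp
    show "(r [^] (p ^ e)) \<otimes> x \<in> ?U" if "r \<in> carrier R" "x \<in> ?U" for r x
      using that k(4)[of "h r" "h x"] by (simp add: hp)
  qed auto
  have "Q \<union> set ys \<subseteq> ?U"
  proof
    fix x assume x: "x \<in> Q \<union> set ys"
    then have xc: "x \<in> carrier R" using Qc yc by auto
    have "h x \<in> ?HK"
    proof (cases "x \<in> Q")
      case True
      then show ?thesis using zero[OF xc] KF.fsubD(2)[OF HK] by simp
    next
      case False
      then show ?thesis using x by (intro qhull_base) simp
    qed
    then show "x \<in> ?U" using xc by simp
  qed
  then have HU: "fhull e (Q \<union> set ys) \<subseteq> ?U" by (rule qhull_least[OF U])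
  have "carrier K \<subseteq> ?HK"
  proof
    fix v assume v: "v \<in> carrier K"
    obtain a s where as: "a \<in> carrier R" "s \<in> carrier R - Q" "v \<otimes>\<^bsub>K\<^esub> h s = h a" using surj[OF v] by blast
    \<comment> \<open>From v h(s) = h(a) one needs a denominator that is a p^e-th power; multiplying
      by s^n with n = p^e - 1 provides it.\<close>
    obtain n where n: "p ^ e = Suc n" using p_gt_1 by (cases "p ^ e") auto
    have cc: "s \<in> carrier R" "d \<in> carrier R" using as(2) d(1) by auto
    note hc = hom.hom_closed[OF cc(1)] hom.hom_closed[OF cc(2)]
    have "(d [^] (p ^ e)) \<otimes> ((s [^] n) \<otimes> a) \<in> ?U" using HU d(2)[of "(s [^] n) \<otimes> a"] cc as(1) by auto
    then have 1: "h ((d [^] (p ^ e)) \<otimes> ((s [^] n) \<otimes> a)) \<in> ?HK" by simp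
    have "h ((d [^] (p ^ e)) \<otimes> ((s [^] n) \<otimes> a)) = ((h d) [^]\<^bsub>K\<^esub> (p ^ e)) \<otimes>\<^bsub>K\<^esub> (((h s) [^]\<^bsub>K\<^esub> n) \<otimes>\<^bsub>K\<^esub> (v \<otimes>\<^bsub>K\<^esub> h s))"
      unfolding as(3) using cc as(1) by (simp add: hp)
    also have "\<dots> = ((h d) [^]\<^bsub>K\<^esub> (p ^ e)) \<otimes>\<^bsub>K\<^esub> (((h s) [^]\<^bsub>K\<^esub> (p ^ e)) \<otimes>\<^bsub>K\<^esub> v)"
      unfolding n using hc v by (simp add: K.m_ac)
    also have "\<dots> = ((h d \<otimes>\<^bsub>K\<^esub> h s) [^]\<^bsub>K\<^esub> (p ^ e)) \<otimes>\<^bsub>K\<^esub> v"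
      using hc v by (simp add: K.nat_pow_distrib K.m_assoc)
    finally have 2: "h ((d [^] (p ^ e)) \<otimes> ((s [^] n) \<otimes> a)) = ((h d \<otimes>\<^bsub>K\<^esub> h s) [^]\<^bsub>K\<^esub> (p ^ e)) \<otimes>\<^bsub>K\<^esub> v" .
    let ?w = "h d \<otimes>\<^bsub>K\<^esub> h s"
    have wc: "?w \<in> carrier K" using hc by simp
    have "?w \<noteq> \<zero>\<^bsub>K\<^esub>" using K.integral_iff[OF hc(2,1)] hnz[OF d(1)] hnz[OF as(2)] by simp
    then have wU: "?w \<in> Units K" using K.field_Units wc by simp
    then have iw: "inv\<^bsub>K\<^esub> ?w \<in> carrier K" "inv\<^bsub>K\<^esub> ?w \<otimes>\<^bsub>K\<^esub> ?w = \<one>\<^bsub>K\<^esub>" by simp_all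
    have "((inv\<^bsub>K\<^esub> ?w) [^]\<^bsub>K\<^esub> (p ^ e)) \<otimes>\<^bsub>K\<^esub> ((?w [^]\<^bsub>K\<^esub> (p ^ e)) \<otimes>\<^bsub>K\<^esub> v) \<in> ?HK"
      using KF.fsubD(4)[OF HK iw(1) 1] unfolding 2 .
    moreover have "((inv\<^bsub>K\<^esub> ?w) [^]\<^bsub>K\<^esub> (p ^ e)) \<otimes>\<^bsub>K\<^esub> ((?w [^]\<^bsub>K\<^esub> (p ^ e)) \<otimes>\<^bsub>K\<^esub> v) = ((inv\<^bsub>K\<^esub> ?w \<otimes>\<^bsub>K\<^esub> ?w) [^]\<^bsub>K\<^esub> (p ^ e)) \<otimes>\<^bsub>K\<^esub> v"
      using K.nat_pow_distrib[OF iw(1) wc] iw(1) wc v by (simp add: K.m_assoc)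
    ultimately show "v \<in> ?HK" using iw(2) v by simp
  qed
  then have gen: "V.span (h ` set ys) = carrier ?V" using span[OF hys] KF.fhull_carrier[OF hys, of e] by auto
  have "V.basis (h ` set ys)" unfolding V.basis_def using indep[OF st] gen hys by simp
  then have "V.dim = card (h ` set ys)" by (intro V.dim_basis) simp
  then show ?thesis unfolding frob_degree_def using indep[OF st] by simp
qed

section \<open>Identification of \<alpha> and \<gamma> with ranks\<close>

context F_finite_ring
begin

lemma frob_degree_residue_field:
  assumes Q: "primeideal Q R"
  shows "frob_degree (residue_field R Q) p e = rank Q ^ e"
proof -
  obtain ys where ys: "qbasis R (p ^ e) Q ys" "length ys = rank Q ^ e" using rank_basis[OF Q] by blast
  obtain h where "h \<in> ring_hom R (residue_field R Q)"
    "\<And>a. a \<in> carrier R \<Longrightarrow> h a = \<zero>\<^bsub>residue_field R Q\<^esub> \<longleftrightarrow> a \<in> Q"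
    "\<And>v. v \<in> carrier (residue_field R Q) \<Longrightarrow> \<exists>a\<in>carrier R. \<exists>s\<in>carrier R - Q. v \<otimes>\<^bsub>residue_field R Q\<^esub> h s = h a"
    "field (residue_field R Q)"
    using residue_field_props[OF Q] by blast
  from frob_degree_qbasis[OF Q this(4,1,2,3) ys(1)] ys(2) show ?thesis by simp
qed

text \<open>The degree is \<open>rank Q\<close>^e, so its logarithm to base p^e is the same for
  every e > 0; this gives the definite description its unique value.\<close>

lemma frob_alpha_eq:
  assumes Q: "primeideal Q R"
  shows "frob_alpha R p Q = log (real p) (real (rank Q))"
proof -
  have p: "1 < real p" and r: "0 < real (rank Q)" using p_gt_1 rank_pos[OF Q] by simp_all
  have l: "log (real (p ^ e)) (real (frob_degree (residue_field R Q) p e)) = log (real p) (real (rank Q))" if "e > 0" for e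
    unfolding frob_degree_residue_field[OF Q]
    using p r that by (simp add: log_nat_power log_base_pow)
  show ?thesis unfolding frob_alpha_def
  proof (rule the_equality)
    show "\<forall>e>0. log (real p) (real (rank Q)) = log (real (p ^ e)) (real (frob_degree (residue_field R Q) p e))"
      using l by simp
    show "a = log (real p) (real (rank Q))"
      if "\<forall>e>0. a = log (real (p ^ e)) (real (frob_degree (residue_field R Q) p e))" for a
      using l[of 1] spec[OF that, of 1] by simp
  qed
qed

text \<open>The logarithm is increasing and ranks are at least 1, so the maximum of the \<alpha>(P)
  is the logarithm of the maximal rank.\<close>

lemma powr_frob_gamma: "real p powr (real e * frob_gamma R p) = real max_rank ^ e"
proof -
  have p: "1 < real p" and m: "0 < real max_rank" using p_gt_1 max_rank_pos by simp_all
  note fin = min_primes_props(1) and ne = min_primes_props(2)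
  have al: "frob_alpha R p P = log (real p) (real (rank P))" if "P \<in> min_primes R" for P
    using that by (intro frob_alpha_eq) (simp add: min_primes_def)
  have "frob_gamma R p = log (real p) (real max_rank)"
    unfolding frob_gamma_def
  proof (rule Max_eqI)
    show "finite (frob_alpha R p ` min_primes R)" using fin by simp
    show "y \<le> log (real p) (real max_rank)" if y: "y \<in> frob_alpha R p ` min_primes R" for y
    proof -
      obtain P where P: "P \<in> min_primes R" "y = frob_alpha R p P" using y by blast
      have "1 \<le> rank P" using P(1) by (intro rank_pos) (simp add: min_primes_def)
      then show ?thesis using al[OF P(1)] P(2) rank_le_max_rank[OF P(1)] p by simp
    qed
    have "max_rank \<in> rank ` min_primes R" unfolding max_rank_def using fin ne by (intro Max_in) simp_all
    then obtain P where P: "P \<in> min_primes R" "max_rank = rank P" by blast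
    then show "log (real p) (real max_rank) \<in> frob_alpha R p ` min_primes R"
      using al[OF P(1)] by (intro image_eqI[of _ _ P]) simp_all
  qed
  then have "real p powr (real e * frob_gamma R p) = (real p powr log (real p) (real max_rank)) powr real e"
    by (simp add: powr_powr mult.commute)
  also have "real p powr log (real p) (real max_rank) = real max_rank" using p m by simp
  also have "real max_rank powr real e = real max_rank ^ e" using m by (simp add: powr_realpow)
  finally show ?thesis .
qed

end

theorem theorem3p9:
  fixes R :: "('a, 'r) ring_scheme" and M :: "('a, 'b, 'm) module_scheme" and p :: nat
  assumes "cring R" and "noetherian_ring R"
    and "Factorial_Ring.prime p" and "ring_char R = p"
    and "F_finite R p"
    and "Module.module R M" and "fin_gen R M"
  shows "convergent (\<lambda>e. real (min_gens R (frob_push R p e M)) / real p powr (real e * frob_gamma R p)) \<and>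
    (\<exists>C :: real. \<forall>e :: nat.
       e_HK R p M \<le> real (min_gens R (frob_push R p e M)) / real p powr (real e * frob_gamma R p)
                      + C / real p ^ e)"
proof -
  interpret frob R p by (intro frob.intro frob_axioms.intro assms)
  obtain e where e: "e \<ge> 1" "fin_gen R (frob_push R p e (self_module R))"
    using assms(5) unfolding F_finite_def by blast
  then obtain n where "gens e {} n" using S.fin_gen_frob_push by blast
  then obtain A where A: "finite A" "card A \<le> n" "A \<subseteq> carrier R" "carrier R \<subseteq> fhull e ({} \<union> A)" by (rule gensE)
  obtain k where k: "e = 1 + k" using e(1) le_Suc_ex by blast
  \<comment> \<open>F-finiteness is given for some e >= 1 only; the same generators work for e = 1,
    which is what the rank is based on.\<close>
  have "fhull e A \<subseteq> fhull 1 A" using S.qhull_mult_mono[of A "p ^ 1" "p ^ k"] A(3) by (simp add: k)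
  then have "gens 1 {} n" using A by (intro gensI[of A]) auto
  then have "\<exists>n. gens 1 {} n" by blast
  then interpret F_finite_module R p M
    by (intro F_finite_module.intro F_finite_ring.intro F_finite_ring_axioms.intro frob_module.intro frob_axioms assms)
  obtain A0 where A0: "finite A0" "A0 \<subseteq> carrier M" "LinearCombinations.module.span R M A0 = carrier M"
    using assms(7) unfolding fin_gen_def by blast
  \<comment> \<open>M itself is the push-forward with exponent p^0 = 1, so its span is bounded by
    the hull at e = 0.\<close>
  have "LinearCombinations.module.span R M A0 \<subseteq> mhull 0 A0"
    using qsubD[OF qsub_qhull[OF A0(2), of "p ^ 0"]] qhull_superset[of A0 R "p ^ 0" M]
    by (intro span_least) (auto simp: msub0_smult qsub_qhull[OF A0(2)])
  then have "carrier M \<subseteq> mhull 0 A0" using A0(3) by simp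
  from hilbert_kunz_limit[OF A0(1,2) this] show ?thesis
    unfolding e_HK_def powr_frob_gamma .
qed

end
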